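(* Let $\mathcal H$ and $f$ satisfy the assumptions listed in the context. For every $\ell\in L^2(0,T;H^1(\Omega)^* )$, the fatigue damage problem $$\varphi(t)\in\operatorname*{arg\,min}_{\varphi\in H^1(\Omega)}\mathcal E(t,\varphi,q(t)),\qquad-\partial_q\mathcal E(t,\varphi(t),q(t))\in\partial_{\dot q}\mathcal R_\epsilon(\mathcal H(q)(t),\dot q(t))\ \text{ in }L^2(\Omega),\qquad q(0)=0,$$ a.e. in $(0,T)$, admits a unique solution $(q,\varphi)\in H^1_0(0,T;L^2(\Omega))\times L^2(0,T;H^1(\Omega))$, which is characterized by the following system: $$\dot q(t)=\tfrac1\epsilon\max\big(-\beta(q(t)-\varphi(t))-(f\circ\mathcal H)(q)(t)\big)\ \text{ in }L^2(\Omega),\qquad q(0)=0,$$ $$-\alpha\Delta\varphi(t)+\beta\varphi(t)=\beta q(t)+\ell(t)\ \text{ in }H^1(\Omega)^*,$$ a.e. in $(0,T)$.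
   Context: Setting: $T>0$; $\Omega\subset\mathbb R^N$, $N\in\{2,3\}$, is a bounded Lipschitz domain; $\alpha,\beta,\epsilon>0$ are constants. $\Delta:H^1(\Omega)\to H^1(\Omega)^*$ is given by $\langle\Delta\eta,\psi\rangle=-\int_\Omega\nabla\eta\cdot\nabla\psi\,dx$. $\max(x):=\max\{x,0\}$. Scalar functions also denote their Nemytskii operators. $H^1_0(0,T;X)=\{z\in H^1(0,T;X):z(0)=0\}$. A dot is the time derivative. Energy: $\mathcal E:[0,T]\times H^1(\Omega)\times L^2(\Omega)\to\mathbb R$, $\mathcal E(t,\varphi,q)=\frac\alpha2\|\nabla\varphi\|^2_{L^2(\Omega)}+\frac\beta2\|\varphi-q\|^2_{L^2(\Omega)}-\langle\ell(t),\varphi\rangle_{H^1(\Omega)}$. Dissipation: $\mathcal R_\epsilon:L^2(\Omega)\times L^2(\Omega)\to\mathbb R\cup\{\infty\}$, $\mathcal R_\epsilon(\omega,\eta)=\int_\Omega f(\omega)\eta\,dx+\frac\epsilon2\|\eta\|^2_{L^2(\Omega)}$ if $\eta\ge0$ a.e. in $\Omega$, and $\infty$ otherwise. $\partial_{\dot q}\mathcal R_\epsilon$ is the convex subdifferential with respect to the second argument, so the inclusion means $(-\partial_q\mathcal E(t,\varphi(t),q(t)),\eta-\dot q(t))_{L^2(\Omega)}\le\mathcal R_\epsilon(\mathcal H(q)(t),\eta)-\mathcal R_\epsilon(\mathcal H(q)(t),\dot q(t))$ for all $\eta\in L^2(\Omega)$. Assumptions: (a) $\mathcal H:L^2(0,T;L^2(\Omega))\to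 L^2(0,T;L^2(\Omega))$ and there is $L_{\mathcal H}>0$ with $\|\mathcal H(q_1)(t)-\mathcal H(q_2)(t)\|_{L^2(\Omega)}\le L_{\mathcal H}\int_0^t\|q_1(s)-q_2(s)\|_{L^2(\Omega)}ds$ a.e. in $(0,T)$ for all $q_1,q_2\in L^2(0,T;L^2(\Omega))$; $\mathcal H$ is Gâteaux differentiable on $L^2(0,T;L^2(\Omega))$, with derivative $q\mapsto\mathcal H'(q)$ continuous on $H^1(0,T;L^2(\Omega))$. (b) $f:\mathbb R\to\mathbb R$ is Lipschitz continuous with constant $L_f>0$ and directionally differentiable. *)

theory Defs
  imports "HOL-Analysis.Analysis" "HOL-Library.Function_Algebras"
begin

section \<open>Seminormed function spaces\<close>

text \<open>
  Elements of Lebesgue, Sobolev and Bochner spaces are represented by functions. A space is given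
  by the set \<open>X\<close> of its representatives together with a seminorm \<open>N\<close> on \<open>X\<close>, and two
  representatives \<open>u\<close>, \<open>v\<close> denote the same element iff \<open>N (u - v) = 0\<close>. Algebraic operations on
  representatives are pointwise.
\<close>

instantiation "fun" :: (type, real_vector) real_vector
begin

definition scaleR_fun :: "real \<Rightarrow> ('a \<Rightarrow> 'b) \<Rightarrow> 'a \<Rightarrow> 'b"
  where "scaleR_fun c u = (\<lambda>x. c *\<^sub>R u x)"

instance
  by standard (auto simp: scaleR_fun_def fun_eq_iff scaleR_add_right scaleR_add_left)

end

text \<open>
  Linearity is required in the target modulo its seminorm. The bound forces the map to respect
  equality in the source.
\<close>

definition bounded_linear_between ::
    "'v::real_vector set \<Rightarrow> ('v \<Rightarrow> real) \<Rightarrow> 'w::real_vector set \<Rightarrow> ('w \<Rightarrow> real) \<Rightarrow> ('v \<Rightarrow> 'w) \<Rightarrow> bool"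
  where "bounded_linear_between X N Y M A \<longleftrightarrow>
    (\<forall>u\<in>X. A u \<in> Y) \<and>
    (\<forall>u\<in>X. \<forall>v\<in>X. M (A (u + v) - (A u + A v)) = 0) \<and>
    (\<forall>c. \<forall>u\<in>X. M (A (c *\<^sub>R u) - c *\<^sub>R A u) = 0) \<and>
    (\<exists>C. \<forall>u\<in>X. M (A u) \<le> C * N u)"

definition operator_norm :: "'v set \<Rightarrow> ('v \<Rightarrow> real) \<Rightarrow> ('w \<Rightarrow> real) \<Rightarrow> ('v \<Rightarrow> 'w) \<Rightarrow> real"
  where "operator_norm X N M A = (SUP u\<in>{u \<in> X. N u \<le> 1}. M (A u))"

definition dual_space :: "'v::real_vector set \<Rightarrow> ('v \<Rightarrow> real) \<Rightarrow> ('v \<Rightarrow> real) set"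
  where "dual_space X N = {F. bounded_linear_between X N (UNIV :: real set) abs F}"

definition dual_norm :: "'v set \<Rightarrow> ('v \<Rightarrow> real) \<Rightarrow> ('v \<Rightarrow> real) \<Rightarrow> real"
  where "dual_norm X N F = operator_norm X N abs F"


section \<open>Bochner spaces on a time interval\<close>

abbreviation time :: "real \<Rightarrow> real measure"
  where "time T \<equiv> lebesgue_on {0<..<T}"

text \<open>
  The library's Bochner integral lives on Banach-space types. Strong measurability and the integral
  below are its defining clauses, with the norm replaced by \<open>N\<close> and all values taken in \<open>X\<close>.
\<close>

definition strongly_measurable ::
    "real \<Rightarrow> 'v::real_vector set \<Rightarrow> ('v \<Rightarrow> real) \<Rightarrow> (real \<Rightarrow> 'v) \<Rightarrow> bool"
  where "strongly_measurable T X N u \<longleftrightarrow>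
    (AE t in time T. u t \<in> X) \<and>
    (\<exists>s. (\<forall>n. simple_function (time T) (s n) \<and> s n ` {0<..<T} \<subseteq> X) \<and>
         (AE t in time T. (\<lambda>n. N (s n t - u t)) \<longlonglongrightarrow> 0))"

definition has_bochner_integral_in ::
    "real \<Rightarrow> 'v::real_vector set \<Rightarrow> ('v \<Rightarrow> real) \<Rightarrow> (real \<Rightarrow> 'v) \<Rightarrow> 'v \<Rightarrow> bool"
  where "has_bochner_integral_in T X N u I \<longleftrightarrow>
    strongly_measurable T X N u \<and> I \<in> X \<and>
    (\<exists>s. (\<forall>n. Bochner_Integration.simple_bochner_integrable (time T) (s n) \<and> s n ` {0<..<T} \<subseteq> X) \<and>
         (\<lambda>n. \<integral>\<^sup>+t. ennreal (N (u t - s n t)) \<partial>time T) \<longlonglongrightarrow> 0 \<and>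
         (\<lambda>n. N (Bochner_Integration.simple_bochner_integral (time T) (s n) - I)) \<longlonglongrightarrow> 0)"

definition bochner_L2 :: "real \<Rightarrow> 'v::real_vector set \<Rightarrow> ('v \<Rightarrow> real) \<Rightarrow> (real \<Rightarrow> 'v) set"
  where "bochner_L2 T X N =
    {u. strongly_measurable T X N u \<and> integrable (time T) (\<lambda>t. (N (u t))\<^sup>2)}"

definition bochner_L2_norm :: "real \<Rightarrow> ('v \<Rightarrow> real) \<Rightarrow> (real \<Rightarrow> 'v) \<Rightarrow> real"
  where "bochner_L2_norm T N u = sqrt (LINT t|time T. (N (u t))\<^sup>2)"


section \<open>Test functions\<close>

primrec Ck :: "nat \<Rightarrow> ('a::euclidean_space \<Rightarrow> real) \<Rightarrow> bool"
  where
    "Ck 0 \<psi> = continuous_on UNIV \<psi>"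
  | "Ck (Suc k) \<psi> =
      ((\<forall>x. \<psi> differentiable (at x)) \<and> (\<forall>b\<in>Basis. Ck k (\<lambda>x. frechet_derivative \<psi> (at x) b)))"

definition test_functions :: "'a::euclidean_space set \<Rightarrow> ('a \<Rightarrow> real) set"
  where "test_functions S =
    {\<psi>. (\<forall>k. Ck k \<psi>) \<and> compact (closure {x. \<psi> x \<noteq> 0}) \<and> closure {x. \<psi> x \<noteq> 0} \<subseteq> S}"


section \<open>Sobolev spaces in time\<close>

definition has_weak_time_derivative ::
    "real \<Rightarrow> 'v::real_vector set \<Rightarrow> ('v \<Rightarrow> real) \<Rightarrow> (real \<Rightarrow> 'v) \<Rightarrow> (real \<Rightarrow> 'v) \<Rightarrow> bool"
  where "has_weak_time_derivative T X N q w \<longleftrightarrow>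
    (\<forall>\<psi>\<in>test_functions {0<..<T}. \<exists>I.
       has_bochner_integral_in T X N (\<lambda>t. deriv \<psi> t *\<^sub>R q t) I \<and>
       has_bochner_integral_in T X N (\<lambda>t. \<psi> t *\<^sub>R w t) (- I))"

definition bochner_H1 :: "real \<Rightarrow> 'v::real_vector set \<Rightarrow> ('v \<Rightarrow> real) \<Rightarrow> (real \<Rightarrow> 'v) set"
  where "bochner_H1 T X N =
    {q \<in> bochner_L2 T X N. \<exists>w\<in>bochner_L2 T X N. has_weak_time_derivative T X N q w}"

definition time_derivative ::
    "real \<Rightarrow> 'v::real_vector set \<Rightarrow> ('v \<Rightarrow> real) \<Rightarrow> (real \<Rightarrow> 'v) \<Rightarrow> real \<Rightarrow> 'v"
  where "time_derivative T X N q =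
    (SOME w. w \<in> bochner_L2 T X N \<and> has_weak_time_derivative T X N q w)"

definition bochner_H1_norm ::
    "real \<Rightarrow> 'v::real_vector set \<Rightarrow> ('v \<Rightarrow> real) \<Rightarrow> (real \<Rightarrow> 'v) \<Rightarrow> real"
  where "bochner_H1_norm T X N q =
    sqrt ((bochner_L2_norm T N q)\<^sup>2 + (bochner_L2_norm T N (time_derivative T X N q))\<^sup>2)"

text \<open>The value at time 0 is that of the representative which is continuous on \<open>[0,T]\<close>.\<close>

definition vanishes_initially ::
    "real \<Rightarrow> 'v::real_vector set \<Rightarrow> ('v \<Rightarrow> real) \<Rightarrow> (real \<Rightarrow> 'v) \<Rightarrow> bool"
  where "vanishes_initially T X N q \<longleftrightarrow>
    (\<exists>c. (\<forall>t\<in>{0..T}. c t \<in> X) \<and>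
         (\<forall>t\<in>{0..T}. ((\<lambda>s. N (c s - c t)) \<longlongrightarrow> 0) (at t within {0..T})) \<and>
         (AE t in time T. N (q t - c t) = 0) \<and>
         N (c 0) = 0)"

definition bochner_H10 :: "real \<Rightarrow> 'v::real_vector set \<Rightarrow> ('v \<Rightarrow> real) \<Rightarrow> (real \<Rightarrow> 'v) set"
  where "bochner_H10 T X N = {q \<in> bochner_H1 T X N. vanishes_initially T X N q}"


section \<open>Lebesgue and Sobolev spaces on the spatial domain\<close>

text \<open>
  Near each boundary point the domain is, in the coordinates of an orthonormal frame with last
  axis \<open>e\<close>, the part of a ball lying strictly above a Lipschitz graph over the hyperplane
  orthogonal to \<open>e\<close>.
\<close>

definition bounded_lipschitz_domain :: "'a::euclidean_space set \<Rightarrow> bool"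
  where "bounded_lipschitz_domain \<Omega> \<longleftrightarrow>
    open \<Omega> \<and> connected \<Omega> \<and> \<Omega> \<noteq> {} \<and> bounded \<Omega> \<and>
    (\<forall>p\<in>frontier \<Omega>. \<exists>r e \<gamma> L. r > 0 \<and> norm e = 1 \<and> L-lipschitz_on {y. y \<bullet> e = 0} \<gamma> \<and>
       \<Omega> \<inter> ball p r = {x \<in> ball p r. x \<bullet> e > \<gamma> (x - (x \<bullet> e) *\<^sub>R e)})"

definition L2 :: "'a::euclidean_space set \<Rightarrow> ('a \<Rightarrow> real) set"
  where "L2 \<Omega> = {u. u \<in> borel_measurable (lebesgue_on \<Omega>) \<and>
    integrable (lebesgue_on \<Omega>) (\<lambda>x. (u x)\<^sup>2)}"

definition L2_inner :: "'a::euclidean_space set \<Rightarrow> ('a \<Rightarrow> real) \<Rightarrow> ('a \<Rightarrow> real) \<Rightarrow> real"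
  where "L2_inner \<Omega> u v = (LINT x|lebesgue_on \<Omega>. u x * v x)"

definition L2_norm :: "'a::euclidean_space set \<Rightarrow> ('a \<Rightarrow> real) \<Rightarrow> real"
  where "L2_norm \<Omega> u = sqrt (LINT x|lebesgue_on \<Omega>. (u x)\<^sup>2)"

definition L2_field :: "'a::euclidean_space set \<Rightarrow> ('a \<Rightarrow> 'a) set"
  where "L2_field \<Omega> = {g. g \<in> borel_measurable (lebesgue_on \<Omega>) \<and>
    integrable (lebesgue_on \<Omega>) (\<lambda>x. (norm (g x))\<^sup>2)}"

definition has_weak_gradient :: "'a::euclidean_space set \<Rightarrow> ('a \<Rightarrow> real) \<Rightarrow> ('a \<Rightarrow> 'a) \<Rightarrow> bool"
  where "has_weak_gradient \<Omega> u g \<longleftrightarrow>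
    (\<forall>\<psi>\<in>test_functions \<Omega>. \<forall>b\<in>Basis.
       (LINT x|lebesgue_on \<Omega>. u x * frechet_derivative \<psi> (at x) b) =
       - (LINT x|lebesgue_on \<Omega>. (g x \<bullet> b) * \<psi> x))"

definition H1 :: "'a::euclidean_space set \<Rightarrow> ('a \<Rightarrow> real) set"
  where "H1 \<Omega> = {u \<in> L2 \<Omega>. \<exists>g\<in>L2_field \<Omega>. has_weak_gradient \<Omega> u g}"

definition grad :: "'a::euclidean_space set \<Rightarrow> ('a \<Rightarrow> real) \<Rightarrow> 'a \<Rightarrow> 'a"
  where "grad \<Omega> u = (SOME g. g \<in> L2_field \<Omega> \<and> has_weak_gradient \<Omega> u g)"

definition grad_inner :: "'a::euclidean_space set \<Rightarrow> ('a \<Rightarrow> real) \<Rightarrow> ('a \<Rightarrow> real) \<Rightarrow> real"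
  where "grad_inner \<Omega> u v = (LINT x|lebesgue_on \<Omega>. grad \<Omega> u x \<bullet> grad \<Omega> v x)"

definition grad_norm :: "'a::euclidean_space set \<Rightarrow> ('a \<Rightarrow> real) \<Rightarrow> real"
  where "grad_norm \<Omega> u = sqrt (LINT x|lebesgue_on \<Omega>. (norm (grad \<Omega> u x))\<^sup>2)"

definition H1_norm :: "'a::euclidean_space set \<Rightarrow> ('a \<Rightarrow> real) \<Rightarrow> real"
  where "H1_norm \<Omega> u = sqrt ((L2_norm \<Omega> u)\<^sup>2 + (grad_norm \<Omega> u)\<^sup>2)"

definition laplacian :: "'a::euclidean_space set \<Rightarrow> ('a \<Rightarrow> real) \<Rightarrow> ('a \<Rightarrow> real) \<Rightarrow> real"
  where "laplacian \<Omega> \<eta> = (\<lambda>\<psi>. - grad_inner \<Omega> \<eta> \<psi>)"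

text \<open>The embedding of \<open>L2 \<Omega>\<close> into the dual of \<open>H1 \<Omega>\<close>.\<close>

definition L2_functional :: "'a::euclidean_space set \<Rightarrow> ('a \<Rightarrow> real) \<Rightarrow> ('a \<Rightarrow> real) \<Rightarrow> real"
  where "L2_functional \<Omega> u = (\<lambda>\<psi>. L2_inner \<Omega> u \<psi>)"

abbreviation L2_L2 :: "real \<Rightarrow> 'a::euclidean_space set \<Rightarrow> (real \<Rightarrow> 'a \<Rightarrow> real) set"
  where "L2_L2 T \<Omega> \<equiv> bochner_L2 T (L2 \<Omega>) (L2_norm \<Omega>)"

abbreviation L2_L2_norm :: "real \<Rightarrow> 'a::euclidean_space set \<Rightarrow> (real \<Rightarrow> 'a \<Rightarrow> real) \<Rightarrow> real"
  where "L2_L2_norm T \<Omega> \<equiv> bochner_L2_norm T (L2_norm \<Omega>)"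

abbreviation H1_L2 :: "real \<Rightarrow> 'a::euclidean_space set \<Rightarrow> (real \<Rightarrow> 'a \<Rightarrow> real) set"
  where "H1_L2 T \<Omega> \<equiv> bochner_H1 T (L2 \<Omega>) (L2_norm \<Omega>)"

abbreviation H1_L2_norm :: "real \<Rightarrow> 'a::euclidean_space set \<Rightarrow> (real \<Rightarrow> 'a \<Rightarrow> real) \<Rightarrow> real"
  where "H1_L2_norm T \<Omega> \<equiv> bochner_H1_norm T (L2 \<Omega>) (L2_norm \<Omega>)"

abbreviation H10_L2 :: "real \<Rightarrow> 'a::euclidean_space set \<Rightarrow> (real \<Rightarrow> 'a \<Rightarrow> real) set"
  where "H10_L2 T \<Omega> \<equiv> bochner_H10 T (L2 \<Omega>) (L2_norm \<Omega>)"

abbreviation L2_H1 :: "real \<Rightarrow> 'a::euclidean_space set \<Rightarrow> (real \<Rightarrow> 'a \<Rightarrow> real) set"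
  where "L2_H1 T \<Omega> \<equiv> bochner_L2 T (H1 \<Omega>) (H1_norm \<Omega>)"

abbreviation L2_H1_dual :: "real \<Rightarrow> 'a::euclidean_space set \<Rightarrow> (real \<Rightarrow> ('a \<Rightarrow> real) \<Rightarrow> real) set"
  where "L2_H1_dual T \<Omega> \<equiv>
    bochner_L2 T (dual_space (H1 \<Omega>) (H1_norm \<Omega>)) (dual_norm (H1 \<Omega>) (H1_norm \<Omega>))"


section \<open>Assumptions on the data\<close>

definition gateaux_derivative_at ::
    "real \<Rightarrow> 'a::euclidean_space set \<Rightarrow> ((real \<Rightarrow> 'a \<Rightarrow> real) \<Rightarrow> real \<Rightarrow> 'a \<Rightarrow> real) \<Rightarrow>
     (real \<Rightarrow> 'a \<Rightarrow> real) \<Rightarrow> ((real \<Rightarrow> 'a \<Rightarrow> real) \<Rightarrow> real \<Rightarrow> 'a \<Rightarrow> real) \<Rightarrow> bool"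
  where "gateaux_derivative_at T \<Omega> H q A \<longleftrightarrow>
    bounded_linear_between (L2_L2 T \<Omega>) (L2_L2_norm T \<Omega>) (L2_L2 T \<Omega>) (L2_L2_norm T \<Omega>) A \<and>
    (\<forall>h\<in>L2_L2 T \<Omega>.
       ((\<lambda>\<tau>. L2_L2_norm T \<Omega> ((1 / \<tau>) *\<^sub>R (H (q + \<tau> *\<^sub>R h) - H q) - A h)) \<longlongrightarrow> 0) (at 0))"

text \<open>
  Continuity of \<open>H'\<close> is meant from \<open>H\<^sup>1(0,T;L\<^sup>2(\<Omega>))\<close> with its own norm to the bounded operators
  on \<open>L\<^sup>2(0,T;L\<^sup>2(\<Omega>))\<close> with the operator norm.
\<close>

definition history_operator ::
    "real \<Rightarrow> 'a::euclidean_space set \<Rightarrow> ((real \<Rightarrow> 'a \<Rightarrow> real) \<Rightarrow> real \<Rightarrow> 'a \<Rightarrow> real) \<Rightarrow> bool"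
  where "history_operator T \<Omega> H \<longleftrightarrow>
    (\<forall>q\<in>L2_L2 T \<Omega>. H q \<in> L2_L2 T \<Omega>) \<and>
    (\<exists>L>0. \<forall>q1\<in>L2_L2 T \<Omega>. \<forall>q2\<in>L2_L2 T \<Omega>. AE t in time T.
       L2_norm \<Omega> (H q1 t - H q2 t) \<le> L * (LINT s|time t. L2_norm \<Omega> (q1 s - q2 s))) \<and>
    (\<exists>H'. (\<forall>q\<in>L2_L2 T \<Omega>. gateaux_derivative_at T \<Omega> H q (H' q)) \<and>
       (\<forall>q\<in>H1_L2 T \<Omega>. \<forall>e>0. \<exists>d>0. \<forall>p\<in>H1_L2 T \<Omega>. H1_L2_norm T \<Omega> (p - q) < d \<longrightarrow>
          operator_norm (L2_L2 T \<Omega>) (L2_L2_norm T \<Omega>) (L2_L2_norm T \<Omega>) (H' p - H' q) < e))"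

definition directionally_differentiable :: "(real \<Rightarrow> real) \<Rightarrow> bool"
  where "directionally_differentiable f \<longleftrightarrow>
    (\<forall>x h. \<exists>d. ((\<lambda>\<tau>. (f (x + \<tau> * h) - f x) / \<tau>) \<longlongrightarrow> d) (at_right 0))"


section \<open>Energy and dissipation\<close>

definition energy ::
    "'a::euclidean_space set \<Rightarrow> real \<Rightarrow> real \<Rightarrow> (real \<Rightarrow> ('a \<Rightarrow> real) \<Rightarrow> real) \<Rightarrow>
     real \<Rightarrow> ('a \<Rightarrow> real) \<Rightarrow> ('a \<Rightarrow> real) \<Rightarrow> real"
  where "energy \<Omega> \<alpha> \<beta> ell t \<phi> q =
    \<alpha> / 2 * (grad_norm \<Omega> \<phi>)\<^sup>2 + \<beta> / 2 * (L2_norm \<Omega> (\<phi> - q))\<^sup>2 - ell t \<phi>"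

text \<open>Frechet derivative of \<open>J\<close> on \<open>L2 \<Omega>\<close>, identified with an element of \<open>L2 \<Omega>\<close>.\<close>

definition has_L2_gradient ::
    "'a::euclidean_space set \<Rightarrow> (('a \<Rightarrow> real) \<Rightarrow> real) \<Rightarrow> ('a \<Rightarrow> real) \<Rightarrow> ('a \<Rightarrow> real) \<Rightarrow> bool"
  where "has_L2_gradient \<Omega> J q g \<longleftrightarrow> g \<in> L2 \<Omega> \<and>
    (\<forall>e>0. \<exists>d>0. \<forall>\<eta>\<in>L2 \<Omega>. L2_norm \<Omega> \<eta> < d \<longrightarrow>
       \<bar>J (q + \<eta>) - J q - L2_inner \<Omega> g \<eta>\<bar> \<le> e * L2_norm \<Omega> \<eta>)"

definition energy_dq ::
    "'a::euclidean_space set \<Rightarrow> real \<Rightarrow> real \<Rightarrow> (real \<Rightarrow> ('a \<Rightarrow> real) \<Rightarrow> real) \<Rightarrow>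
     real \<Rightarrow> ('a \<Rightarrow> real) \<Rightarrow> ('a \<Rightarrow> real) \<Rightarrow> 'a \<Rightarrow> real"
  where "energy_dq \<Omega> \<alpha> \<beta> ell t \<phi> q =
    (SOME g. has_L2_gradient \<Omega> (\<lambda>p. energy \<Omega> \<alpha> \<beta> ell t \<phi> p) q g)"

definition dissipation ::
    "'a::euclidean_space set \<Rightarrow> real \<Rightarrow> (real \<Rightarrow> real) \<Rightarrow> ('a \<Rightarrow> real) \<Rightarrow> ('a \<Rightarrow> real) \<Rightarrow> ereal"
  where "dissipation \<Omega> \<epsilon> f \<omega> \<eta> =
    (if AE x in lebesgue_on \<Omega>. \<eta> x \<ge> 0
     then ereal (L2_inner \<Omega> (f \<circ> \<omega>) \<eta> + \<epsilon> / 2 * (L2_norm \<Omega> \<eta>)\<^sup>2) else \<infinity>)"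

definition L2_subdifferential ::
    "'a::euclidean_space set \<Rightarrow> (('a \<Rightarrow> real) \<Rightarrow> ereal) \<Rightarrow> ('a \<Rightarrow> real) \<Rightarrow> ('a \<Rightarrow> real) set"
  where "L2_subdifferential \<Omega> J v = {\<xi> \<in> L2 \<Omega>. v \<in> L2 \<Omega> \<and> J v < \<infinity> \<and>
    (\<forall>\<eta>\<in>L2 \<Omega>. ereal (L2_inner \<Omega> \<xi> (\<eta> - v)) \<le> J \<eta> - J v)}"


section \<open>The fatigue damage problem and its reformulation\<close>

abbreviation dot :: "real \<Rightarrow> 'a::euclidean_space set \<Rightarrow> (real \<Rightarrow> 'a \<Rightarrow> real) \<Rightarrow> real \<Rightarrow> 'a \<Rightarrow> real"
  where "dot T \<Omega> \<equiv> time_derivative T (L2 \<Omega>) (L2_norm \<Omega>)"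

definition fatigue_damage_problem ::
    "real \<Rightarrow> 'a::euclidean_space set \<Rightarrow> real \<Rightarrow> real \<Rightarrow> real \<Rightarrow>
     ((real \<Rightarrow> 'a \<Rightarrow> real) \<Rightarrow> real \<Rightarrow> 'a \<Rightarrow> real) \<Rightarrow> (real \<Rightarrow> real) \<Rightarrow>
     (real \<Rightarrow> ('a \<Rightarrow> real) \<Rightarrow> real) \<Rightarrow> (real \<Rightarrow> 'a \<Rightarrow> real) \<Rightarrow> (real \<Rightarrow> 'a \<Rightarrow> real) \<Rightarrow> bool"
  where "fatigue_damage_problem T \<Omega> \<alpha> \<beta> \<epsilon> H f ell q \<phi> \<longleftrightarrow>
    (AE t in time T.
       is_arg_min (\<lambda>\<psi>. energy \<Omega> \<alpha> \<beta> ell t \<psi> (q t)) (\<lambda>\<psi>. \<psi> \<in> H1 \<Omega>) (\<phi> t)) \<and>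
    (AE t in time T.
       - energy_dq \<Omega> \<alpha> \<beta> ell t (\<phi> t) (q t)
         \<in> L2_subdifferential \<Omega> (dissipation \<Omega> \<epsilon> f (H q t)) (dot T \<Omega> q t)) \<and>
    vanishes_initially T (L2 \<Omega>) (L2_norm \<Omega>) q"

definition fatigue_damage_system ::
    "real \<Rightarrow> 'a::euclidean_space set \<Rightarrow> real \<Rightarrow> real \<Rightarrow> real \<Rightarrow>
     ((real \<Rightarrow> 'a \<Rightarrow> real) \<Rightarrow> real \<Rightarrow> 'a \<Rightarrow> real) \<Rightarrow> (real \<Rightarrow> real) \<Rightarrow>
     (real \<Rightarrow> ('a \<Rightarrow> real) \<Rightarrow> real) \<Rightarrow> (real \<Rightarrow> 'a \<Rightarrow> real) \<Rightarrow> (real \<Rightarrow> 'a \<Rightarrow> real) \<Rightarrow> bool"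
  where "fatigue_damage_system T \<Omega> \<alpha> \<beta> \<epsilon> H f ell q \<phi> \<longleftrightarrow>
    (AE t in time T. AE x in lebesgue_on \<Omega>.
       dot T \<Omega> q t x = 1 / \<epsilon> * max (- \<beta> * (q t x - \<phi> t x) - f (H q t x)) 0) \<and>
    vanishes_initially T (L2 \<Omega>) (L2_norm \<Omega>) q \<and>
    (AE t in time T. \<forall>\<psi>\<in>H1 \<Omega>.
       - \<alpha> * laplacian \<Omega> (\<phi> t) \<psi> + \<beta> * L2_functional \<Omega> (\<phi> t) \<psi> =
       \<beta> * L2_functional \<Omega> (q t) \<psi> + ell t \<psi>)"

end

theory Submission
  imports Defs
begin

text \<open>
  For fixed \<open>q\<close> the energy is a coercive quadratic functional of \<open>\<phi>\<close>, so its minimiser is the unique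
  solution of the elliptic equation and depends Lipschitz continuously on \<open>(q(t), \<ell>(t))\<close>. The
  subdifferential inclusion says that the rate is the projection of
  \<open>(- \<beta> (q - \<phi>) - f(H(q))) / \<epsilon>\<close> onto the nonnegative functions. After elimination of \<open>\<phi>\<close>,
  the unknown \<open>w\<close>, the time derivative of \<open>q\<close>, solves a Volterra equation \<open>w = G(w)\<close> with
  \<open>\<parallel>G(u)(t) - G(w)(t)\<parallel> \<le> K \<integral>\<^sub>0\<^sup>t \<parallel>u - w\<parallel>\<close>, to which Picard iteration applies.

  All spaces are spaces of representatives, so Bochner integrals are handled weakly: an element of
  \<open>L\<^sup>2(\<Omega>)\<close> is determined up to null sets by its inner products, and Riesz representation supplies the
  primitive of \<open>w\<close> and every Bochner integral that the weak derivative asks for. That derivative is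
  unique, and functions in \<open>H\<^sup>1\<^sub>0\<close> are primitives, by the fundamental lemma of the calculus of
  variations and its du Bois-Reymond form. These rest on smooth bumps \<open>exp (- 1 / (n t))\<close>
  increasing to indicators of boxes.
\<close>

section \<open>Strong measurability\<close>

text \<open>The elliptic solution operator acts at a single instant, so an equation for
  \<open>q\<close> would contain \<open>q(t)\<close> itself. With the rate as unknown and
  \<open>q\<close> as its primitive, this instantaneous dependence is dominated by an integral over
  \<open>(0,t)\<close>. The constant becomes \<open>K = \<beta> (1 + \<beta> / min \<alpha> \<beta>)
  / \<epsilon> + L_f L_H T / \<epsilon>\<close>, and measuring differences against
  \<open>exp (2 K t)\<close> gives contraction on the whole interval at once. Gradients, time
  derivatives, primitives, the derivative of the energy and the elliptic solutions are all choices,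
  linear only up to seminorm zero, and a seminorm says nothing outside its space. Identities are
  therefore proved by testing with fixed elements. Estimates are Lipschitz bounds on the spaces, and
  these bounds, not linearity, also make the composed maps measurable in time. Limits of Picard
  iterates are taken at almost every fixed time in \<open>L2 \<Omega>\<close>; measurability of the
  limit is recovered afterwards from simple functions chosen close in mean to the iterates.\<close>

text \<open>Lebesgue measure is complete: after extension by zero off \<open>S\<close>, a change on
  a null set keeps a function measurable. Simple approximations converge only almost everywhere, so
  their limits have to pass through this.\<close>

lemma borel_measurable_lebesgue_on_AE:
  fixes f g :: "'a::euclidean_space \<Rightarrow> 'b::euclidean_space"
  assumes S: "S \<in> sets lebesgue" and f: "f \<in> borel_measurable (lebesgue_on S)"
    and eq: "AE x in lebesgue_on S. f x = g x"
  shows "g \<in> borel_measurable (lebesgue_on S)"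
proof -
  have "AE x in lebesgue. (if x \<in> S then f x else 0) = (if x \<in> S then g x else 0)"
    using eq S by (auto simp: AE_restrict_space_iff elim: eventually_mono)
  then have "(\<lambda>x. if x \<in> S then g x else 0) \<in> borel_measurable lebesgue"
    by (rule borel_measurable_AE[OF borel_measurable_if_I[OF f S]])
  then show ?thesis
    by (rule borel_measurable_if_D)
qed

lemma borel_measurable_lebesgue_on_AE_limit:
  fixes g :: "'a::euclidean_space \<Rightarrow> real"
  assumes S: "S \<in> sets lebesgue" and f: "\<And>n. f n \<in> borel_measurable (lebesgue_on S)"
    and lim: "AE x in lebesgue_on S. (\<lambda>n. f n x) \<longlonglongrightarrow> g x"
  shows "g \<in> borel_measurable (lebesgue_on S)"
proof -
  \<comment> \<open>\<open>lim\<close> is measurable as a function on all of \<open>S\<close>, also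
    at points where the sequence diverges and its value is meaningless; off a null set it is
    \<open>g\<close>.\<close>
  have m: "(\<lambda>x. lim (\<lambda>n. f n x)) \<in> borel_measurable (lebesgue_on S)"
    using f by (intro borel_measurable_lim_metric)
  have "AE x in lebesgue_on S. lim (\<lambda>n. f n x) = g x"
    using lim by eventually_elim (rule limI)
  then show ?thesis
    by (rule borel_measurable_lebesgue_on_AE[OF S m])
qed

lemma finite_measure_time: "finite_measure (time T)"
  by (rule finite_measure_lebesgue_on) simp

lemma integrable_bounded_lebesgue_on:
  fixes f :: "'a::euclidean_space \<Rightarrow> real"
  assumes "S \<in> lmeasurable" "f \<in> borel_measurable (lebesgue_on S)"
    and "AE x in lebesgue_on S. \<bar>f x\<bar> \<le> B"
  shows "integrable (lebesgue_on S) f"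
  using finite_measure.integrable_const_bound[OF finite_measure_lebesgue_on[OF assms(1)], of f B] assms
  by simp

lemma tendsto_zero_squeeze:
  fixes f g :: "nat \<Rightarrow> real"
  assumes "g \<longlonglongrightarrow> 0" "\<And>n. 0 \<le> f n" "\<And>n. f n \<le> g n"
  shows "f \<longlonglongrightarrow> 0"
  by (rule Lim_null_comparison[OF _ assms(1)]) (use assms(2,3) in simp)

lemma strongly_measurableE:
  assumes "strongly_measurable T X N u"
  obtains s where "\<And>n. simple_function (time T) (s n)" "\<And>n t. t \<in> {0<..<T} \<Longrightarrow> s n t \<in> X"
    "AE t in time T. (\<lambda>n. N (s n t - u t)) \<longlonglongrightarrow> 0"
proof -
  from assms obtain s where s: "\<forall>n. simple_function (time T) (s n) \<and> s n ` {0<..<T} \<subseteq> X"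
      "AE t in time T. (\<lambda>n. N (s n t - u t)) \<longlonglongrightarrow> 0"
    unfolding strongly_measurable_def by blast
  show ?thesis
    by (rule that[of s]) (use s in \<open>simp_all add: image_subset_iff\<close>)
qed

lemma strongly_measurableI:
  assumes "AE t in time T. u t \<in> X"
    and "\<And>n. simple_function (time T) (s n)" "\<And>n t. t \<in> {0<..<T} \<Longrightarrow> s n t \<in> X"
    and "AE t in time T. (\<lambda>n. N (s n t - u t)) \<longlonglongrightarrow> 0"
  shows "strongly_measurable T X N u"
  unfolding strongly_measurable_def using assms by (intro conjI exI[of _ s]) auto

lemma strongly_measurable_in: "strongly_measurable T X N u \<Longrightarrow> AE t in time T. u t \<in> X"
  by (simp add: strongly_measurable_def)

text \<open>\<open>A\<close> is applied to two sequences of simple functions whose values lie in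
  \<open>Y\<close> and \<open>Z\<close> at every time. Sequential continuity on \<open>Y\<close> and
  \<open>Z\<close> is therefore enough, and \<open>A\<close> may be built from choices that are
  linear only up to seminorm zero.\<close>

lemma strongly_measurable_compose2:
  assumes u: "strongly_measurable T Y M u" and v: "strongly_measurable T Z M' v"
    and A: "\<And>y z. y \<in> Y \<Longrightarrow> z \<in> Z \<Longrightarrow> A y z \<in> X"
    and cont: "\<And>y z ys zs. \<lbrakk>y \<in> Y; z \<in> Z; \<And>n. ys n \<in> Y; \<And>n. zs n \<in> Z;
      (\<lambda>n::nat. M (ys n - y)) \<longlonglongrightarrow> 0; (\<lambda>n. M' (zs n - z)) \<longlonglongrightarrow> 0\<rbrakk>
      \<Longrightarrow> (\<lambda>n. N (A (ys n) (zs n) - A y z)) \<longlonglongrightarrow> 0"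
  shows "strongly_measurable T X N (\<lambda>t. A (u t) (v t))"
proof -
  obtain s where s: "\<And>n. simple_function (time T) (s n)" "\<And>n t. t \<in> {0<..<T} \<Longrightarrow> s n t \<in> Y"
      "AE t in time T. (\<lambda>n. M (s n t - u t)) \<longlonglongrightarrow> 0"
    by (rule strongly_measurableE[OF u]) blast
  obtain r where r: "\<And>n. simple_function (time T) (r n)" "\<And>n t. t \<in> {0<..<T} \<Longrightarrow> r n t \<in> Z"
      "AE t in time T. (\<lambda>n. M' (r n t - v t)) \<longlonglongrightarrow> 0"
    by (rule strongly_measurableE[OF v]) blast
  show ?thesis
  proof (rule strongly_measurableI[where s="\<lambda>n t. A (s n t) (r n t)"])
    show "AE t in time T. A (u t) (v t) \<in> X"
      using strongly_measurable_in[OF u] strongly_measurable_in[OF v]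
      by eventually_elim (blast intro: A)
    show "simple_function (time T) (\<lambda>t. A (s n t) (r n t))" for n
      by (rule simple_function_compose2[OF s(1) r(1), of A])
    show "A (s n t) (r n t) \<in> X" if "t \<in> {0<..<T}" for n t
      using that s r A by blast
    show "AE t in time T. (\<lambda>n. N (A (s n t) (r n t) - A (u t) (v t))) \<longlonglongrightarrow> 0"
      using strongly_measurable_in[OF u] strongly_measurable_in[OF v] s(3) r(3) AE_space
    proof eventually_elim
      case (elim t)
      then have "t \<in> {0<..<T}" by simp
      with elim s(2) r(2) show ?case
        by (intro cont[OF elim(1,2) _ _ elim(3,4)])
    qed
  qed
qed

text \<open>The instances are addition and, through the square integrable version
  \<open>bochner_L2_lipschitz2\<close>, the maps \<open>sol\<close>, \<open>drive\<close> and
  \<open>rate\<close>.\<close>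

lemma strongly_measurable_lipschitz2:
  assumes u: "strongly_measurable T Y M u" and v: "strongly_measurable T Z M' v"
    and A: "\<And>y z. y \<in> Y \<Longrightarrow> z \<in> Z \<Longrightarrow> A y z \<in> X"
    and N: "\<And>x y. x \<in> X \<Longrightarrow> y \<in> X \<Longrightarrow> 0 \<le> N (x - y)"
    and lip: "\<And>y z y' z'. \<lbrakk>y \<in> Y; z \<in> Z; y' \<in> Y; z' \<in> Z\<rbrakk>
      \<Longrightarrow> N (A y z - A y' z') \<le> C * M (y - y') + D * M' (z - z')"
  shows "strongly_measurable T X N (\<lambda>t. A (u t) (v t))"
proof (rule strongly_measurable_compose2[OF u v A])
  fix y z ys zs
  assume *: "y \<in> Y" "z \<in> Z" "\<And>n. ys n \<in> Y" "\<And>n. zs n \<in> Z"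
    and l: "(\<lambda>n::nat. M (ys n - y)) \<longlonglongrightarrow> 0" "(\<lambda>n. M' (zs n - z)) \<longlonglongrightarrow> 0"
  have lim: "(\<lambda>n. C * M (ys n - y) + D * M' (zs n - z)) \<longlonglongrightarrow> 0"
    using tendsto_add[OF tendsto_mult_left[OF l(1), of C] tendsto_mult_left[OF l(2), of D]] by simp
  show "(\<lambda>n. N (A (ys n) (zs n) - A y z)) \<longlonglongrightarrow> 0"
    by (rule tendsto_zero_squeeze[OF lim N[OF A[OF *(3,4)] A[OF *(1,2)]] lip[OF *(3,4,1,2)]])
qed

text \<open>Lets a scalar factor enter \<open>strongly_measurable_compose2\<close> as a function
  into the reals, seen as a seminormed set.\<close>

lemma strongly_measurable_real:
  fixes g :: "real \<Rightarrow> real"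
  assumes "g \<in> borel_measurable (time T)"
  shows "strongly_measurable T UNIV abs g"
proof -
  obtain F where F: "\<And>i. simple_function (time T) (F i)"
      "\<And>x. x \<in> space (time T) \<Longrightarrow> (\<lambda>i. F i x) \<longlonglongrightarrow> g x"
    using borel_measurable_implies_sequence_metric[OF assms, of 0] by blast
  show ?thesis
  proof (rule strongly_measurableI[where s=F])
    show "AE t in time T. (\<lambda>n. \<bar>F n t - g t\<bar>) \<longlonglongrightarrow> 0"
      using F(2) by (intro AE_I2 tendsto_rabs_zero) (simp add: LIM_zero)
  qed (use F in auto)
qed

text \<open>Outside \<open>X\<close> the seminorm is uncontrolled: the integral of a non-integrable
  square is 0 by convention, so \<open>L2_norm\<close> vanishes there. Hence the membership premises
  throughout.\<close>

locale seminormed_set =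
  fixes X :: "'v::real_vector set" and N :: "'v \<Rightarrow> real"
  assumes zero_in: "0 \<in> X"
    and add_in: "u \<in> X \<Longrightarrow> v \<in> X \<Longrightarrow> u + v \<in> X"
    and scaleR_in: "u \<in> X \<Longrightarrow> c *\<^sub>R u \<in> X"
    and N_nonneg: "u \<in> X \<Longrightarrow> 0 \<le> N u"
    and N_scaleR: "u \<in> X \<Longrightarrow> N (c *\<^sub>R u) = \<bar>c\<bar> * N u"
    and N_triangle: "u \<in> X \<Longrightarrow> v \<in> X \<Longrightarrow> N (u + v) \<le> N u + N v"
begin

lemma minus_in: "u \<in> X \<Longrightarrow> - u \<in> X"
  using scaleR_in[of u "-1"] by simp

lemma diff_in: "u \<in> X \<Longrightarrow> v \<in> X \<Longrightarrow> u - v \<in> X"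
  using add_in[of u "- v"] minus_in by simp

lemma sum_in: "(\<And>i. i \<in> I \<Longrightarrow> g i \<in> X) \<Longrightarrow> sum g I \<in> X"
  by (induction I rule: infinite_finite_induct) (auto intro: zero_in add_in)

lemma N_zero: "N 0 = 0"
  using N_scaleR[OF zero_in, of 0] by simp

lemma N_minus: "u \<in> X \<Longrightarrow> N (- u) = N u"
  using N_scaleR[of u "-1"] by simp

lemma N_commute: "u \<in> X \<Longrightarrow> v \<in> X \<Longrightarrow> N (u - v) = N (v - u)"
  using N_minus[OF diff_in[of u v]] by simp

lemma N_triangle3:
  "u \<in> X \<Longrightarrow> v \<in> X \<Longrightarrow> w \<in> X \<Longrightarrow> N (u - w) \<le> N (u - v) + N (v - w)"
  using N_triangle[of "u - v" "v - w"] by (simp add: diff_in)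

lemma N_triangle_diff: "u \<in> X \<Longrightarrow> v \<in> X \<Longrightarrow> N (u - v) \<le> N u + N v"
  using N_triangle[of u "- v"] by (simp add: minus_in N_minus)

lemma N_le_add: "u \<in> X \<Longrightarrow> v \<in> X \<Longrightarrow> N u \<le> N v + N (u - v)"
  using N_triangle[of v "u - v"] by (simp add: diff_in)

lemma abs_N_diff: "u \<in> X \<Longrightarrow> v \<in> X \<Longrightarrow> \<bar>N u - N v\<bar> \<le> N (u - v)"
  using N_le_add[of u v] N_le_add[of v u] N_commute[of u v] by linarith

lemma N_tendsto:
  assumes "u \<in> X" "\<And>n. s n \<in> X" "(\<lambda>n::nat. N (s n - u)) \<longlonglongrightarrow> 0"
  shows "(\<lambda>n. N (s n)) \<longlonglongrightarrow> N u"
proof -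
  have "(\<lambda>n. N (s n) - N u) \<longlonglongrightarrow> 0"
    by (rule Lim_null_comparison[OF _ assms(3)]) (simp add: abs_N_diff assms)
  then show ?thesis by (simp add: LIM_zero_cancel)
qed

section \<open>Measurability in time and approximation by simple functions\<close>

lemma N_simple_measurable:
  "simple_function (time T) s \<Longrightarrow> (\<lambda>t. N (s t)) \<in> borel_measurable (time T)"
  using borel_measurable_simple_function simple_function_compose1 by blast

lemma borel_measurable_N:
  assumes "strongly_measurable T X N u"
  shows "(\<lambda>t. N (u t)) \<in> borel_measurable (time T)"
proof -
  obtain s where s: "\<And>n. simple_function (time T) (s n)" "\<And>n t. t \<in> {0<..<T} \<Longrightarrow> s n t \<in> X"
      "AE t in time T. (\<lambda>n. N (s n t - u t)) \<longlonglongrightarrow> 0"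
    by (rule strongly_measurableE[OF assms]) blast
  show ?thesis
  proof (rule borel_measurable_lebesgue_on_AE_limit)
    show "(\<lambda>t. N (s n t)) \<in> borel_measurable (time T)" for n
      using s(1) by (rule N_simple_measurable)
    show "AE t in time T. (\<lambda>n. N (s n t)) \<longlonglongrightarrow> N (u t)"
      using s(3) strongly_measurable_in[OF assms] AE_space
    proof eventually_elim
      case (elim t)
      with s(2) show ?case
        by (intro N_tendsto[OF elim(2) _ elim(1)]) simp
    qed
  qed simp
qed

lemma strongly_measurable_add:
  assumes "strongly_measurable T X N u" "strongly_measurable T X N v"
  shows "strongly_measurable T X N (\<lambda>t. u t + v t)"
proof (rule strongly_measurable_lipschitz2[OF assms, where A="\<lambda>a b. a + b" and C=1 and D=1])
  fix y z y' z' assume "y \<in> X" "z \<in> X" "y' \<in> X" "z' \<in> X"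
  then show "N (y + z - (y' + z')) \<le> 1 * N (y - y') + 1 * N (z - z')"
    using N_triangle[of "y - y'" "z - z'"] by (simp add: diff_in algebra_simps)
qed (auto intro: add_in N_nonneg diff_in)

lemma strongly_measurable_scaleR:
  assumes g: "g \<in> borel_measurable (time T)" and u: "strongly_measurable T X N u"
  shows "strongly_measurable T X N (\<lambda>t. g t *\<^sub>R u t)"
proof (rule strongly_measurable_compose2[OF strongly_measurable_real[OF g] u, where A="\<lambda>a b. a *\<^sub>R b"])
  fix y :: real and z ys zs
  assume z: "z \<in> X" "\<And>n. zs n \<in> X" and l: "(\<lambda>n::nat. \<bar>ys n - y\<bar>) \<longlonglongrightarrow> 0" "(\<lambda>n. N (zs n - z)) \<longlonglongrightarrow> 0"
  have ys: "ys \<longlonglongrightarrow> y"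
    using l(1) by (simp add: tendsto_rabs_zero_iff LIM_zero_iff)
  have lim: "(\<lambda>n. \<bar>ys n\<bar> * N (zs n - z) + \<bar>ys n - y\<bar> * N z) \<longlonglongrightarrow> 0"
    using tendsto_add[OF tendsto_mult[OF tendsto_rabs[OF ys] l(2)] tendsto_mult_right[OF l(1), of "N z"]]
    by simp
  have le: "N (ys n *\<^sub>R zs n - y *\<^sub>R z) \<le> \<bar>ys n\<bar> * N (zs n - z) + \<bar>ys n - y\<bar> * N z" for n
  proof -
    have "ys n *\<^sub>R zs n - y *\<^sub>R z = ys n *\<^sub>R (zs n - z) + (ys n - y) *\<^sub>R z"
      by (simp add: algebra_simps)
    then show ?thesis
      using N_triangle[of "ys n *\<^sub>R (zs n - z)" "(ys n - y) *\<^sub>R z"] z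
      by (simp add: N_scaleR diff_in scaleR_in)
  qed
  have nn: "0 \<le> N (ys n *\<^sub>R zs n - y *\<^sub>R z)" for n
    using z by (intro N_nonneg diff_in scaleR_in)
  show "(\<lambda>n. N (ys n *\<^sub>R zs n - y *\<^sub>R z)) \<longlonglongrightarrow> 0"
    by (rule tendsto_zero_squeeze[OF lim nn le])
qed (auto intro: scaleR_in)

lemma strongly_measurable_diff:
  assumes "strongly_measurable T X N u" "strongly_measurable T X N v"
  shows "strongly_measurable T X N (\<lambda>t. u t - v t)"
  using strongly_measurable_add[OF assms(1) strongly_measurable_scaleR[OF borel_measurable_const[of "-1"] assms(2)]]
  by simp

lemma strongly_measurable_const: "v \<in> X \<Longrightarrow> strongly_measurable T X N (\<lambda>t. v)"
  by (rule strongly_measurableI[where s="\<lambda>n t. v"]) (auto simp: N_zero)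

lemma simple_restrict:
  assumes "simple_function (time T) s" "{t \<in> {0<..<T}. P t} \<in> sets (time T)"
  shows "simple_function (time T) (\<lambda>t. if P t then s t else 0)"
  using assms by (intro simple_function_If) auto

text \<open>Truncation: values with seminorm above twice that of \<open>u t\<close> are replaced by
  0. Where \<open>N (u t)\<close> is positive this is eventually inactive, because
  \<open>N (s n t)\<close> tends to \<open>N (u t)\<close>; where it is zero, truncating cannot
  increase the error.\<close>

lemma dominated_simple_approximation:
  assumes u: "strongly_measurable T X N u"
  obtains s where "\<And>n. simple_function (time T) (s n)" "\<And>n t. t \<in> {0<..<T} \<Longrightarrow> s n t \<in> X"
    "AE t in time T. (\<lambda>n. N (s n t - u t)) \<longlonglongrightarrow> 0"
    "\<And>n t. t \<in> {0<..<T} \<Longrightarrow> N (s n t) \<le> 2 * \<bar>N (u t)\<bar>"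
proof -
  obtain s where s: "\<And>n. simple_function (time T) (s n)" "\<And>n t. t \<in> {0<..<T} \<Longrightarrow> s n t \<in> X"
      "AE t in time T. (\<lambda>n. N (s n t - u t)) \<longlonglongrightarrow> 0"
    by (rule strongly_measurableE[OF u]) blast
  note [measurable] = borel_measurable_N[OF u] N_simple_measurable[OF s(1)]
  \<comment> \<open>The absolute value makes the bound hold at every time: at exceptional times
    \<open>u t\<close> may lie outside \<open>X\<close> and \<open>N (u t)\<close> may be negative,
    while the replacement value 0 has seminorm 0.\<close>
  define r where "r n t = (if N (s n t) \<le> 2 * \<bar>N (u t)\<bar> then s n t else 0)" for n t
  show ?thesis
  proof (rule that[of r])
    show "simple_function (time T) (r n)" for n
    proof -
      have "{t \<in> space (time T). N (s n t) \<le> 2 * \<bar>N (u t)\<bar>} \<in> sets (time T)"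
        by measurable
      then show ?thesis
        unfolding r_def[abs_def] by (intro simple_restrict s) simp
    qed
    show "r n t \<in> X" if "t \<in> {0<..<T}" for n t
      using that s by (auto simp: r_def zero_in)
    show "N (r n t) \<le> 2 * \<bar>N (u t)\<bar>" for n t
      by (auto simp: r_def N_zero)
    show "AE t in time T. (\<lambda>n. N (r n t - u t)) \<longlonglongrightarrow> 0"
      using s(3) strongly_measurable_in[OF u] AE_space
    proof eventually_elim
      case (elim t)
      then have X: "s n t \<in> X" "u t \<in> X" for n using s by auto
      show ?case
      proof (cases "N (u t) = 0")
        case True
        have "N (r n t - u t) \<le> N (s n t - u t)" for n
          using N_nonneg[OF diff_in[OF X]] True N_minus[OF X(2)] by (auto simp: r_def)
        moreover have "0 \<le> N (r n t - u t)" for n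
          using X zero_in by (auto simp: r_def N_minus N_nonneg diff_in)
        ultimately show ?thesis
          by (rule tendsto_zero_squeeze[OF elim(1), rotated])
      next
        case False
        then have "N (u t) > 0" using N_nonneg[OF X(2)] by auto
        moreover have "(\<lambda>n. N (s n t)) \<longlonglongrightarrow> N (u t)"
          using X elim(1) by (intro N_tendsto)
        ultimately have "eventually (\<lambda>n. N (s n t) < 2 * N (u t)) sequentially"
          by (intro order_tendstoD(2)[of _ "N (u t)"]) auto
        then have "eventually (\<lambda>n. N (s n t - u t) = N (r n t - u t)) sequentially"
          by eventually_elim (use X N_nonneg in \<open>auto simp: r_def\<close>)
        then show ?thesis
          using elim(1) by (rule Lim_transform_eventually[rotated])
      qed
    qed
  qed
qed

lemma L1_simple_approximation:
  assumes u: "strongly_measurable T X N u" and int: "integrable (time T) (\<lambda>t. N (u t))"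
  obtains s where "\<And>n. simple_function (time T) (s n)" "\<And>n t. t \<in> {0<..<T} \<Longrightarrow> s n t \<in> X"
    "\<And>n. integrable (time T) (\<lambda>t. N (s n t - u t))"
    "(\<lambda>n. LINT t|time T. N (s n t - u t)) \<longlonglongrightarrow> 0"
proof -
  obtain s where s: "\<And>n. simple_function (time T) (s n)" "\<And>n t. t \<in> {0<..<T} \<Longrightarrow> s n t \<in> X"
    "AE t in time T. (\<lambda>n. N (s n t - u t)) \<longlonglongrightarrow> 0"
    "\<And>n t. t \<in> {0<..<T} \<Longrightarrow> N (s n t) \<le> 2 * \<bar>N (u t)\<bar>"
    by (rule dominated_simple_approximation[OF u]) blast
  have sm: "strongly_measurable T X N (s n)" for n
    by (rule strongly_measurableI[where s="\<lambda>_. s n"]) (use s in \<open>auto simp: N_zero\<close>)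
  have meas: "(\<lambda>t. N (s n t - u t)) \<in> borel_measurable (time T)" for n
    by (intro borel_measurable_N strongly_measurable_diff sm u)
  \<comment> \<open>3 = 2 + 1: the truncated approximation contributes at most
    \<open>2 * N (u t)\<close>, the limit one more \<open>N (u t)\<close>.\<close>
  have bound: "AE t in time T. norm (N (s n t - u t)) \<le> 3 * N (u t)" for n
    using strongly_measurable_in[OF u] AE_space
  proof eventually_elim
    case (elim t)
    then have "s n t \<in> X" "t \<in> {0<..<T}" using s by auto
    then show ?case
      using elim(1) N_triangle_diff[of "s n t" "u t"] s(4)[of t n] N_nonneg[of "u t"]
        N_nonneg[OF diff_in[of "s n t" "u t"]] by auto
  qed
  have int3: "integrable (time T) (\<lambda>t. 3 * N (u t))" using int by simp
  show ?thesis
  proof (rule that[of s])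
    show "integrable (time T) (\<lambda>t. N (s n t - u t))" for n
      by (rule integrable_dominated_convergence[OF _ _ int3, where s="\<lambda>_ t. N (s n t - u t)"])
         (use meas bound in auto)
    have "(\<lambda>n. LINT t|time T. N (s n t - u t)) \<longlonglongrightarrow> (LINT t|time T. 0)"
      by (rule integral_dominated_convergence[OF _ _ int3]) (use meas bound s(3) in auto)
    then show "(\<lambda>n. LINT t|time T. N (s n t - u t)) \<longlonglongrightarrow> 0" by simp
  qed (use s in auto)
qed

end

section \<open>Hilbert spaces of representatives\<close>

text \<open>First-order condition for a minimum at \<open>s = 0\<close>. The sign of
  \<open>n\<close> is unknown, so it is replaced by \<open>b = \<bar>n\<bar> + 1\<close>; at
  \<open>s = - g / b\<close> the expression is then at most \<open>- g^2 / (2 b)\<close>.\<close>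

lemma quadratic_nonneg_imp_zero:
  fixes g n :: real
  assumes "\<And>s. 0 \<le> s * g + s\<^sup>2 / 2 * n"
  shows "g = 0"
proof (rule ccontr)
  assume "g \<noteq> 0"
  then have g: "g\<^sup>2 > 0" by simp
  define b where "b = \<bar>n\<bar> + 1"
  have b: "b > 0" "n \<le> b" by (simp_all add: b_def)
  have "0 \<le> (- g / b) * g + (- g / b)\<^sup>2 / 2 * n" by (rule assms)
  also have "\<dots> \<le> (- g / b) * g + (- g / b)\<^sup>2 / 2 * b"
    using b by (intro add_left_mono mult_left_mono) auto
  also have "\<dots> = - (g\<^sup>2 / (2 * b))"
    using b by (simp add: field_simps power2_eq_square)
  finally show False using g b by (simp add: field_simps)
qed

text \<open>\<open>ip\<close> is only semidefinite, since distinct representatives of one element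
  have distance zero. The instances are \<open>L2\<close>, \<open>H1\<close> with its own norm, and
  \<open>H1\<close> with the norm of the elliptic form.\<close>

locale semi_hilbert =
  fixes X :: "'v::real_vector set" and N :: "'v \<Rightarrow> real" and ip :: "'v \<Rightarrow> 'v \<Rightarrow> real"
  assumes zero_closed: "0 \<in> X"
    and add_closed: "u \<in> X \<Longrightarrow> v \<in> X \<Longrightarrow> u + v \<in> X"
    and scaleR_closed: "u \<in> X \<Longrightarrow> c *\<^sub>R u \<in> X"
    and ip_commute: "u \<in> X \<Longrightarrow> v \<in> X \<Longrightarrow> ip u v = ip v u"
    and ip_add_left: "u \<in> X \<Longrightarrow> v \<in> X \<Longrightarrow> w \<in> X \<Longrightarrow> ip (u + v) w = ip u w + ip v w"
    and ip_scaleR_left: "u \<in> X \<Longrightarrow> w \<in> X \<Longrightarrow> ip (c *\<^sub>R u) w = c * ip u w"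
    and ip_nonneg: "u \<in> X \<Longrightarrow> 0 \<le> ip u u"
    and N_eq: "u \<in> X \<Longrightarrow> N u = sqrt (ip u u)"
    and complete: "\<lbrakk>\<And>n. s n \<in> X; \<And>e. e > 0 \<Longrightarrow> \<exists>K. \<forall>m\<ge>K. \<forall>n\<ge>K. N (s m - s n) < e\<rbrakk>
      \<Longrightarrow> \<exists>u\<in>X. (\<lambda>n::nat. N (s n - u)) \<longlonglongrightarrow> 0"
begin

lemma ip_add_right: "u \<in> X \<Longrightarrow> v \<in> X \<Longrightarrow> w \<in> X \<Longrightarrow> ip w (u + v) = ip w u + ip w v"
  using ip_add_left ip_commute add_closed by simp

lemma ip_scaleR_right: "u \<in> X \<Longrightarrow> w \<in> X \<Longrightarrow> ip w (c *\<^sub>R u) = c * ip w u"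
  using ip_scaleR_left ip_commute scaleR_closed by simp

lemma N_power2: "u \<in> X \<Longrightarrow> (N u)\<^sup>2 = ip u u"
  by (simp add: N_eq ip_nonneg)

lemma N_ge_0: "u \<in> X \<Longrightarrow> 0 \<le> N u"
  by (simp add: N_eq ip_nonneg)

text \<open>The discriminant argument, with a separate case \<open>ip v v = 0\<close>:
  semidefiniteness does not make such a \<open>v\<close> zero, and \<open>ip u v = 0\<close> has to
  be proved.\<close>

lemma Cauchy_Schwarz:
  assumes u: "u \<in> X" and v: "v \<in> X"
  shows "\<bar>ip u v\<bar> \<le> N u * N v"
proof -
  define a b c where "a = ip u u" and "b = ip u v" and "c = ip v v"
  have ac: "0 \<le> a" "0 \<le> c" using u v by (auto simp: a_def c_def ip_nonneg)
  have q: "0 \<le> a + 2 * t * b + t\<^sup>2 * c" for t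
  proof -
    have "0 \<le> ip (u + t *\<^sub>R v) (u + t *\<^sub>R v)"
      using u v by (intro ip_nonneg add_closed scaleR_closed)
    also have "\<dots> = a + 2 * t * b + t\<^sup>2 * c"
      using u v ip_commute[OF u v]
      by (simp add: ip_add_left ip_add_right ip_scaleR_left ip_scaleR_right add_closed scaleR_closed
          a_def b_def c_def power2_eq_square algebra_simps)
    finally show ?thesis .
  qed
  have "b\<^sup>2 \<le> a * c"
  proof (cases "c = 0")
    case True
    have "b = 0"
    proof (rule ccontr)
      assume "b \<noteq> 0"
      \<comment> \<open>The quadratic has degenerated to \<open>a + 2 * t * b\<close>; this
        \<open>t\<close> gives it the value -1.\<close>
      then show False using q[of "- (a + 1) / (2 * b)"] True by (simp add: field_simps)
    qed
    then show ?thesis using ac by simp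
  next
    case False
    then have "0 < c" using ac by simp
    have "0 \<le> a + 2 * (- b / c) * b + (- b / c)\<^sup>2 * c" by (rule q)
    also have "\<dots> = a - b\<^sup>2 / c" using \<open>0 < c\<close> by (simp add: field_simps power2_eq_square)
    finally show ?thesis using \<open>0 < c\<close> by (simp add: field_simps)
  qed
  then have "sqrt (b\<^sup>2) \<le> sqrt (a * c)" by (rule real_sqrt_le_mono)
  then show ?thesis using u v by (simp add: real_sqrt_mult N_eq a_def b_def c_def)
qed

sublocale seminormed_set X N
proof
  show "N (c *\<^sub>R u) = \<bar>c\<bar> * N u" if "u \<in> X" for c u
    using that by (simp add: N_eq scaleR_closed ip_scaleR_left ip_scaleR_right real_sqrt_mult flip: mult.assoc)
  show "N (u + v) \<le> N u + N v" if u: "u \<in> X" and v: "v \<in> X" for u v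
  proof (rule power2_le_imp_le)
    have "(N (u + v))\<^sup>2 = ip u u + 2 * ip u v + ip v v"
      using u v ip_commute[OF u v] by (simp add: N_power2 add_closed ip_add_left ip_add_right)
    also have "\<dots> \<le> (N u + N v)\<^sup>2"
      using Cauchy_Schwarz[OF u v] u v by (simp add: power2_sum N_power2)
    finally show "(N (u + v))\<^sup>2 \<le> (N u + N v)\<^sup>2" .
    show "0 \<le> N u + N v" using u v by (simp add: N_ge_0)
  qed
qed (fact zero_closed, erule (1) add_closed, erule scaleR_closed, erule N_ge_0)

lemma ip_minus_left: "u \<in> X \<Longrightarrow> w \<in> X \<Longrightarrow> ip (- u) w = - ip u w"
  using ip_scaleR_left[of u w "-1"] by simp

lemma ip_diff_left: "u \<in> X \<Longrightarrow> v \<in> X \<Longrightarrow> w \<in> X \<Longrightarrow> ip (u - v) w = ip u w - ip v w"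
  using ip_add_left[of u "- v" w] by (simp add: minus_in ip_minus_left)

lemma ip_diff_right: "u \<in> X \<Longrightarrow> v \<in> X \<Longrightarrow> w \<in> X \<Longrightarrow> ip w (u - v) = ip w u - ip w v"
  using ip_diff_left[of u v w] ip_commute diff_in by simp

lemma ip_zero_left: "w \<in> X \<Longrightarrow> ip 0 w = 0"
  using ip_scaleR_left[of 0 w 0] by (simp add: zero_in)

lemma ip_sum_left:
  "(\<And>i. i \<in> I \<Longrightarrow> g i \<in> X) \<Longrightarrow> w \<in> X \<Longrightarrow> ip (sum g I) w = (\<Sum>i\<in>I. ip (g i) w)"
  by (induction I rule: infinite_finite_induct) (auto simp: ip_zero_left ip_add_left sum_in)

text \<open>Test with \<open>v = u\<close>. Elements known only through their inner products, such
  as primitives and Bochner integrals, are identified this way.\<close>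

lemma N_eq_0I: "u \<in> X \<Longrightarrow> (\<And>v. v \<in> X \<Longrightarrow> ip u v = 0) \<Longrightarrow> N u = 0"
  by (simp add: N_eq)

lemma ip_tendsto:
  assumes "u \<in> X" "\<And>n. s n \<in> X" "v \<in> X" "(\<lambda>n::nat. N (s n - u)) \<longlonglongrightarrow> 0"
  shows "(\<lambda>n. ip (s n) v) \<longlonglongrightarrow> ip u v"
proof -
  have le: "\<bar>ip (s n) v - ip u v\<bar> \<le> N (s n - u) * N v" for n
    using Cauchy_Schwarz[of "s n - u" v] assms by (simp add: diff_in ip_diff_left)
  have "(\<lambda>n. N (s n - u) * N v) \<longlonglongrightarrow> 0"
    using tendsto_mult_right[OF assms(4), of "N v"] by simp
  then have "(\<lambda>n. ip (s n) v - ip u v) \<longlonglongrightarrow> 0"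
    by (rule Lim_null_comparison[rotated]) (simp add: le)
  then show ?thesis by (simp add: LIM_zero_cancel)
qed

lemma N_power2_add_scaleR:
  "u \<in> X \<Longrightarrow> v \<in> X \<Longrightarrow> (N (u + c *\<^sub>R v))\<^sup>2 = (N u)\<^sup>2 + 2 * c * ip u v + c\<^sup>2 * (N v)\<^sup>2"
  using ip_commute[of u v] N_power2[of "u + c *\<^sub>R v"]
  by (simp add: N_power2[of u] N_power2[of v] add_in scaleR_in ip_add_left ip_add_right
      ip_scaleR_left ip_scaleR_right power2_eq_square[of c] algebra_simps)

text \<open>
  The minimiser of \<open>v \<mapsto> (N v)\<^sup>2 / 2 - F v\<close> exists because minimising sequences are Cauchy by the
  parallelogram identity.
\<close>

lemma Riesz_representation:
  assumes add: "\<And>u v. u \<in> X \<Longrightarrow> v \<in> X \<Longrightarrow> F (u + v) = F u + F v"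
    and scale: "\<And>c u. u \<in> X \<Longrightarrow> F (c *\<^sub>R u) = c * F u"
    and bound: "\<And>u. u \<in> X \<Longrightarrow> \<bar>F u\<bar> \<le> C * N u"
  shows "\<exists>w\<in>X. \<forall>v\<in>X. ip w v = F v"
proof -
  define J where "J v = (N v)\<^sup>2 / 2 - F v" for v
  define d where "d = Inf (J ` X)"
  \<comment> \<open>Since \<open>F v \<le> C * N v\<close>, the bound is
    \<open>0 \<le> (N v - C)^2\<close> rearranged.\<close>
  have J_ge: "- (C\<^sup>2 / 2) \<le> J v" if "v \<in> X" for v
    using bound[OF that] zero_le_power2[of "N v - C"] unfolding J_def power2_diff
    by (simp add: field_simps)
  have bdd: "bdd_below (J ` X)"
    using J_ge by (intro bdd_belowI2)
  have d_le: "d \<le> J v" if "v \<in> X" for v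
    unfolding d_def using bdd that by (intro cINF_lower)
  have ex: "\<exists>v\<in>X. J v < d + 1 / real (Suc n)" for n
  proof -
    have "d < d + 1 / real (Suc n)" by simp
    then show ?thesis
      unfolding d_def using bdd zero_in by (subst (asm) cINF_less_iff) auto
  qed
  define v where "v n = (SOME u. u \<in> X \<and> J u < d + 1 / real (Suc n))" for n
  have v: "v n \<in> X" "J (v n) < d + 1 / real (Suc n)" for n
    using someI_ex[of "\<lambda>u. u \<in> X \<and> J u < d + 1 / real (Suc n)"] ex[of n] unfolding v_def by blast+
  have parallelogram: "(N (a - b))\<^sup>2 = 4 * (J a + J b - 2 * J ((1/2) *\<^sub>R (a + b)))"
    if "a \<in> X" "b \<in> X" for a b
  proof -
    have "F ((1/2) *\<^sub>R (a + b)) = (F a + F b) / 2"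
      using that by (simp add: add scale add_in del: scaleR_add_right)
    moreover have "(N ((1/2) *\<^sub>R (a + b)))\<^sup>2 = (N (a + b))\<^sup>2 / 4"
      using that by (simp add: N_scaleR add_in power_divide del: scaleR_add_right)
    moreover have "(N (a + b))\<^sup>2 = (N a)\<^sup>2 + 2 * ip a b + (N b)\<^sup>2"
      using N_power2_add_scaleR[OF that, of 1] by simp
    moreover have "(N (a - b))\<^sup>2 = (N a)\<^sup>2 - 2 * ip a b + (N b)\<^sup>2"
      using N_power2_add_scaleR[OF that, of "-1"] by simp
    ultimately show ?thesis by (simp add: J_def field_simps)
  qed
  \<comment> \<open>8 = 4 * 2: the factor 4 is that of the parallelogram identity,
    \<open>J (v m)\<close> and \<open>J (v n)\<close> each exceed the infimum \<open>d\<close> by at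
    most \<open>1 / Suc K\<close>, and \<open>J\<close> at the midpoint is at least
    \<open>d\<close>.\<close>
  have close: "(N (v m - v n))\<^sup>2 \<le> 8 / real (Suc K)" if "m \<ge> K" "n \<ge> K" for m n K
  proof -
    have "1 / real (Suc m) \<le> 1 / real (Suc K)" "1 / real (Suc n) \<le> 1 / real (Suc K)"
      using that by (auto intro!: divide_left_mono)
    then show ?thesis
      using parallelogram[OF v(1) v(1), of m n] v(2)[of m] v(2)[of n]
        d_le[OF scaleR_in[OF add_in[OF v(1) v(1)]], of "1/2" m n] by simp
  qed
  have cauchy: "\<exists>K. \<forall>m\<ge>K. \<forall>n\<ge>K. N (v m - v n) < e" if "e > 0" for e
  proof -
    obtain K where K: "8 / e\<^sup>2 < real K" using reals_Archimedean2 by blast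
    have "N (v m - v n) < e" if "m \<ge> K" "n \<ge> K" for m n
    proof (rule power2_less_imp_less)
      have "8 / real (Suc K) < e\<^sup>2"
        using K \<open>e > 0\<close> by (simp add: field_simps) (smt (verit) zero_less_power)
      then show "(N (v m - v n))\<^sup>2 < e\<^sup>2"
        using close[OF that] by simp
    qed (use \<open>e > 0\<close> in simp)
    then show ?thesis by blast
  qed
  obtain w where w: "w \<in> X" "(\<lambda>n. N (v n - w)) \<longlonglongrightarrow> 0"
    using complete[OF v(1) cauchy] by blast
  \<comment> \<open>Only \<open>ip\<close> has to pass to the limit:
    \<open>d \<le> J (v n + s *\<^sub>R u)\<close> is expanded around \<open>v n\<close>, and
    \<open>J (v n)\<close> exceeds \<open>d\<close> by less than \<open>1 / Suc n\<close>.\<close>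
  have var: "0 \<le> s * (ip w u - F u) + s\<^sup>2 / 2 * (N u)\<^sup>2" if u: "u \<in> X" for u s
  proof -
    have "0 \<le> s * (ip (v n) u - F u) + s\<^sup>2 / 2 * (N u)\<^sup>2 + 1 / real (Suc n)" for n
    proof -
      have "J (v n + s *\<^sub>R u) = J (v n) + s * (ip (v n) u - F u) + s\<^sup>2 / 2 * (N u)\<^sup>2"
        using v(1)[of n] u by (simp add: J_def N_power2_add_scaleR add scale scaleR_in field_simps)
      then show ?thesis
        using d_le[OF add_in[OF v(1) scaleR_in[OF u]], of n s] v(2)[of n] by linarith
    qed
    moreover have "(\<lambda>n. s * (ip (v n) u - F u) + s\<^sup>2 / 2 * (N u)\<^sup>2 + 1 / real (Suc n))
        \<longlonglongrightarrow> s * (ip w u - F u) + s\<^sup>2 / 2 * (N u)\<^sup>2 + 0"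
      by (intro tendsto_add tendsto_mult_left tendsto_diff tendsto_const
          LIMSEQ_inverse_real_of_nat[unfolded inverse_eq_divide] ip_tendsto[OF w(1) v(1) u w(2)])
    ultimately have "0 \<le> s * (ip w u - F u) + s\<^sup>2 / 2 * (N u)\<^sup>2 + 0"
      by (intro LIMSEQ_le_const) auto
    then show ?thesis by simp
  qed
  have "ip w u = F u" if "u \<in> X" for u
    using quadratic_nonneg_imp_zero[OF var[OF that]] by simp
  then show ?thesis using w(1) by blast
qed

text \<open>Along \<open>w + s *\<^sub>R v\<close> the functional is an exact quadratic in
  \<open>s\<close>. Minimality gives the first-order condition in every direction; conversely, once
  the linear term is zero, the step \<open>s = 1\<close> towards a competitor only adds half a
  squared seminorm.\<close>

lemma minimizer_iff:
  assumes add: "\<And>u v. u \<in> X \<Longrightarrow> v \<in> X \<Longrightarrow> F (u + v) = F u + F v"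
    and scale: "\<And>c u. u \<in> X \<Longrightarrow> F (c *\<^sub>R u) = c * F u" and w: "w \<in> X"
  shows "(\<forall>v\<in>X. (N w)\<^sup>2 / 2 - F w \<le> (N v)\<^sup>2 / 2 - F v) \<longleftrightarrow> (\<forall>v\<in>X. ip w v = F v)"
proof
  have expand: "(N (w + s *\<^sub>R v))\<^sup>2 / 2 - F (w + s *\<^sub>R v)
      = (N w)\<^sup>2 / 2 - F w + (s * (ip w v - F v) + s\<^sup>2 / 2 * (N v)\<^sup>2)" if "v \<in> X" for s v
    using that w by (simp add: N_power2_add_scaleR add scale scaleR_in field_simps)
  {
    assume min: "\<forall>v\<in>X. (N w)\<^sup>2 / 2 - F w \<le> (N v)\<^sup>2 / 2 - F v"
    show "\<forall>v\<in>X. ip w v = F v"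
    proof
      fix v assume v: "v \<in> X"
      have "0 \<le> s * (ip w v - F v) + s\<^sup>2 / 2 * (N v)\<^sup>2" for s
        using bspec[OF min add_in[OF w scaleR_in[OF v]], of s] expand[OF v, of s] by simp
      from quadratic_nonneg_imp_zero[OF this] show "ip w v = F v" by simp
    qed
  next
    assume eq: "\<forall>v\<in>X. ip w v = F v"
    show "\<forall>v\<in>X. (N w)\<^sup>2 / 2 - F w \<le> (N v)\<^sup>2 / 2 - F v"
    proof
      fix v assume v: "v \<in> X"
      show "(N w)\<^sup>2 / 2 - F w \<le> (N v)\<^sup>2 / 2 - F v"
        using expand[OF diff_in[OF v w], of 1] eq diff_in[OF v w] by simp
    qed
  }
qed

section \<open>Bochner integrals through their inner products\<close>

lemma borel_measurable_ip:
  assumes u: "strongly_measurable T X N u" and v: "v \<in> X"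
  shows "(\<lambda>t. ip (u t) v) \<in> borel_measurable (time T)"
proof -
  obtain s where s: "\<And>n. simple_function (time T) (s n)" "\<And>n t. t \<in> {0<..<T} \<Longrightarrow> s n t \<in> X"
      "AE t in time T. (\<lambda>n. N (s n t - u t)) \<longlonglongrightarrow> 0"
    by (rule strongly_measurableE[OF u]) blast
  show ?thesis
  proof (rule borel_measurable_lebesgue_on_AE_limit)
    show "(\<lambda>t. ip (s n t) v) \<in> borel_measurable (time T)" for n
      by (rule borel_measurable_simple_function, rule simple_function_compose1, rule s)
    show "AE t in time T. (\<lambda>n. ip (s n t) v) \<longlonglongrightarrow> ip (u t) v"
      using s(3) strongly_measurable_in[OF u] AE_space
    proof eventually_elim
      case (elim t)
      with s(2) show ?case by (intro ip_tendsto[OF elim(2) _ v elim(1)]) simp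
    qed
  qed simp
qed

lemma integrable_ip:
  assumes u: "strongly_measurable T X N u" and int: "integrable (time T) (\<lambda>t. N (u t))" and v: "v \<in> X"
  shows "integrable (time T) (\<lambda>t. ip (u t) v)"
proof (rule Bochner_Integration.integrable_bound)
  show "integrable (time T) (\<lambda>t. N (u t) * N v)" using int by simp
  show "AE t in time T. norm (ip (u t) v) \<le> norm (N (u t) * N v)"
    using strongly_measurable_in[OF u]
    by eventually_elim (use Cauchy_Schwarz v in \<open>auto intro: order_trans[OF _ abs_ge_self]\<close>)
qed (rule borel_measurable_ip[OF u v])

lemma simple_bochner_integrable_time:
  "simple_function (time T) s \<Longrightarrow> Bochner_Integration.simple_bochner_integrable (time T) s"
  using finite_measure.emeasure_finite[OF finite_measure_time]
  by (auto intro!: Bochner_Integration.simple_bochner_integrable.intros)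

lemma ip_simple_bochner_integral:
  assumes s: "simple_function (time T) s" "s ` {0<..<T} \<subseteq> X" and v: "v \<in> X"
  shows "ip (Bochner_Integration.simple_bochner_integral (time T) s) v = (LINT t|time T. ip (s t) v)"
proof -
  let ?M = "time T"
  have "(LINT t|?M. ip (s t) v) = Bochner_Integration.simple_bochner_integral ?M (\<lambda>t. ip (s t) v)"
    by (rule simple_bochner_integrable_eq_integral[symmetric],
        rule simple_bochner_integrable_time[OF simple_function_compose1[OF s(1)]])
  \<comment> \<open>The sum runs over the values of \<open>s\<close> and not over those of
    \<open>ip (s t) v\<close>, because different values of \<open>s\<close> may have the same inner
    product with \<open>v\<close>.\<close>
  also have "\<dots> = (\<Sum>y\<in>s ` space ?M. measure ?M {x \<in> space ?M. s x = y} *\<^sub>R ip y v)"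
    by (rule Bochner_Integration.simple_bochner_integral_partition
        [OF simple_bochner_integrable_time[OF simple_function_compose1[OF s(1)]] s(1)]) auto
  also have "\<dots> = ip (Bochner_Integration.simple_bochner_integral ?M s) v"
    unfolding Bochner_Integration.simple_bochner_integral_def
    using s(2) v by (subst ip_sum_left) (auto intro!: scaleR_in sum.cong simp: ip_scaleR_left image_subset_iff)
  finally show ?thesis ..
qed

lemma simple_bochner_integral_in:
  "s ` {0<..<T} \<subseteq> X \<Longrightarrow> Bochner_Integration.simple_bochner_integral (time T) s \<in> X"
  unfolding Bochner_Integration.simple_bochner_integral_def
  by (intro sum_in scaleR_in) (auto simp: image_subset_iff)

text \<open>A Bochner integral is determined only up to seminorm zero, whereas
  \<open>has_weak_time_derivative\<close> demands exactly the value \<open>- I\<close>. This lemma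
  changes the representative of the value.\<close>

lemma has_bochner_integral_in_cong_value:
  assumes I: "has_bochner_integral_in T X N u I" and J: "J \<in> X" "N (I - J) = 0"
  shows "has_bochner_integral_in T X N u J"
proof -
  obtain s where s: "strongly_measurable T X N u" "I \<in> X"
    "\<And>n. Bochner_Integration.simple_bochner_integrable (time T) (s n)" "\<And>n. s n ` {0<..<T} \<subseteq> X"
    "(\<lambda>n. \<integral>\<^sup>+t. ennreal (N (u t - s n t)) \<partial>time T) \<longlonglongrightarrow> 0"
    "(\<lambda>n. N (Bochner_Integration.simple_bochner_integral (time T) (s n) - I)) \<longlonglongrightarrow> 0"
    using I unfolding has_bochner_integral_in_def by blast
  have in_X: "Bochner_Integration.simple_bochner_integral (time T) (s n) \<in> X" for n
    by (rule simple_bochner_integral_in[OF s(4)])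
  have "(\<lambda>n. N (Bochner_Integration.simple_bochner_integral (time T) (s n) - J)) \<longlonglongrightarrow> 0"
  proof (rule tendsto_zero_squeeze[OF s(6)])
    show "0 \<le> N (Bochner_Integration.simple_bochner_integral (time T) (s n) - J)" for n
      by (intro N_nonneg diff_in in_X J)
    show "N (Bochner_Integration.simple_bochner_integral (time T) (s n) - J)
        \<le> N (Bochner_Integration.simple_bochner_integral (time T) (s n) - I)" for n
      using N_triangle3[OF in_X s(2) J(1), of n] J(2) by simp
  qed
  then show ?thesis
    unfolding has_bochner_integral_in_def using s J by blast
qed

text \<open>Riesz representation of the functional
  \<open>v \<mapsto> \<integral> ip (u t) v\<close>, which Cauchy-Schwarz bounds by the integral of
  \<open>N (u t)\<close> times the seminorm of \<open>v\<close>.\<close>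

lemma weak_integral_exists:
  assumes u: "strongly_measurable T X N u" and int: "integrable (time T) (\<lambda>t. N (u t))"
  shows "\<exists>w\<in>X. \<forall>v\<in>X. ip w v = (LINT t|time T. ip (u t) v)"
proof (rule Riesz_representation)
  note X = strongly_measurable_in[OF u]
  show "(LINT t|time T. ip (u t) (a + b)) = (LINT t|time T. ip (u t) a) + (LINT t|time T. ip (u t) b)"
    if "a \<in> X" "b \<in> X" for a b
  proof -
    have "(LINT t|time T. ip (u t) (a + b)) = (LINT t|time T. ip (u t) a + ip (u t) b)"
      by (rule integral_cong_AE)
         (use X that in \<open>auto intro!: borel_measurable_add borel_measurable_ip[OF u] add_in
            simp: ip_add_right elim!: eventually_mono\<close>)
    then show ?thesis using integrable_ip[OF u int] that by simp
  qed
  show "(LINT t|time T. ip (u t) (c *\<^sub>R a)) = c * (LINT t|time T. ip (u t) a)" if "a \<in> X" for a c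
  proof -
    have "(LINT t|time T. ip (u t) (c *\<^sub>R a)) = (LINT t|time T. c * ip (u t) a)"
      by (rule integral_cong_AE)
         (use X that in \<open>auto intro!: borel_measurable_times borel_measurable_ip[OF u] scaleR_in
            simp: ip_scaleR_right elim!: eventually_mono\<close>)
    then show ?thesis by simp
  qed
  show "\<bar>LINT t|time T. ip (u t) a\<bar> \<le> (LINT t|time T. N (u t)) * N a" if a: "a \<in> X" for a
  proof -
    have "\<bar>LINT t|time T. ip (u t) a\<bar> \<le> (LINT t|time T. \<bar>ip (u t) a\<bar>)"
      by (rule integral_abs_bound)
    also have "\<dots> \<le> (LINT t|time T. N (u t) * N a)"
      by (rule integral_mono_AE)
         (use integrable_ip[OF u int a] int X a Cauchy_Schwarz in \<open>auto elim!: eventually_mono\<close>)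
    finally show ?thesis by simp
  qed
qed

text \<open>The value is the weak integral \<open>I\<close>. For simple functions close to
  \<open>u\<close> in mean, the weak identity tested with the difference \<open>d\<close> of the
  simple integral and \<open>I\<close> bounds \<open>(N d)^2\<close> by the mean distance times
  \<open>N d\<close>, so the simple integrals converge to \<open>I\<close>.\<close>

lemma bochner_integral_exists:
  assumes u: "strongly_measurable T X N u" and int: "integrable (time T) (\<lambda>t. N (u t))"
  shows "\<exists>I. has_bochner_integral_in T X N u I"
proof -
  obtain I where I: "I \<in> X" "\<And>v. v \<in> X \<Longrightarrow> ip I v = (LINT t|time T. ip (u t) v)"
    using weak_integral_exists[OF assms] by blast
  obtain s where s: "\<And>n. simple_function (time T) (s n)" "\<And>n t. t \<in> {0<..<T} \<Longrightarrow> s n t \<in> X"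
    "\<And>n. integrable (time T) (\<lambda>t. N (s n t - u t))"
    "(\<lambda>n. LINT t|time T. N (s n t - u t)) \<longlonglongrightarrow> 0"
    by (rule L1_simple_approximation[OF assms]) blast
  have sX: "s n ` {0<..<T} \<subseteq> X" for n using s(2) by auto
  have sm: "strongly_measurable T X N (s n)" for n
    by (rule strongly_measurableI[where s="\<lambda>_. s n"]) (use s in \<open>auto simp: N_zero\<close>)
  note X = strongly_measurable_in[OF u]
  have uX: "AE t in time T. u t \<in> X \<and> s n t \<in> X" for n
    using X AE_space by eventually_elim (use s(2) in auto)
  have eq: "(\<integral>\<^sup>+t. ennreal (N (u t - s n t)) \<partial>time T) = ennreal (LINT t|time T. N (s n t - u t))" for n
  proof -
    have "(\<integral>\<^sup>+t. ennreal (N (u t - s n t)) \<partial>time T) = (\<integral>\<^sup>+t. ennreal (N (s n t - u t)) \<partial>time T)"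
      by (rule nn_integral_cong_AE) (use uX[of n] in \<open>eventually_elim, simp add: N_commute\<close>)
    also have "\<dots> = ennreal (LINT t|time T. N (s n t - u t))"
      by (rule nn_integral_eq_integral[OF s(3)])
         (use uX[of n] in \<open>eventually_elim, simp add: N_nonneg diff_in\<close>)
    finally show ?thesis .
  qed
  have nn: "0 \<le> (LINT t|time T. N (s n t - u t))" for n
    by (rule integral_nonneg_AE) (use uX[of n] in \<open>eventually_elim, simp add: N_nonneg diff_in\<close>)
  have l1: "(\<lambda>n. \<integral>\<^sup>+t. ennreal (N (u t - s n t)) \<partial>time T) \<longlonglongrightarrow> 0"
    unfolding eq using tendsto_ennrealI[OF s(4)] by simp
  let ?S = "\<lambda>n. Bochner_Integration.simple_bochner_integral (time T) (s n)"
  have SX: "?S n \<in> X" for n by (rule simple_bochner_integral_in[OF sX])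
  have le: "N (?S n - I) \<le> (LINT t|time T. N (s n t - u t))" for n
  proof -
    let ?d = "?S n - I"
    have d: "?d \<in> X" by (intro diff_in SX I)
    have int_s: "integrable (time T) (\<lambda>t. ip (s n t) ?d)"
    proof -
      have "integrable (time T) (\<lambda>t. N (s n t))"
      proof (rule Bochner_Integration.integrable_bound)
        show "integrable (time T) (\<lambda>t. N (s n t - u t) + N (u t))" using s(3) int by simp
        show "AE t in time T. norm (N (s n t)) \<le> norm (N (s n t - u t) + N (u t))"
          using uX[of n]
        proof eventually_elim
          case (elim t)
          then show ?case
            using N_triangle[of "s n t - u t" "u t"] N_nonneg[of "s n t"] N_nonneg[of "u t"]
              N_nonneg[of "s n t - u t"] by (auto simp: diff_in)
        qed
      qed (rule borel_measurable_N[OF sm])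
      then show ?thesis by (rule integrable_ip[OF sm _ d])
    qed
    have "(N ?d)\<^sup>2 = ip (?S n) ?d - ip I ?d"
      using N_power2[OF d] ip_diff_left[OF SX I(1) d, of n] by simp
    also have "\<dots> = (LINT t|time T. ip (s n t) ?d) - (LINT t|time T. ip (u t) ?d)"
      by (simp add: I(2)[OF d] ip_simple_bochner_integral[OF s(1) sX d])
    also have "\<dots> = (LINT t|time T. ip (s n t) ?d - ip (u t) ?d)"
      using int_s integrable_ip[OF u int d] by simp
    also have "\<dots> \<le> (LINT t|time T. N (s n t - u t) * N ?d)"
    proof (rule integral_mono_AE)
      show "AE t in time T. ip (s n t) ?d - ip (u t) ?d \<le> N (s n t - u t) * N ?d"
        using uX[of n]
      proof eventually_elim
        case (elim t)
        then show ?case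
          using Cauchy_Schwarz[OF diff_in[of "s n t" "u t"] d] ip_diff_left[of "s n t" "u t" ?d] d by auto
      qed
    qed (use int_s integrable_ip[OF u int d] s(3) in auto)
    also have "\<dots> = (LINT t|time T. N (s n t - u t)) * N ?d" by simp
    finally have "N ?d * N ?d \<le> (LINT t|time T. N (s n t - u t)) * N ?d"
      by (simp add: power2_eq_square)
    then show ?thesis
      using nn[of n] N_nonneg[OF d] by (cases "N ?d = 0") auto
  qed
  have l2: "(\<lambda>n. N (?S n - I)) \<longlonglongrightarrow> 0"
    by (rule tendsto_zero_squeeze[OF s(4) N_nonneg[OF diff_in[OF SX I(1)]] le])
  have "has_bochner_integral_in T X N u I"
    unfolding has_bochner_integral_in_def
    by (intro conjI exI[of _ s] allI u I(1) sX l1 l2 simple_bochner_integrable_time s(1))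
  then show ?thesis by blast
qed

text \<open>Simple integrals commute with \<open>ip\<close>, and the definition supplies both the
  convergence of the simple integrals and that of the mean distances. The estimate is made in
  \<open>ennreal\<close> because the definition measures distance by a nonnegative integral. It
  turns a vector-valued weak derivative into one scalar identity for each \<open>v\<close>.\<close>

lemma ip_bochner_integral:
  assumes I: "has_bochner_integral_in T X N u I" and int: "integrable (time T) (\<lambda>t. N (u t))" and v: "v \<in> X"
  shows "ip I v = (LINT t|time T. ip (u t) v)"
proof -
  obtain s where s: "strongly_measurable T X N u" "I \<in> X"
    "\<And>n. Bochner_Integration.simple_bochner_integrable (time T) (s n)" "\<And>n. s n ` {0<..<T} \<subseteq> X"
    "(\<lambda>n. \<integral>\<^sup>+t. ennreal (N (u t - s n t)) \<partial>time T) \<longlonglongrightarrow> 0"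
    "(\<lambda>n. N (Bochner_Integration.simple_bochner_integral (time T) (s n) - I)) \<longlonglongrightarrow> 0"
    using I unfolding has_bochner_integral_in_def by blast
  let ?S = "\<lambda>n. Bochner_Integration.simple_bochner_integral (time T) (s n)"
  have sf: "simple_function (time T) (s n)" for n
    using s(3)[of n] by cases
  have SX: "?S n \<in> X" for n by (rule simple_bochner_integral_in[OF s(4)])
  have sX: "t \<in> {0<..<T} \<Longrightarrow> s n t \<in> X" for n t using s(4)[of n] by auto
  have sm: "strongly_measurable T X N (s n)" for n
    by (rule strongly_measurableI[where s="\<lambda>_. s n"]) (use sf sX in \<open>auto simp: N_zero\<close>)
  have uX: "AE t in time T. u t \<in> X \<and> s n t \<in> X" for n
    using strongly_measurable_in[OF s(1)] AE_space by eventually_elim (use sX in auto)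
  have l1: "(\<lambda>n. ip (?S n) v) \<longlonglongrightarrow> ip I v"
    by (rule ip_tendsto[OF s(2) SX v s(6)])
  have md: "(\<lambda>t. N (u t - s n t)) \<in> borel_measurable (time T)" for n
    by (intro borel_measurable_N strongly_measurable_diff s(1) sm)
  have le: "ennreal \<bar>ip (?S n) v - (LINT t|time T. ip (u t) v)\<bar>
      \<le> ennreal (N v) * (\<integral>\<^sup>+t. ennreal (N (u t - s n t)) \<partial>time T)" for n
  proof -
    have int_s: "integrable (time T) (\<lambda>t. ip (s n t) v)"
      by (rule integrable.intros[OF has_bochner_integral_simple_bochner_integrable
          [OF simple_bochner_integrable_time[OF simple_function_compose1[OF sf]]]])
    have "ip (?S n) v - (LINT t|time T. ip (u t) v) = (LINT t|time T. ip (s n t) v - ip (u t) v)"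
      using int_s integrable_ip[OF s(1) int v] by (simp add: ip_simple_bochner_integral[OF sf s(4) v])
    then have "ennreal \<bar>ip (?S n) v - (LINT t|time T. ip (u t) v)\<bar>
        \<le> (\<integral>\<^sup>+t. norm (ip (s n t) v - ip (u t) v) \<partial>time T)"
      using integral_norm_bound_ennreal[of "time T" "\<lambda>t. ip (s n t) v - ip (u t) v"]
        int_s integrable_ip[OF s(1) int v] by simp
    also have "\<dots> \<le> (\<integral>\<^sup>+t. ennreal (N v) * ennreal (N (u t - s n t)) \<partial>time T)"
    proof (rule nn_integral_mono_AE, use uX[of n] in eventually_elim)
      case (elim t)
      then have "\<bar>ip (s n t) v - ip (u t) v\<bar> \<le> N v * N (u t - s n t)"
        using Cauchy_Schwarz[OF diff_in[of "s n t" "u t"] v] ip_diff_left[of "s n t" "u t" v] v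
          N_commute[of "s n t" "u t"] by (auto simp: mult.commute)
      then show ?case
        using elim v by (simp add: N_nonneg diff_in flip: ennreal_mult)
    qed
    also have "\<dots> = ennreal (N v) * (\<integral>\<^sup>+t. ennreal (N (u t - s n t)) \<partial>time T)"
      using md by (intro nn_integral_cmult) measurable
    finally show ?thesis .
  qed
  have "(\<lambda>n. ennreal (N v) * (\<integral>\<^sup>+t. ennreal (N (u t - s n t)) \<partial>time T)) \<longlonglongrightarrow> ennreal (N v) * 0"
    by (intro ennreal_tendsto_cmult s(5)) simp
  then have "(\<lambda>n. ennreal \<bar>ip (?S n) v - (LINT t|time T. ip (u t) v)\<bar>) \<longlonglongrightarrow> 0"
    by (intro tendsto_sandwich[OF always_eventually[OF allI] always_eventually[OF allI[OF le]] tendsto_const])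
       simp_all
  then have "(\<lambda>n. \<bar>ip (?S n) v - (LINT t|time T. ip (u t) v)\<bar>) \<longlonglongrightarrow> 0"
    using tendsto_ennreal_iff[of "\<lambda>n. \<bar>ip (?S n) v - (LINT t|time T. ip (u t) v)\<bar>" sequentially 0] by simp
  then have "(\<lambda>n. ip (?S n) v) \<longlonglongrightarrow> (LINT t|time T. ip (u t) v)"
    by (simp add: tendsto_rabs_zero_iff LIM_zero_iff)
  then show ?thesis using l1 LIMSEQ_unique by blast
qed

end

section \<open>Test functions\<close>

lemma Ck_SucD: "Ck (Suc k) \<psi> \<Longrightarrow> Ck k \<psi>"
proof (induction k arbitrary: \<psi>)
  case 0
  then show ?case
    by (auto simp: continuous_on_eq_continuous_at intro: differentiable_imp_continuous_within)
next
  case (Suc k)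
  then have "\<forall>x. \<psi> differentiable (at x)" "\<And>b. b \<in> Basis \<Longrightarrow> Ck (Suc k) (\<lambda>x. frechet_derivative \<psi> (at x) b)"
    by auto
  then show ?case using Suc.IH by auto
qed

lemma Ck_SucI:
  assumes "\<And>x. (\<psi> has_derivative D x) (at x)" "\<And>b. b \<in> Basis \<Longrightarrow> Ck k (\<lambda>x. D x b)"
  shows "Ck (Suc k) \<psi>"
proof -
  have "frechet_derivative \<psi> (at x) = D x" for x
    using frechet_derivative_at[OF assms(1)] by simp
  then show ?thesis using assms by (auto simp: differentiable_def)
qed

lemma Ck_const: "Ck k (\<lambda>x. c)"
proof (induction k arbitrary: c)
  case (Suc k)
  show ?case by (rule Ck_SucI[where D="\<lambda>x b. 0"]) (auto intro: Suc)
qed simp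

lemma Ck_add: "Ck k f \<Longrightarrow> Ck k g \<Longrightarrow> Ck k (\<lambda>x. f x + g x)"
proof (induction k arbitrary: f g)
  case 0
  then show ?case by (auto intro: continuous_on_add)
next
  case (Suc k)
  have d: "(f has_derivative frechet_derivative f (at x)) (at x)"
    "(g has_derivative frechet_derivative g (at x)) (at x)" for x
    using Suc.prems by (auto simp: frechet_derivative_works)
  show ?case
    by (rule Ck_SucI[OF has_derivative_add[OF d]]) (use Suc in auto)
qed

lemma Ck_mult: "Ck k f \<Longrightarrow> Ck k g \<Longrightarrow> Ck k (\<lambda>x. f x * g x)"
proof (induction k arbitrary: f g)
  case 0
  then show ?case by (auto intro: continuous_on_mult)
next
  case (Suc k)
  have d: "(f has_derivative frechet_derivative f (at x)) (at x)"
    "(g has_derivative frechet_derivative g (at x)) (at x)" for x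
    using Suc.prems by (auto simp: frechet_derivative_works)
  show ?case
    by (rule Ck_SucI[OF has_derivative_mult[OF d]])
       (use Suc Ck_SucD[OF Suc.prems(1)] Ck_SucD[OF Suc.prems(2)] in \<open>auto intro!: Ck_add\<close>)
qed

lemma Ck_prod: "(\<And>i. i \<in> I \<Longrightarrow> Ck k (f i)) \<Longrightarrow> Ck k (\<lambda>x. \<Prod>i\<in>I. f i x)"
  by (induction I rule: infinite_finite_induct) (auto intro: Ck_const Ck_mult)

text \<open>
  The functions \<open>p (1 / y) exp (- 1 / y)\<close>, extended by zero to \<open>y \<le> 0\<close>, are closed under
  differentiation.
\<close>

definition flat :: "real poly \<Rightarrow> real \<Rightarrow> real"
  where "flat p y = (if y > 0 then poly p (1 / y) * exp (- (1 / y)) else 0)"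

text \<open>With \<open>x = 1 / y\<close>, the derivative of \<open>p(1/y) exp(-1/y)\<close> in
  \<open>y\<close> is \<open>x^2 (p(x) - p'(x)) exp(-x)\<close>; the factor
  \<open>[:0, 0, 1:]\<close> is the polynomial \<open>x^2\<close>.\<close>

definition flat_deriv :: "real poly \<Rightarrow> real poly"
  where "flat_deriv p = [:0, 0, 1:] * (p - pderiv p)"

lemma poly_mult_exp_tendsto_0: "((\<lambda>x::real. poly p x * exp (- x)) \<longlongrightarrow> 0) at_top"
proof -
  have "((\<lambda>x::real. \<Sum>i\<le>degree p. coeff p i * (x ^ i / exp x)) \<longlongrightarrow> (\<Sum>i\<le>degree p. coeff p i * 0)) at_top"
    by (intro tendsto_sum tendsto_mult_left tendsto_power_div_exp_0)
  then show ?thesis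
    by (simp add: poly_altdef exp_minus sum_distrib_right divide_inverse mult.assoc)
qed

lemma flat_has_derivative: "(flat p has_real_derivative flat (flat_deriv p) y) (at y)"
proof -
  consider "y > 0" | "y < 0" | "y = 0" by linarith
  then show ?thesis
  proof cases
    case 1
    have "((\<lambda>y. poly p (1 / y) * exp (- (1 / y))) has_real_derivative flat (flat_deriv p) y) (at y)"
      using 1 by (auto intro!: derivative_eq_intros DERIV_chain2[OF poly_DERIV]
          simp: flat_def flat_deriv_def power2_eq_square field_simps)
    then show ?thesis
      by (rule has_field_derivative_transform_within_open[of _ _ _ "{0<..}"]) (use 1 in \<open>auto simp: flat_def\<close>)
  next
    case 2
    have "((\<lambda>y. 0) has_real_derivative flat (flat_deriv p) y) (at y)"
      using 2 by (simp add: flat_def)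
    then show ?thesis
      by (rule has_field_derivative_transform_within_open[of _ _ _ "{..<0}"]) (use 2 in \<open>auto simp: flat_def\<close>)
  next
    case 3
    \<comment> \<open>For \<open>h > 0\<close> the difference quotient at 0 is
      \<open>x p(x) exp(-x)\<close> with \<open>x = 1 / h\<close>, whence the extra factor
      \<open>[:0, 1:]\<close>.\<close>
    have "((\<lambda>x::real. poly ([:0, 1:] * p) x * exp (- x)) \<longlongrightarrow> 0) at_top"
      by (rule poly_mult_exp_tendsto_0)
    then have "((\<lambda>h. poly ([:0, 1:] * p) (inverse h) * exp (- inverse h)) \<longlongrightarrow> 0) (at_right 0)"
      by (rule filterlim_compose[OF _ filterlim_inverse_at_top_right])
    then have r: "((\<lambda>h. (flat p h - flat p 0) / (h - 0)) \<longlongrightarrow> 0) (at_right 0)"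
      by (rule Lim_transform_eventually)
         (auto simp: eventually_at_filter flat_def field_simps)
    have l: "((\<lambda>h. (flat p h - flat p 0) / (h - 0)) \<longlongrightarrow> 0) (at_left 0)"
      by (rule Lim_transform_eventually[OF tendsto_const])
         (auto simp: eventually_at_filter flat_def)
    have "((\<lambda>h. (flat p h - flat p 0) / (h - 0)) \<longlongrightarrow> 0) (at 0)"
      using l r by (simp add: filterlim_at_split)
    then show ?thesis
      using 3 by (simp add: has_field_derivative_iff flat_def)
  qed
qed

text \<open>The induction is over all \<open>p\<close> at once: differentiation replaces
  \<open>p\<close> by \<open>flat_deriv p\<close> and adds a constant factor.\<close>

lemma Ck_flat_affine: "Ck k (\<lambda>x::'a::euclidean_space. flat p (x \<bullet> v + c))"
proof (induction k arbitrary: p)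
  case 0
  have "continuous_on UNIV (flat p)"
    using DERIV_isCont[OF flat_has_derivative] by (simp add: continuous_on_eq_continuous_at)
  then have "continuous_on UNIV (\<lambda>x. flat p (x \<bullet> v + c))"
    by (rule continuous_on_compose2) (auto intro!: continuous_intros)
  then show ?case by simp
next
  case (Suc k)
  show ?case
  proof (rule Ck_SucI)
    fix x :: 'a
    have "((\<lambda>x. x \<bullet> v + c) has_derivative (\<lambda>h. h \<bullet> v)) (at x)"
      by (auto intro!: derivative_eq_intros)
    from has_derivative_compose[OF this flat_has_derivative[of p, unfolded has_field_derivative_def]]
    show "((\<lambda>x. flat p (x \<bullet> v + c)) has_derivative (\<lambda>h. flat (flat_deriv p) (x \<bullet> v + c) * (h \<bullet> v))) (at x)" .
  qed (intro Ck_mult Suc Ck_const)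
qed

section \<open>Smooth bumps on boxes\<close>

definition box_bump :: "nat \<Rightarrow> 'a \<Rightarrow> 'a \<Rightarrow> 'a::euclidean_space \<Rightarrow> real"
  where "box_bump n a b x =
    (\<Prod>i\<in>Basis. flat 1 (real (Suc n) * ((x - a) \<bullet> i)) * flat 1 (real (Suc n) * ((b - x) \<bullet> i)))"

lemma Ck_box_bump: "Ck k (box_bump n a b)"
proof -
  have "box_bump n a b = (\<lambda>x. \<Prod>i\<in>Basis. flat 1 (x \<bullet> (real (Suc n) *\<^sub>R i) + (- real (Suc n) * (a \<bullet> i)))
      * flat 1 (x \<bullet> (- real (Suc n) *\<^sub>R i) + (real (Suc n) * (b \<bullet> i))))"
    by (simp add: box_bump_def fun_eq_iff inner_diff_left algebra_simps)
  then show ?thesis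
    by (simp only:) (intro Ck_prod Ck_mult Ck_flat_affine)
qed

lemma flat_1_range: "0 \<le> flat 1 y" "flat 1 y \<le> 1" "flat 1 y = 0 \<longleftrightarrow> y \<le> 0"
  by (auto simp: flat_def)

lemma box_bump_range: "0 \<le> box_bump n a b x" "box_bump n a b x \<le> 1"
  unfolding box_bump_def
  by (auto intro!: prod_nonneg prod_le_1 mult_nonneg_nonneg mult_le_one simp: flat_1_range)

text \<open>The multiplier \<open>Suc n\<close> is positive for every \<open>n\<close>, so already
  the bump with \<open>n = 0\<close> is positive on the whole open box; this one serves as the
  reference function in \<open>du_Bois_Reymond\<close>.\<close>

lemma box_bump_eq_0_iff: "box_bump n a b x = 0 \<longleftrightarrow> x \<notin> box a b"
  by (auto simp: box_bump_def flat_1_range mem_box inner_diff_left not_less mult_le_0_iff)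

lemma box_bump_tendsto:
  fixes x :: "'a::euclidean_space"
  shows "(\<lambda>n. box_bump n a b x) \<longlonglongrightarrow> indicator (box a b) x"
proof (cases "x \<in> box a b")
  case True
  have lim: "(\<lambda>n. flat 1 (real (Suc n) * y)) \<longlonglongrightarrow> 1" if "y > 0" for y
  proof -
    have "(\<lambda>n. exp (- (inverse (real (Suc n)) * (1 / y)))) \<longlonglongrightarrow> exp (- (0 * (1 / y)))"
      by (intro tendsto_intros LIMSEQ_inverse_real_of_nat)
    moreover have "exp (- (inverse (real (Suc n)) * (1 / y))) = flat 1 (real (Suc n) * y)" for n
      using mult_pos_pos[OF _ that, of "real (Suc n)"] by (simp add: flat_def inverse_eq_divide)
    ultimately show ?thesis by simp
  qed
  have "(\<lambda>n. box_bump n a b x) \<longlonglongrightarrow> (\<Prod>i\<in>(Basis::'a set). 1 * 1)"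
    unfolding box_bump_def
    by (intro tendsto_prod tendsto_mult lim) (use True in \<open>auto simp: mem_box inner_diff_left\<close>)
  then show ?thesis using True by simp
next
  case False
  then have "box_bump n a b x = 0" for n by (simp add: box_bump_eq_0_iff)
  then show ?thesis using False by simp
qed

lemma box_bump_test_function:
  assumes "cbox a b \<subseteq> S"
  shows "box_bump n a b \<in> test_functions S"
proof -
  have "closure {x. box_bump n a b x \<noteq> 0} \<subseteq> cbox a b"
    by (rule closure_minimal) (use box_subset_cbox in \<open>auto simp: box_bump_eq_0_iff\<close>)
  then have "compact (closure {x. box_bump n a b x \<noteq> 0})" "closure {x. box_bump n a b x \<noteq> 0} \<subseteq> S"
    using assms bounded_subset[OF bounded_cbox] by (auto simp: compact_eq_bounded_closed)
  then show ?thesis by (simp add: test_functions_def Ck_box_bump)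
qed

section \<open>The fundamental lemma of the calculus of variations\<close>

lemma AE_zero_if_box_integrals_zero:
  fixes g :: "'a::euclidean_space \<Rightarrow> real"
  assumes g: "integrable lborel g" and box: "\<And>a b. (LINT x:box a b|lborel. g x) = 0"
    and tot: "(LINT x|lborel. g x) = 0"
  shows "AE x in lborel. g x = 0"
proof (rule sigma_finite_measure.density_zero[OF lborel.sigma_finite_measure_axioms g])
  have si: "set_integrable lborel A g" if "A \<in> sets borel" for A
    unfolding set_integrable_def using g that by (intro integrable_mult_indicator) auto
  have sb: "sigma_sets UNIV (range (\<lambda>(a, b). box a b)) = (sets borel :: 'a set set)"
    by (simp add: borel_eq_box)
  fix A :: "'a set" assume "A \<in> sets lborel"
  then have A: "A \<in> sigma_sets UNIV (range (\<lambda>(a, b). box a b))" by (simp add: sb)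
  have stable: "Int_stable (range (\<lambda>(a, b). box a b :: 'a set))"
    by (auto simp: Int_stable_def box_Int_box)
  \<comment> \<open>Dynkin's argument: the sets on which \<open>g\<close> integrates to zero contain
    the intersection-stable generator of open boxes and are closed under disjoint countable unions;
    closure under complements comes from \<open>tot\<close>, the whole space being no box.\<close>
  show "(LINT x:A|lborel. g x) = 0"
  proof (rule sigma_sets_induct_disjoint[OF stable _ A])
    fix A :: "'a set" assume "A \<in> sigma_sets UNIV (range (\<lambda>(a, b). box a b))"
      and 0: "(LINT x:A|lborel. g x) = 0"
    then have A: "A \<in> sets borel" by (simp add: sb)
    have "(LINT x:UNIV|lborel. g x) = (LINT x:(UNIV - A) \<union> A|lborel. g x)" by simp
    also have "\<dots> = (LINT x:UNIV - A|lborel. g x) + (LINT x:A|lborel. g x)"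
      by (rule set_integral_Un) (use A in \<open>auto intro!: si\<close>)
    finally show "(LINT x:UNIV - A|lborel. g x) = 0"
      using 0 tot by (simp add: set_lebesgue_integral_def)
  next
    fix A :: "nat \<Rightarrow> 'a set"
    assume disj: "disjoint_family A" and r: "range A \<subseteq> sigma_sets UNIV (range (\<lambda>(a, b). box a b))"
      and 0: "\<And>i. (LINT x:A i|lborel. g x) = 0"
    then have A: "A i \<in> sets borel" for i using sb by auto
    have "(LINT x:(\<Union>i. A i)|lborel. g x) = (\<Sum>i. (LINT x:(A i)|lborel. g x))"
    proof (rule lebesgue_integral_countable_add)
      show "A i \<inter> A j = {}" if "i \<noteq> j" for i j
        using disj that by (auto simp: disjoint_family_on_def)
    qed (use A in \<open>auto intro!: si\<close>)
    then show "(LINT x:(\<Union>i. A i)|lborel. g x) = 0" using 0 by simp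
  qed (use box in \<open>auto simp: set_lebesgue_integral_def\<close>)
qed

text \<open>The bumps of a box are test functions on \<open>S\<close> if its closed box lies in
  \<open>S\<close>. Therefore \<open>h\<close> is cut off to \<open>box c d\<close>: any box meets
  it in a box whose closure stays in \<open>cbox c d\<close>, so all box integrals of the cut-off
  function vanish.\<close>

lemma fundamental_lemma_box:
  fixes h :: "'a::euclidean_space \<Rightarrow> real"
  assumes S: "open S" and h: "integrable (lebesgue_on S) h"
    and test: "\<And>\<psi>. \<psi> \<in> test_functions S \<Longrightarrow> (LINT x|lebesgue_on S. \<psi> x * h x) = 0"
    and cd: "cbox c d \<subseteq> S"
  shows "AE x in lebesgue. x \<in> box c d \<longrightarrow> h x = 0"
proof -
  have Sm: "S \<in> sets lebesgue" using S by (simp add: lborelD)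
  have box0: "(LINT x|lebesgue_on S. indicator (box a b) x * h x) = 0" if "cbox a b \<subseteq> S" for a b
  proof -
    have m: "indicator (box a b) \<in> borel_measurable (lebesgue_on S)"
      by (intro measurable_restrict_space1 borel_measurable_indicator) simp
    have mb: "box_bump n a b \<in> borel_measurable (lebesgue_on S)" for n
      using Ck_box_bump[of 0 n a b] Sm
      by (intro continuous_imp_measurable_on_sets_lebesgue) (auto intro: continuous_on_subset)
    have "(\<lambda>n. LINT x|lebesgue_on S. box_bump n a b x * h x) \<longlonglongrightarrow> (LINT x|lebesgue_on S. indicator (box a b) x * h x)"
    proof (rule integral_dominated_convergence[where w="\<lambda>x. \<bar>h x\<bar>"])
      show "AE x in lebesgue_on S. (\<lambda>n. box_bump n a b x * h x) \<longlonglongrightarrow> indicator (box a b) x * h x"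
        by (intro AE_I2 tendsto_mult_right box_bump_tendsto)
      show "AE x in lebesgue_on S. norm (box_bump n a b x * h x) \<le> \<bar>h x\<bar>" for n
        by (intro AE_I2) (simp add: abs_mult box_bump_range mult_left_le_one_le)
    qed (use h m mb in \<open>auto intro!: borel_measurable_times\<close>)
    moreover have "(LINT x|lebesgue_on S. box_bump n a b x * h x) = 0" for n
      by (rule test[OF box_bump_test_function[OF that]])
    ultimately show ?thesis by (simp add: LIMSEQ_const_iff)
  qed
  define g0 where "g0 x = indicator (box c d) x * h x" for x
  have cdS: "box c d \<subseteq> S" using cd box_subset_cbox by blast
  have bm: "box a b \<in> sets lebesgue" for a b :: 'a by simp
  have restr: "indicator S x *\<^sub>R (indicator B x * (indicator (box c d) x * h x)) = indicator B x * g0 x" for x B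
    using cdS by (auto simp: g0_def indicator_def)
  have hS: "integrable lebesgue (\<lambda>x. indicator S x *\<^sub>R h x)"
    using h Sm by (simp add: integrable_restrict_space)
  have g0: "integrable lebesgue g0"
  proof -
    have "integrable lebesgue (\<lambda>x. indicator (box c d) x *\<^sub>R (indicator S x *\<^sub>R h x))"
      by (rule integrable_mult_indicator[OF bm hS])
    moreover have "indicator (box c d) x *\<^sub>R (indicator S x *\<^sub>R h x) = g0 x" for x
      using cdS by (auto simp: g0_def indicator_def)
    ultimately show ?thesis by simp
  qed
  have box0': "(LINT x|lebesgue. indicator (box a b) x * g0 x) = 0" for a b
  proof -
    obtain a' b' where ab: "box a b \<inter> box c d = box a' b'" using box_Int_box by blast
    have "(LINT x|lebesgue. indicator (box a b) x * g0 x) = 0"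
    proof (cases "box a' b' = {}")
      case True
      then have "(\<lambda>x. indicator (box a b) x * g0 x) = (\<lambda>x. 0)"
        using ab by (auto simp: g0_def indicator_def fun_eq_iff)
      then show ?thesis by simp
    next
      case False
      \<comment> \<open>Nonemptiness matters: an empty open box may belong to a nonempty closed box
        with the same corners, which need not lie in \<open>cbox c d\<close>.\<close>
      have "cbox a' b' = closure (box a' b')" using False by (simp add: closure_box)
      also have "\<dots> \<subseteq> cbox c d"
        by (rule closure_minimal) (use ab box_subset_cbox in auto)
      finally have "cbox a' b' \<subseteq> S" using cd by blast
      from box0[OF this] have "(LINT x|lebesgue. indicator S x *\<^sub>R (indicator (box a' b') x * h x)) = 0"
        using Sm by (simp add: integral_restrict_space)
      moreover have "indicator S x *\<^sub>R (indicator (box a' b') x * h x) = indicator (box a b) x * g0 x" for x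
        using ab[symmetric] cdS by (auto simp: g0_def indicator_def)
      ultimately show ?thesis by simp
    qed
    then show ?thesis .
  qed
  \<comment> \<open>The Dynkin argument lives on Borel sets and \<open>lborel\<close>, while the
    cut-off is only Lebesgue measurable; hence a Borel representative.\<close>
  obtain g where g: "g \<in> borel_measurable lborel" "AE x in lborel. g0 x = g x"
    using completion_ex_borel_measurable_real[OF borel_measurable_integrable[OF g0]] by blast
  have ae: "AE x in lebesgue. g0 x = g x" using g(2) by (rule AE_completion)
  have gi: "integrable lebesgue g"
    by (rule integrable_cong_AE_imp[OF g0 measurable_completion[OF g(1)]])
       (use ae in \<open>eventually_elim, simp\<close>)
  have gl: "integrable lborel g" using gi integrable_completion[OF g(1)] by simp
  have "AE x in lborel. g x = 0"
  proof (rule AE_zero_if_box_integrals_zero[OF gl])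
    have b: "(LINT x:box a b|lborel. g x) = 0" for a b
    proof -
      have "(LINT x:box a b|lborel. g x) = (LINT x|lebesgue. indicator (box a b) x * g x)"
        unfolding set_lebesgue_integral_def using g(1)
        by (subst integral_completion) (auto intro!: borel_measurable_times)
      also have "\<dots> = (LINT x|lebesgue. indicator (box a b) x * g0 x)"
        by (rule integral_cong_AE)
           (use ae g0 gi in \<open>auto intro!: borel_measurable_times borel_measurable_indicator elim: eventually_mono\<close>)
      finally show ?thesis using box0' by simp
    qed
    then show "(LINT x:box a b|lborel. g x) = 0" for a b .
    have "(LINT x|lborel. g x) = (LINT x|lebesgue. g x)" using integral_completion[OF g(1)] by simp
    also have "\<dots> = (LINT x|lebesgue. g0 x)"
      by (rule integral_cong_AE) (use ae g0 gi in \<open>auto elim: eventually_mono\<close>)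
    also have "\<dots> = (LINT x|lebesgue. indicator (box c d) x * g0 x)"
      by (rule Bochner_Integration.integral_cong) (auto simp: g0_def indicator_def)
    finally show "(LINT x|lborel. g x) = 0" using box0' by simp
  qed
  then have "AE x in lebesgue. g x = 0" by (rule AE_completion)
  with ae show ?thesis by eventually_elim (auto simp: g0_def)
qed

text \<open>An open set is a countable union of closed boxes, and the boundary of a box is a null
  set.\<close>

lemma fundamental_lemma:
  fixes h :: "'a::euclidean_space \<Rightarrow> real"
  assumes S: "open S" and h: "integrable (lebesgue_on S) h"
    and test: "\<And>\<psi>. \<psi> \<in> test_functions S \<Longrightarrow> (LINT x|lebesgue_on S. \<psi> x * h x) = 0"
  shows "AE x in lebesgue_on S. h x = 0"
proof -
  obtain D where D: "countable D" "D \<subseteq> Pow S" "\<And>X. X \<in> D \<Longrightarrow> \<exists>a b. X = cbox a b" "\<Union>D = S"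
    by (rule open_countable_Union_open_cbox[OF S]) blast
  have "AE x in lebesgue. x \<in> X \<longrightarrow> h x = 0" if XD: "X \<in> D" for X
  proof -
    obtain a b where X: "X = cbox a b" using D(3)[OF XD] by blast
    have "negligible (cbox a b - box a b)" by (rule negligible_frontier_interval)
    then have "AE x in lebesgue. x \<notin> cbox a b - box a b"
      unfolding negligible_iff_null_sets by (rule AE_not_in)
    moreover have "AE x in lebesgue. x \<in> box a b \<longrightarrow> h x = 0"
      by (rule fundamental_lemma_box[OF S h test]) (use D(2) XD X in auto)
    ultimately show ?thesis
      by eventually_elim (use X in blast)
  qed
  then have "AE x in lebesgue. \<forall>X\<in>D. x \<in> X \<longrightarrow> h x = 0"
    by (subst AE_ball_countable[OF D(1)]) blast
  then have "AE x in lebesgue. x \<in> S \<longrightarrow> h x = 0"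
    by eventually_elim (use D(4) in auto)
  then show ?thesis using S by (simp add: AE_restrict_space_iff lborelD)
qed

section \<open>Test functions on an interval and their primitives\<close>

lemma test_function_support:
  assumes "\<psi> \<in> test_functions {0<..<T::real}" "T > 0"
  obtains a b where "0 < a" "a < b" "b < T" "\<And>x. x \<notin> {a..b} \<Longrightarrow> \<psi> x = 0"
proof -
  define K where "K = closure {x. \<psi> x \<noteq> 0}"
  have K: "compact K" "K \<subseteq> {0<..<T}" and sub: "\<And>x. \<psi> x \<noteq> 0 \<Longrightarrow> x \<in> K"
    using assms closure_subset[of "{x. \<psi> x \<noteq> 0}"] unfolding test_functions_def K_def by blast+
  show thesis
  proof (cases "K = {}")
    case True
    then show ?thesis using that[of "T/4" "T/2"] sub assms(2) by fastforce
  next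
    case False
    obtain l where l: "l \<in> K" "\<And>x. x \<in> K \<Longrightarrow> l \<le> x"
      using compact_attains_inf[OF K(1) False] by blast
    obtain u where u: "u \<in> K" "\<And>x. x \<in> K \<Longrightarrow> x \<le> u"
      using compact_attains_sup[OF K(1) False] by blast
    have lu: "0 < l" "l \<le> u" "u < T" using l u K(2) by auto
    show ?thesis
    \<comment> \<open>\<open>l / 2\<close> is still positive and is strictly below \<open>u\<close>
      even if \<open>l = u\<close>.\<close>
    proof (rule that[of "l/2" u])
      show "\<psi> x = 0" if "x \<notin> {l/2..u}" for x
        using that l u sub[of x] lu by force
    qed (use lu in auto)
  qed
qed

lemma Ck_deriv:
  fixes \<psi> :: "real \<Rightarrow> real"
  assumes "\<And>k. Ck k \<psi>"
  shows "(\<psi> has_real_derivative deriv \<psi> t) (at t)" "Ck k (deriv \<psi>)"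
proof -
  have d: "\<psi> differentiable (at x)" for x using assms[of "Suc 0"] by simp
  then show D: "(\<psi> has_real_derivative deriv \<psi> t) (at t)" for t
    by (simp add: DERIV_deriv_iff_real_differentiable)
  have "frechet_derivative \<psi> (at x) 1 = deriv \<psi> x" for x
    using frechet_derivative_at[OF D[unfolded has_field_derivative_def], of x] by (metis mult.right_neutral)
  then show "Ck k (deriv \<psi>)" using assms[of "Suc k"] by simp
qed

lemma Ck_continuous: "(\<And>k. Ck k \<psi>) \<Longrightarrow> continuous_on S \<psi>"
  by (metis Ck.simps(1) continuous_on_subset subset_UNIV)

lemma test_function_Ck: "\<psi> \<in> test_functions S \<Longrightarrow> Ck k \<psi>"
  by (simp add: test_functions_def)

lemma continuous_borel_measurable_lebesgue_on:
  fixes f :: "'a::euclidean_space \<Rightarrow> real"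
  assumes "continuous_on UNIV f" "S \<in> sets lebesgue"
  shows "f \<in> borel_measurable (lebesgue_on S)"
  by (rule continuous_imp_measurable_on_sets_lebesgue[OF _ assms(2)]) (use assms(1) continuous_on_subset in blast)

lemma integrable_bounded_times:
  fixes f g :: "'a::euclidean_space \<Rightarrow> real"
  assumes "f \<in> borel_measurable M" "\<And>x. \<bar>f x\<bar> \<le> B" "integrable M g"
  shows "integrable M (\<lambda>x. f x * g x)"
proof (rule Bochner_Integration.integrable_bound)
  show "integrable M (\<lambda>x. B * g x)" using assms(3) by simp
  show "AE x in M. norm (f x * g x) \<le> norm (B * g x)"
    using order_trans[OF assms(2) abs_ge_self] by (intro AE_I2) (auto simp: abs_mult intro!: mult_right_mono)
qed (use assms in auto)

lemma compact_support_bounded: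
  fixes \<psi> :: "real \<Rightarrow> real"
  assumes "continuous_on UNIV \<psi>" "\<And>x. x \<notin> {a..b} \<Longrightarrow> \<psi> x = 0"
  obtains B where "\<And>x. \<bar>\<psi> x\<bar> \<le> B"
proof -
  have "compact (\<psi> ` {a..b})"
    using assms(1) continuous_on_subset by (intro compact_continuous_image) auto
  from compact_imp_bounded[OF this] obtain B where B: "\<forall>y\<in>\<psi> ` {a..b}. \<bar>y\<bar> \<le> B"
    unfolding bounded_real ..
  show thesis
  proof (rule that[of "max B 0"])
    show "\<bar>\<psi> x\<bar> \<le> max B 0" for x
      using B assms(2)[of x] by (cases "x \<in> {a..b}") (force simp: max_def)+
  qed
qed

lemma test_function_bounded:
  assumes "\<psi> \<in> test_functions {0<..<T::real}" "T > 0"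
  obtains B where "\<And>x. \<bar>\<psi> x\<bar> \<le> B"
proof -
  obtain a b where s: "\<And>x. x \<notin> {a..b} \<Longrightarrow> \<psi> x = 0"
    by (rule test_function_support[OF assms]) blast
  show thesis
    by (rule compact_support_bounded[OF Ck_continuous[OF test_function_Ck[OF assms(1)]] s])
       (use that in blast)+
qed

lemma test_function_deriv:
  assumes \<psi>: "\<psi> \<in> test_functions {0<..<T::real}" and T: "T > 0"
  shows "deriv \<psi> \<in> test_functions {0<..<T}"
proof -
  obtain a b where ab: "0 < a" "a < b" "b < T" "\<And>x. x \<notin> {a..b} \<Longrightarrow> \<psi> x = 0"
    by (rule test_function_support[OF assms]) blast
  have "deriv \<psi> x = 0" if x: "x \<notin> {a..b}" for x
  proof -
    have "((\<lambda>x. 0) has_real_derivative 0) (at x)" by simp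
    then have "(\<psi> has_real_derivative 0) (at x)"
      by (rule has_field_derivative_transform_within_open[of _ _ _ "- {a..b}"])
         (use x ab in \<open>auto simp: open_Compl\<close>)
    then show ?thesis by (rule DERIV_imp_deriv)
  qed
  then have "{x. deriv \<psi> x \<noteq> 0} \<subseteq> {a..b}" by blast
  then have "closure {x. deriv \<psi> x \<noteq> 0} \<subseteq> {a..b}"
    by (rule closure_minimal) simp
  then show ?thesis
    using ab Ck_deriv(2)[OF test_function_Ck[OF \<psi>]] bounded_subset[OF bounded_closed_interval]
    by (auto simp: test_functions_def compact_eq_bounded_closed)
qed

text \<open>Three readings of an integral up to \<open>t\<close>: over the shorter interval as in
  the Volterra estimates, as a gauge integral for the fundamental theorem and for continuity in
  \<open>t\<close>, and with a cut-off over the fixed interval for Fubini and for weak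
  integrals.\<close>

lemma time_integral:
  fixes g :: "real \<Rightarrow> real"
  assumes g: "integrable (time T) g" and t: "t \<in> {0..T}"
  shows "integrable (time t) g" "g integrable_on {0..t}" "(LINT s|time t. g s) = integral {0..t} g"
    "(LINT s|time t. g s) = (LINT s|time T. indicator {..<t} s * g s)"
proof -
  have s: "set_integrable lebesgue {0<..<T} g"
    using g by (simp add: integrable_restrict_space set_integrable_def)
  have s': "set_integrable lebesgue {0<..<t} g"
    by (rule set_integrable_subset[OF s]) (use t in auto)
  then show "integrable (time t) g"
    by (simp add: integrable_restrict_space set_integrable_def)
  have ho: "g integrable_on {0<..<t}" "(LINT s:{0<..<t}|lebesgue. g s) = integral {0<..<t} g"
    using set_lebesgue_integral_eq_integral[OF s'] by auto
  then show "g integrable_on {0..t}"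
    by (simp add: integrable_on_open_interval_real)
  show "(LINT s|time t. g s) = integral {0..t} g"
    using ho(2) by (simp add: integral_restrict_space set_lebesgue_integral_def integral_open_interval_real)
  have "(\<lambda>s. indicator {0<..<t} s *\<^sub>R g s) = (\<lambda>s. indicator {0<..<T} s *\<^sub>R (indicator {..<t} s * g s))"
    using t by (auto simp: indicator_def fun_eq_iff)
  then show "(LINT s|time t. g s) = (LINT s|time T. indicator {..<t} s * g s)"
    by (simp add: integral_restrict_space)
qed

lemma time_integral_continuous:
  fixes g :: "real \<Rightarrow> real"
  assumes g: "integrable (time T) g" and T: "T > 0"
  shows "continuous_on {0..T} (\<lambda>t. LINT s|time t. g s)"
proof -
  have "continuous_on {0..T} (\<lambda>t. integral {0..t} g)"
    using time_integral(2)[OF g, of T] T by (intro indefinite_integral_continuous_1) auto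
  then show ?thesis
    by (subst continuous_on_cong[OF refl time_integral(3)[OF g]]) auto
qed

lemma test_function_integrable:
  assumes "\<psi> \<in> test_functions {0<..<T::real}" "T > 0"
  shows "integrable (time T) \<psi>"
proof -
  obtain B where "\<And>x. \<bar>\<psi> x\<bar> \<le> B" by (rule test_function_bounded[OF assms]) blast
  moreover have "\<psi> \<in> borel_measurable (time T)"
    by (intro continuous_borel_measurable_lebesgue_on Ck_continuous test_function_Ck[OF assms(1)]) auto
  ultimately show ?thesis by (intro integrable_bounded_lebesgue_on) auto
qed

text \<open>The primitive from 0 vanishes to the left of the support anyway; zero mean is what makes
  it vanish to the right as well.\<close>

lemma test_function_antiderivative:
  assumes \<eta>: "\<eta> \<in> test_functions {0<..<T::real}" and T: "T > 0" and int: "(LINT t|time T. \<eta> t) = 0"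
  obtains \<psi> where "\<psi> \<in> test_functions {0<..<T}" "deriv \<psi> = \<eta>"
proof -
  obtain a b where ab: "0 < a" "a < b" "b < T" "\<And>x. x \<notin> {a..b} \<Longrightarrow> \<eta> x = 0"
    by (rule test_function_support[OF \<eta> T]) blast
  note C = Ck_continuous[OF test_function_Ck[OF \<eta>]]
  define \<psi> where "\<psi> x = integral {0..x} \<eta>" for x
  have zero_left: "\<psi> x = 0" if "x < a" for x
  proof -
    have "integral {0..x} \<eta> = integral {0..x} (\<lambda>x. 0)"
      by (rule integral_cong) (use ab that in auto)
    then show ?thesis by (simp add: \<psi>_def)
  qed
  have zero_right: "\<psi> x = 0" if "x > b" for x
  proof -
    have z: "integral {b..y} \<eta> = 0" if "y \<ge> b" for y
    proof -
      have "integral {b..y} \<eta> = integral {b..y} (\<lambda>x. 0)"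
        by (rule integral_spike[of "{b}"]) (use ab that in auto)
      then show ?thesis by simp
    qed
    have "integral {0..y} \<eta> = integral {0..b} \<eta>" if "y \<ge> b" for y
      using Henstock_Kurzweil_Integration.integral_combine[of 0 b y \<eta>] z[OF that] that ab
        integrable_continuous_interval[OF C] by simp
    moreover have "integral {0..T} \<eta> = 0"
      using time_integral(3)[OF test_function_integrable[OF \<eta> T], of T] int T by simp
    ultimately show ?thesis using ab that unfolding \<psi>_def by (metis less_imp_le)
  qed
  have D: "(\<psi> has_real_derivative \<eta> x) (at x)" for x
  proof (cases "x < a")
    case True
    have "((\<lambda>x. 0) has_real_derivative \<eta> x) (at x)" using True ab by simp
    then show ?thesis
      by (rule has_field_derivative_transform_within_open[of _ _ _ "{..<a}"]) (use True zero_left in auto)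
  next
    case False
    \<comment> \<open>Here \<open>x \<ge> a > 0\<close>, so \<open>x\<close> is interior to
      \<open>{0..x + 1}\<close> and the one-sided statement is a genuine derivative.\<close>
    have "(\<psi> has_real_derivative \<eta> x) (at x within {0..x + 1})"
      unfolding \<psi>_def using False ab by (intro integral_has_real_derivative C) auto
    moreover have "at x within {0..x+1} = at x"
      by (rule at_within_interior) (use False ab in simp)
    ultimately show ?thesis by (simp only:)
  qed
  have deriv: "deriv \<psi> = \<eta>" using D by (intro ext DERIV_imp_deriv)
  have Ck: "Ck k \<psi>" for k
  proof (cases k)
    case 0
    then show ?thesis using D by (auto simp: continuous_on_eq_continuous_at intro: DERIV_isCont)
  next
    case (Suc j)
    have "Ck (Suc j) \<psi>"
      by (rule Ck_SucI[OF D[unfolded has_field_derivative_def]]) (simp add: test_function_Ck[OF \<eta>])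
    then show ?thesis using Suc by simp
  qed
  have "closure {x. \<psi> x \<noteq> 0} \<subseteq> {a..b}"
    using zero_left zero_right by (intro closure_minimal) (auto simp: not_less[symmetric])
  then have "\<psi> \<in> test_functions {0<..<T}"
    using ab Ck bounded_subset[OF bounded_closed_interval]
    by (auto simp: test_functions_def compact_eq_bounded_closed)
  then show thesis using that deriv by blast
qed

lemma test_functions_diff_scale:
  fixes f g :: "real \<Rightarrow> real"
  assumes "f \<in> test_functions S" "g \<in> test_functions S"
  shows "(\<lambda>x. f x - c * g x) \<in> test_functions S"
proof -
  have "Ck k (\<lambda>x. f x + (- c) * g x)" for k
    using assms by (intro Ck_add Ck_mult Ck_const) (auto simp: test_functions_def)
  moreover have sub: "closure {x. f x - c * g x \<noteq> 0} \<subseteq> closure {x. f x \<noteq> 0} \<union> closure {x. g x \<noteq> 0}"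
    unfolding closure_Un[symmetric] by (rule closure_mono) auto
  moreover have "bounded (closure {x. f x - c * g x \<noteq> 0})"
    by (rule bounded_subset[OF _ sub])
       (use assms in \<open>auto simp: test_functions_def compact_eq_bounded_closed\<close>)
  ultimately show ?thesis
    using assms by (simp add: test_functions_def compact_eq_bounded_closed) blast
qed

text \<open>Any test function \<open>\<eta>\<close> becomes one of zero mean after subtraction of a
  multiple of a fixed bump \<open>\<theta>\<close>, and then is the derivative of a test function.
  So \<open>h\<close> minus the constant
  \<open>\<integral> \<theta> h / \<integral> \<theta>\<close> is orthogonal to all test
  functions.\<close>

lemma du_Bois_Reymond:
  fixes h :: "real \<Rightarrow> real"
  assumes h: "integrable (time T) h" and T: "T > 0"
    and test: "\<And>\<psi>. \<psi> \<in> test_functions {0<..<T} \<Longrightarrow> (LINT t|time T. deriv \<psi> t * h t) = 0"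
  shows "\<exists>c. AE t in time T. h t = c"
proof -
  define \<theta> where "\<theta> = box_bump 0 (T/4) (T/2)"
  have \<theta>: "\<theta> \<in> test_functions {0<..<T}"
    unfolding \<theta>_def by (rule box_bump_test_function) (use T in \<open>auto simp: cbox_interval\<close>)
  have int_\<psi>: "integrable (time T) \<psi>" "integrable (time T) (\<lambda>t. \<psi> t * h t)"
    if p: "\<psi> \<in> test_functions {0<..<T}" for \<psi>
  proof -
    show i: "integrable (time T) \<psi>" by (rule test_function_integrable[OF p T])
    obtain B where "\<And>x. \<bar>\<psi> x\<bar> \<le> B" by (rule test_function_bounded[OF p T]) blast
    then show "integrable (time T) (\<lambda>t. \<psi> t * h t)"
      by (rule integrable_bounded_times[OF borel_measurable_integrable[OF i] _ h])
  qed
  define m where "m = (LINT t|time T. \<theta> t)"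
  \<comment> \<open>\<open>\<theta>\<close> is positive on \<open>(T/4, T/2)\<close>, which is not a
    null set, so its integral can serve as denominator.\<close>
  have "m \<noteq> 0"
  proof
    assume "m = 0"
    then have "AE t in time T. \<theta> t = 0"
      using integral_nonneg_eq_0_iff_AE[OF int_\<psi>(1)[OF \<theta>]] by (simp add: m_def \<theta>_def box_bump_range)
    then have "AE t in lebesgue. t \<notin> box (T/4) (T/2)"
      using T by (auto simp: AE_restrict_space_iff \<theta>_def box_bump_eq_0_iff box_real elim!: eventually_mono)
    then have "box (T/4) (T/2) \<in> null_sets lebesgue"
      by (subst (asm) AE_iff_null_sets[symmetric, of "box (T/4) (T/2)"]) auto
    then have "negligible (box (T/4) (T/2))" by (simp add: negligible_iff_null_sets)
    then show False using T negligible_interval(2)[of "T/4" "T/2"] by (simp add: box_real)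
  qed
  define c where "c = (LINT t|time T. \<theta> t * h t) / m"
  have "AE t in time T. h t - c = 0"
  proof (rule fundamental_lemma)
    show "integrable (time T) (\<lambda>t. h t - c)"
      using h finite_measure.integrable_const[OF finite_measure_time] by (intro Bochner_Integration.integrable_diff) auto
    fix \<eta> assume \<eta>: "\<eta> \<in> test_functions {0<..<T}"
    define r where "r = (LINT t|time T. \<eta> t) / m"
    define \<eta>0 where "\<eta>0 t = \<eta> t - r * \<theta> t" for t
    have t0: "\<eta>0 \<in> test_functions {0<..<T}"
      unfolding \<eta>0_def using test_functions_diff_scale[OF \<eta> \<theta>] by simp
    have "(LINT t|time T. \<eta>0 t) = (LINT t|time T. \<eta> t) - r * m"
      unfolding \<eta>0_def m_def using int_\<psi>(1)[OF \<eta>] int_\<psi>(1)[OF \<theta>] by simp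
    then have "(LINT t|time T. \<eta>0 t) = 0" using \<open>m \<noteq> 0\<close> by (simp add: r_def)
    then obtain \<psi> where \<psi>: "\<psi> \<in> test_functions {0<..<T}" "deriv \<psi> = \<eta>0"
      by (rule test_function_antiderivative[OF t0 T])
    have "0 = (LINT t|time T. \<eta> t * h t - r * (\<theta> t * h t))"
      using test[OF \<psi>(1)] \<psi>(2) by (simp add: \<eta>0_def algebra_simps)
    also have "\<dots> = (LINT t|time T. \<eta> t * h t) - r * (LINT t|time T. \<theta> t * h t)"
      using int_\<psi>(2)[OF \<eta>] int_\<psi>(2)[OF \<theta>] by simp
    also have "\<dots> = (LINT t|time T. \<eta> t * h t) - (LINT t|time T. \<eta> t) * c"
      by (simp add: r_def c_def)
    also have "\<dots> = (LINT t|time T. \<eta> t * (h t - c))"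
      using int_\<psi>[OF \<eta>] by (simp add: right_diff_distrib)
    finally show "(LINT t|time T. \<eta> t * (h t - c)) = 0" by simp
  qed simp
  then show ?thesis by (intro exI[of _ c]) (auto elim: eventually_mono)
qed

text \<open>Fubini on the triangle \<open>s < t\<close>: for fixed \<open>s\<close> the integral of
  \<open>deriv \<psi>\<close> over \<open>(s,T)\<close> is \<open>- \<psi> s\<close>, as
  \<open>\<psi>\<close> vanishes at \<open>T\<close>. Since \<open>w\<close> is merely integrable,
  this takes the place of differentiating a product.\<close>

lemma primitive_by_parts:
  fixes w :: "real \<Rightarrow> real"
  assumes w: "integrable (time T) w" and T: "T > 0" and \<psi>: "\<psi> \<in> test_functions {0<..<T}"
  shows "(LINT t|time T. deriv \<psi> t * (LINT s|time t. w s)) = - (LINT t|time T. \<psi> t * w t)"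
proof -
  let ?M = "time T"
  note d\<psi> = test_function_deriv[OF \<psi> T]
  interpret M: finite_measure ?M by (rule finite_measure_time)
  interpret P: pair_sigma_finite ?M ?M ..
  obtain B where B: "\<And>x. \<bar>deriv \<psi> x\<bar> \<le> B" by (rule test_function_bounded[OF d\<psi> T]) blast
  obtain a b where ab: "0 < a" "a < b" "b < T" "\<And>x. x \<notin> {a..b} \<Longrightarrow> \<psi> x = 0"
    by (rule test_function_support[OF \<psi> T]) blast
  have [measurable]: "w \<in> borel_measurable ?M" using w by auto
  have [measurable]: "deriv \<psi> \<in> borel_measurable ?M"
    using test_function_integrable[OF d\<psi> T] by auto
  have [measurable]: "(\<lambda>x. x) \<in> borel_measurable ?M"
    by (intro continuous_borel_measurable_lebesgue_on) auto
  define F where "F t s = (if s < t then deriv \<psi> t * w s else 0)" for t s :: real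
  have Fm: "(\<lambda>(t, s). F t s) \<in> borel_measurable (?M \<Otimes>\<^sub>M ?M)"
    unfolding F_def by measurable
  have FB: "\<bar>F t s\<bar> \<le> B * \<bar>w s\<bar>" for t s
    using B[of t] order_trans[OF abs_ge_zero B] by (auto simp: F_def abs_mult intro!: mult_right_mono)
  have iF: "integrable (?M \<Otimes>\<^sub>M ?M) (\<lambda>(t, s). F t s)"
  proof (rule P.Fubini_integrable[OF Fm])
    have iw: "integrable ?M (\<lambda>s. B * \<bar>w s\<bar>)" using w by simp
    have Ft: "integrable ?M (\<lambda>s. F t s)" if "t \<in> space ?M" for t
    proof (rule Bochner_Integration.integrable_bound[OF iw])
      show "(\<lambda>s. F t s) \<in> borel_measurable ?M"
        unfolding F_def using that by measurable
      show "AE s in ?M. norm (F t s) \<le> norm (B * \<bar>w s\<bar>)"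
        using FB by (intro AE_I2) (auto intro: order_trans[OF _ abs_ge_self])
    qed
    then show "AE x in ?M. integrable ?M (\<lambda>y. case (x, y) of (t, s) \<Rightarrow> F t s)"
      by (intro AE_I2) auto
    show "integrable ?M (\<lambda>x. LINT y|?M. norm (case (x, y) of (t, s) \<Rightarrow> F t s))"
    proof (rule integrable_bounded_lebesgue_on)
      show "(\<lambda>x. LINT y|?M. norm (case (x, y) of (t, s) \<Rightarrow> F t s)) \<in> borel_measurable ?M"
        using Fm by measurable
      show "AE x in ?M. \<bar>LINT y|?M. norm (case (x, y) of (t, s) \<Rightarrow> F t s)\<bar> \<le> (LINT s|?M. B * \<bar>w s\<bar>)"
      proof (rule AE_I2)
        fix t assume "t \<in> space ?M"
        then have "(LINT s|?M. \<bar>F t s\<bar>) \<le> (LINT s|?M. B * \<bar>w s\<bar>)"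
          using Ft iw FB by (intro integral_mono) auto
        then show "\<bar>LINT y|?M. norm (case (t, y) of (t, s) \<Rightarrow> F t s)\<bar> \<le> (LINT s|?M. B * \<bar>w s\<bar>)"
          by simp
      qed
    qed simp
  qed
  have inner: "(LINT t|?M. F t s) = - \<psi> s * w s" if s: "s \<in> {0<..<T}" for s
  proof -
    have "(LINT t|?M. F t s) = (LINT t|?M. (indicator {s<..} t * deriv \<psi> t) * w s)"
      by (rule Bochner_Integration.integral_cong) (auto simp: F_def indicator_def)
    also have "\<dots> = (LINT t|?M. indicator {s<..} t * deriv \<psi> t) * w s"
      by simp
    also have "(LINT t|?M. indicator {s<..} t * deriv \<psi> t) = (LINT t|?M. deriv \<psi> t) - (LINT t|time s. deriv \<psi> t)"
    proof -
      have "(LINT t|time s. deriv \<psi> t) = (LINT t|?M. indicator {..<s} t * deriv \<psi> t)"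
        using s by (intro time_integral(4)[OF test_function_integrable[OF d\<psi> T]]) auto
      moreover have "(LINT t|?M. indicator {s<..} t * deriv \<psi> t)
          = (LINT t|?M. deriv \<psi> t - indicator {..<s} t * deriv \<psi> t)"
      proof (rule integral_cong_AE)
        \<comment> \<open>The set \<open>{s<..}\<close> and the complement of \<open>{..<s}\<close>
          differ by the point \<open>s\<close>, which is a null set.\<close>
        have "AE t in lebesgue. t \<noteq> s" by (rule AE_completion) (rule AE_lborel_singleton)
        then have "AE t in ?M. t \<noteq> s"
          by (subst AE_restrict_space_iff) (auto elim: eventually_mono)
        then show "AE t in ?M. indicator {s<..} t * deriv \<psi> t = deriv \<psi> t - indicator {..<s} t * deriv \<psi> t"
          by eventually_elim (auto simp: indicator_def)
      qed measurable
      moreover have "integrable ?M (\<lambda>t. indicator {..<s} t * deriv \<psi> t)"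
        by (rule integrable_bounded_times[where B=1])
           (auto simp: indicator_def intro: test_function_integrable[OF d\<psi> T])
      ultimately show ?thesis
        using test_function_integrable[OF d\<psi> T] by simp
    qed
    also have "\<dots> = - \<psi> s"
    proof -
      have ftc: "(LINT t|time y. deriv \<psi> t) = \<psi> y" if "y \<in> {0..T}" for y
      proof -
        have "(deriv \<psi> has_integral \<psi> y - \<psi> 0) {0..y}"
          using that Ck_deriv(1)[OF test_function_Ck[OF \<psi>]]
          by (intro fundamental_theorem_of_calculus)
             (auto simp: has_real_derivative_iff_has_vector_derivative[symmetric] intro: DERIV_subset)
        then have "integral {0..y} (deriv \<psi>) = \<psi> y" using ab by (simp add: integral_unique)
        then show ?thesis
          using time_integral(3)[OF test_function_integrable[OF d\<psi> T] that] by simp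
      qed
      show ?thesis using ftc[of T] ftc[of s] s T ab by simp
    qed
    finally show ?thesis by simp
  qed
  have "(LINT t|?M. deriv \<psi> t * (LINT s|time t. w s)) = (LINT t|?M. LINT s|?M. F t s)"
  proof (rule Bochner_Integration.integral_cong[OF refl])
    fix t assume "t \<in> space ?M"
    then have "deriv \<psi> t * (LINT s|time t. w s) = deriv \<psi> t * (LINT s|?M. indicator {..<t} s * w s)"
      using time_integral(4)[OF w, of t] by simp
    also have "\<dots> = (LINT s|?M. deriv \<psi> t * (indicator {..<t} s * w s))" by simp
    also have "\<dots> = (LINT s|?M. F t s)"
      by (rule Bochner_Integration.integral_cong) (auto simp: F_def indicator_def)
    finally show "deriv \<psi> t * (LINT s|time t. w s) = (LINT s|?M. F t s)" .
  qed
  also have "\<dots> = (LINT s|?M. LINT t|?M. F t s)"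
    by (rule P.Fubini_integral[OF iF, symmetric])
  also have "\<dots> = (LINT s|?M. - (\<psi> s * w s))"
    by (rule Bochner_Integration.integral_cong) (auto simp: inner)
  finally show ?thesis by simp
qed

section \<open>Primitives and weak time derivatives\<close>

lemma borel_measurable_indicator_lessThan: "(indicator {..<a} :: real \<Rightarrow> real) \<in> borel_measurable (time T)"
  by (intro measurable_restrict_space1 borel_measurable_indicator) simp

context semi_hilbert
begin

lemma bochner_L2D:
  assumes "w \<in> bochner_L2 T X N"
  shows "strongly_measurable T X N w" "integrable (time T) (\<lambda>t. (N (w t))\<^sup>2)"
    "integrable (time T) (\<lambda>t. N (w t))"
proof -
  show *: "strongly_measurable T X N w" "integrable (time T) (\<lambda>t. (N (w t))\<^sup>2)"
    using assms by (auto simp: bochner_L2_def)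
  show "integrable (time T) (\<lambda>t. N (w t))"
    by (rule finite_measure.square_integrable_imp_integrable[OF finite_measure_time borel_measurable_N[OF *(1)] *(2)])
qed

lemma integrable_N_bounded:
  assumes u: "strongly_measurable T X N u" and g: "integrable (time T) g"
    and le: "AE t in time T. N (u t) \<le> g t"
  shows "integrable (time T) (\<lambda>t. N (u t))"
proof (rule Bochner_Integration.integrable_bound[OF g borel_measurable_N[OF u]])
  show "AE t in time T. norm (N (u t)) \<le> norm (g t)"
    using le strongly_measurable_in[OF u] by eventually_elim (use N_nonneg in force)
qed

lemma bochner_L2I_bounded:
  assumes u: "strongly_measurable T X N u" and g: "integrable (time T) (\<lambda>t. (g t)\<^sup>2)"
    and le: "AE t in time T. N (u t) \<le> g t"
  shows "u \<in> bochner_L2 T X N"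
proof -
  have "integrable (time T) (\<lambda>t. (N (u t))\<^sup>2)"
  proof (rule Bochner_Integration.integrable_bound[OF g])
    show "(\<lambda>t. (N (u t))\<^sup>2) \<in> borel_measurable (time T)"
      by (intro borel_measurable_power borel_measurable_N u)
    show "AE t in time T. norm ((N (u t))\<^sup>2) \<le> norm ((g t)\<^sup>2)"
      using le strongly_measurable_in[OF u]
      by eventually_elim (use N_nonneg power_mono in force)
  qed
  then show ?thesis using u by (simp add: bochner_L2_def)
qed

lemma bochner_L2_diff:
  assumes "u \<in> bochner_L2 T X N" "v \<in> bochner_L2 T X N"
  shows "(\<lambda>t. u t - v t) \<in> bochner_L2 T X N"
proof (rule bochner_L2I_bounded)
  note u = bochner_L2D[OF assms(1)] and v = bochner_L2D[OF assms(2)]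
  show "strongly_measurable T X N (\<lambda>t. u t - v t)" by (intro strongly_measurable_diff u v)
  show "integrable (time T) (\<lambda>t. (N (u t) + N (v t))\<^sup>2)"
  proof (rule Bochner_Integration.integrable_bound)
    show "integrable (time T) (\<lambda>t. 2 * (N (u t))\<^sup>2 + 2 * (N (v t))\<^sup>2)" using u v by simp
    have "(a + b)\<^sup>2 \<le> 2 * a\<^sup>2 + 2 * b\<^sup>2" for a b :: real
      using sum_squares_bound[of a b] by (simp add: power2_sum)
    then show "AE t in time T. norm ((N (u t) + N (v t))\<^sup>2) \<le> norm (2 * (N (u t))\<^sup>2 + 2 * (N (v t))\<^sup>2)"
      by (intro AE_I2) simp
  qed (use u v borel_measurable_N in \<open>auto intro!: borel_measurable_power borel_measurable_add\<close>)
  show "AE t in time T. N (u t - v t) \<le> N (u t) + N (v t)"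
    using strongly_measurable_in[OF u(1)] strongly_measurable_in[OF v(1)]
    by eventually_elim (rule N_triangle_diff)
qed

text \<open>Testing with \<open>z\<close> itself turns the weak identity into a norm bound.\<close>

lemma N_weak_integral_le:
  assumes u: "strongly_measurable T X N u" and int: "integrable (time T) (\<lambda>t. N (u t))"
    and z: "z \<in> X" "\<And>v. v \<in> X \<Longrightarrow> ip z v = (LINT t|time T. ip (u t) v)"
  shows "N z \<le> (LINT t|time T. N (u t))"
proof -
  have "AE t in time T. 0 \<le> N (u t)"
    using strongly_measurable_in[OF u] by eventually_elim (rule N_nonneg)
  then have nn: "0 \<le> (LINT t|time T. N (u t))"
    by (rule integral_nonneg_AE)
  have "(N z)\<^sup>2 = (LINT t|time T. ip (u t) z)" using z by (simp add: N_power2)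
  also have "\<dots> \<le> (LINT t|time T. N (u t) * N z)"
  proof (rule integral_mono_AE)
    show "AE t in time T. ip (u t) z \<le> N (u t) * N z"
      using strongly_measurable_in[OF u] by eventually_elim (use Cauchy_Schwarz[OF _ z(1)] in force)
  qed (use integrable_ip[OF u int z(1)] int in auto)
  finally have "N z * N z \<le> (LINT t|time T. N (u t)) * N z" by (simp add: power2_eq_square)
  then show ?thesis using nn N_nonneg[OF z(1)] by (cases "N z = 0") auto
qed

text \<open>The primitive is characterised weakly; it is the Bochner integral of \<open>w\<close> over \<open>(0,t)\<close>.\<close>

definition primitive :: "(real \<Rightarrow> 'v) \<Rightarrow> real \<Rightarrow> 'v"
  where "primitive w t = (SOME I. I \<in> X \<and> (\<forall>v\<in>X. ip I v = (LINT s|time t. ip (w s) v)))"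

lemma cutoff:
  assumes "strongly_measurable T X N w" "integrable (time T) (\<lambda>t. N (w t))"
    and g: "g \<in> borel_measurable borel" "\<And>s. \<bar>g s\<bar> \<le> (1::real)"
  shows "strongly_measurable T X N (\<lambda>s. g s *\<^sub>R w s)" "integrable (time T) (\<lambda>s. N (g s *\<^sub>R w s))"
proof -
  have "g \<in> borel_measurable (time T)"
    using g(1) by (intro measurable_restrict_space1 measurable_completion) simp
  then show s: "strongly_measurable T X N (\<lambda>s. g s *\<^sub>R w s)"
    by (rule strongly_measurable_scaleR[OF _ assms(1)])
  show "integrable (time T) (\<lambda>s. N (g s *\<^sub>R w s))"
    by (rule integrable_N_bounded[OF s assms(2)], use strongly_measurable_in[OF assms(1)] in eventually_elim)
       (use g(2) in \<open>auto simp: N_scaleR N_nonneg intro!: mult_left_le_one_le\<close>)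
qed

lemma ip_cutoff_integral:
  assumes w: "strongly_measurable T X N w" "integrable (time T) (\<lambda>t. N (w t))"
    and t: "t \<in> {0..T}" and v: "v \<in> X"
  shows "(LINT s|time t. ip (w s) v) = (LINT s|time T. ip (indicator {..<t} s *\<^sub>R w s) v)"
proof -
  have "(LINT s|time t. ip (w s) v) = (LINT s|time T. indicator {..<t} s * ip (w s) v)"
    by (rule time_integral(4)[OF integrable_ip[OF w v] t])
  also have "\<dots> = (LINT s|time T. ip (indicator {..<t} s *\<^sub>R w s) v)"
  proof (rule integral_cong_AE)
    show "AE s in time T. indicator {..<t} s * ip (w s) v = ip (indicator {..<t} s *\<^sub>R w s) v"
      using strongly_measurable_in[OF w(1)] by eventually_elim (simp add: ip_scaleR_left v)
    show "(\<lambda>s. ip (indicator {..<t} s *\<^sub>R w s) v) \<in> borel_measurable (time T)"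
      by (rule borel_measurable_ip[OF cutoff(1)[OF w] v]) (auto simp: indicator_def)
    show "(\<lambda>s. indicator {..<t} s * ip (w s) v) \<in> borel_measurable (time T)"
      by (rule borel_measurable_times[OF _ borel_measurable_ip[OF w(1) v]])
         (rule borel_measurable_indicator_lessThan)
  qed
  finally show ?thesis .
qed

lemma primitive:
  assumes w: "w \<in> bochner_L2 T X N" and t: "t \<in> {0..T}"
  shows "primitive w t \<in> X" "v \<in> X \<Longrightarrow> ip (primitive w t) v = (LINT s|time t. ip (w s) v)"
proof -
  note W = bochner_L2D(1,3)[OF w]
  have "\<exists>I. I \<in> X \<and> (\<forall>v\<in>X. ip I v = (LINT s|time t. ip (w s) v))"
    using weak_integral_exists[OF cutoff[OF W, of "indicator {..<t}"]]
    by (auto simp: ip_cutoff_integral[OF W t] indicator_def)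
  from someI_ex[OF this] show "primitive w t \<in> X"
    "v \<in> X \<Longrightarrow> ip (primitive w t) v = (LINT s|time t. ip (w s) v)"
    by (auto simp: primitive_def)
qed

text \<open>The difference is the weak integral of \<open>w\<close> cut off to the time interval
  between \<open>s\<close> and \<open>t\<close>. Expressing the bound by scalar integrals up to
  \<open>s\<close> and \<open>t\<close> reduces continuity of the primitive to continuity of
  these.\<close>

lemma N_primitive_diff_time:
  assumes w: "w \<in> bochner_L2 T X N" and t: "s \<in> {0..T}" "t \<in> {0..T}"
  shows "N (primitive w s - primitive w t) \<le> \<bar>(LINT r|time s. N (w r)) - (LINT r|time t. N (w r))\<bar>"
proof -
  have le: "N (primitive w t - primitive w s) \<le> (LINT r|time t. N (w r)) - (LINT r|time s. N (w r))"
    if "s \<in> {0..T}" "t \<in> {0..T}" "s \<le> t" for s t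
  proof -
    note W = bochner_L2D(1,3)[OF w]
    define g where "g r = (indicator {..<t} r - indicator {..<s} r :: real)" for r
    have g: "g \<in> borel_measurable borel" "\<And>r. \<bar>g r\<bar> \<le> 1" "\<And>r. 0 \<le> g r"
      using that unfolding g_def by (auto simp: indicator_def)
    note G = cutoff[OF W g(1,2)]
    have i: "integrable (time T) (\<lambda>r. indicator {..<a} r * N (w r))" for a
      by (rule integrable_bounded_times[OF borel_measurable_indicator_lessThan _ W(2), where B=1])
         (simp add: indicator_def)
    have "N (primitive w t - primitive w s) \<le> (LINT r|time T. N (g r *\<^sub>R w r))"
    proof (rule N_weak_integral_le[OF G])
      fix v assume v: "v \<in> X"
      have c: "integrable (time T) (\<lambda>r. ip (indicator {..<a} r *\<^sub>R w r) v)" for a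
        by (rule integrable_ip[OF cutoff[OF W] v]) (auto simp: indicator_def)
      have "ip (primitive w t - primitive w s) v
        = (LINT r|time T. ip (indicator {..<t} r *\<^sub>R w r) v - ip (indicator {..<s} r *\<^sub>R w r) v)"
        using that v c by (simp add: ip_diff_left primitive[OF w] ip_cutoff_integral[OF W _ v])
      also have "\<dots> = (LINT r|time T. ip (g r *\<^sub>R w r) v)"
      proof (rule integral_cong_AE)
        show "AE r in time T. ip (indicator {..<t} r *\<^sub>R w r) v - ip (indicator {..<s} r *\<^sub>R w r) v = ip (g r *\<^sub>R w r) v"
          using strongly_measurable_in[OF W(1)]
          by eventually_elim (simp add: ip_scaleR_left v g_def left_diff_distrib)
      qed (use c integrable_ip[OF G v] in auto)
      finally show "ip (primitive w t - primitive w s) v = (LINT r|time T. ip (g r *\<^sub>R w r) v)" .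
    qed (use that in \<open>auto intro!: diff_in primitive[OF w]\<close>)
    also have "\<dots> = (LINT r|time T. indicator {..<t} r * N (w r) - indicator {..<s} r * N (w r))"
    proof (rule integral_cong_AE)
      show "AE r in time T. N (g r *\<^sub>R w r) = indicator {..<t} r * N (w r) - indicator {..<s} r * N (w r)"
        using strongly_measurable_in[OF W(1)]
        by eventually_elim (use g(3) in \<open>simp add: N_scaleR left_diff_distrib[symmetric] g_def\<close>)
    qed (use G i in auto)
    also have "\<dots> = (LINT r|time t. N (w r)) - (LINT r|time s. N (w r))"
      using that i by (simp add: time_integral(4)[OF W(2)])
    finally show ?thesis .
  qed
  show ?thesis
    using le[of s t] le[of t s] t N_commute[OF primitive(1)[OF w t(1)] primitive(1)[OF w t(2)]]
    by (cases "s \<le> t") auto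
qed

text \<open>\<open>primitive\<close> is a choice and therefore linear only up to seminorm zero, so
  the estimate is derived from its inner products: the difference is a weak integral of
  \<open>u - w\<close>.\<close>

lemma N_primitive_diff:
  assumes u: "u \<in> bochner_L2 T X N" and w: "w \<in> bochner_L2 T X N" and t: "t \<in> {0..T}"
  shows "N (primitive u t - primitive w t) \<le> (LINT s|time t. N (u s - w s))"
proof -
  note U = bochner_L2D(1,3)[OF u] and W = bochner_L2D(1,3)[OF w]
  note D = bochner_L2D(1,3)[OF bochner_L2_diff[OF u w]]
  have ind: "indicator {..<t} \<in> borel_measurable borel" "\<And>r. \<bar>indicator {..<t} r\<bar> \<le> (1::real)"
    by (auto simp: indicator_def)
  note G = cutoff[OF D ind]
  have "N (primitive u t - primitive w t) \<le> (LINT s|time T. N (indicator {..<t} s *\<^sub>R (u s - w s)))"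
  proof (rule N_weak_integral_le[OF G])
    fix v assume v: "v \<in> X"
    have "(LINT s|time T. ip (indicator {..<t} s *\<^sub>R (u s - w s)) v) = (LINT s|time t. ip (u s - w s) v)"
      by (rule ip_cutoff_integral[OF D t v, symmetric])
    also have "\<dots> = (LINT s|time t. ip (u s) v - ip (w s) v)"
    proof (rule integral_cong_AE)
      have "AE s in time T. ip (u s - w s) v = ip (u s) v - ip (w s) v"
        using strongly_measurable_in[OF U(1)] strongly_measurable_in[OF W(1)]
        by eventually_elim (simp add: ip_diff_left v)
      then show "AE s in time t. ip (u s - w s) v = ip (u s) v - ip (w s) v"
        using t by (auto simp: AE_restrict_space_iff elim!: eventually_mono)
    qed (use time_integral(1)[OF integrable_ip[OF D v] t] time_integral(1)[OF integrable_ip[OF U v] t]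
           time_integral(1)[OF integrable_ip[OF W v] t] in auto)
    also have "\<dots> = ip (primitive u t - primitive w t) v"
      using time_integral(1)[OF integrable_ip[OF U v] t] time_integral(1)[OF integrable_ip[OF W v] t] v
      by (simp add: ip_diff_left primitive[OF u t] primitive[OF w t])
    finally show "ip (primitive u t - primitive w t) v = (LINT s|time T. ip (indicator {..<t} s *\<^sub>R (u s - w s)) v)" ..
  qed (intro diff_in primitive(1)[OF u t] primitive(1)[OF w t])
  also have "\<dots> = (LINT s|time T. indicator {..<t} s * N (u s - w s))"
  proof (rule integral_cong_AE)
    show "AE s in time T. N (indicator {..<t} s *\<^sub>R (u s - w s)) = indicator {..<t} s * N (u s - w s)"
      using strongly_measurable_in[OF D(1)] by eventually_elim (simp add: N_scaleR)
    show "(\<lambda>s. indicator {..<t} s * N (u s - w s)) \<in> borel_measurable (time T)"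
      by (rule borel_measurable_times[OF _ borel_measurable_N[OF D(1)]])
         (rule borel_measurable_indicator_lessThan)
  qed (use G in auto)
  also have "\<dots> = (LINT s|time t. N (u s - w s))"
    by (rule time_integral(4)[OF D(2) t, symmetric])
  finally show ?thesis .
qed

lemma N_primitive_0:
  assumes "w \<in> bochner_L2 T X N" "T > 0"
  shows "N (primitive w 0) = 0"
  by (rule N_eq_0I[OF primitive(1)[OF assms(1)]]) (use assms primitive(2)[OF assms(1), of 0] in auto)

lemma primitive_continuous:
  assumes w: "w \<in> bochner_L2 T X N" and T: "T > 0" and t: "t \<in> {0..T}"
  shows "((\<lambda>s. N (primitive w s - primitive w t)) \<longlongrightarrow> 0) (at t within {0..T})"
proof -
  let ?W = "\<lambda>s. LINT r|time s. N (w r)"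
  have "(?W \<longlongrightarrow> ?W t) (at t within {0..T})"
    using time_integral_continuous[OF bochner_L2D(3)[OF w] T] t by (auto simp: continuous_on_def)
  then have "((\<lambda>s. \<bar>?W s - ?W t\<bar>) \<longlongrightarrow> 0) (at t within {0..T})"
    by (intro tendsto_rabs_zero) (simp add: LIM_zero)
  moreover have "\<forall>\<^sub>F s in at t within {0..T}. norm (N (primitive w s - primitive w t)) \<le> \<bar>?W s - ?W t\<bar>"
    unfolding eventually_at_filter
  proof (intro always_eventually allI impI)
    fix s assume s: "s \<in> {0..T}"
    show "norm (N (primitive w s - primitive w t)) \<le> \<bar>?W s - ?W t\<bar>"
      using N_primitive_diff_time[OF w s t] N_nonneg[OF diff_in[OF primitive(1)[OF w s] primitive(1)[OF w t]]]
      by simp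
  qed
  ultimately show ?thesis by (rule Lim_null_comparison[rotated])
qed

text \<open>Sampling at the grid point of mesh \<open>1 / Suc n\<close> to the left of the given
  time: on \<open>(0,T)\<close> the floor takes finitely many values, and a left grid point never
  exceeds \<open>T\<close>.\<close>

lemma strongly_measurable_continuous:
  assumes T: "T > 0" and c: "\<And>t. t \<in> {0..T} \<Longrightarrow> c t \<in> X"
    and cont: "\<And>t. t \<in> {0..T} \<Longrightarrow> ((\<lambda>s. N (c s - c t)) \<longlongrightarrow> 0) (at t within {0..T})"
  shows "strongly_measurable T X N c"
proof (rule strongly_measurableI[where s="\<lambda>n r. c (of_int \<lfloor>r * real (Suc n)\<rfloor> / real (Suc n))"])
  let ?p = "\<lambda>n r. of_int \<lfloor>r * real (Suc n)\<rfloor> / real (Suc n)"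
  have p_le: "?p n r \<le> r" for n r
    using of_int_floor_le[of "r * real (Suc n)"] by (simp add: field_simps)
  have p_ge: "r - inverse (real (Suc n)) \<le> ?p n r" for n r
  proof -
    have "(r * real (Suc n) - 1) / real (Suc n) \<le> ?p n r"
      by (intro divide_right_mono real_of_int_floor_ge_diff_one) simp
    then show ?thesis by (simp add: diff_divide_distrib inverse_eq_divide)
  qed
  have p_in: "?p n r \<in> {0..T}" if "r \<in> {0<..<T}" for n r
    using that p_le[of r n] by auto
  show "AE t in time T. c t \<in> X" by (rule AE_I2) (use c in auto)
  show "c (?p n r) \<in> X" if "r \<in> {0<..<T}" for n r using p_in[OF that] c by blast
  show "simple_function (time T) (\<lambda>r. c (?p n r))" for n
  proof -
    have "simple_function (time T) (\<lambda>r. \<lfloor>r * real (Suc n)\<rfloor>)"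
      unfolding simple_function_def
    proof (intro conjI ballI)
      have "(\<lambda>r. \<lfloor>r * real (Suc n)\<rfloor>) ` space (time T) \<subseteq> {0..\<lfloor>T * real (Suc n)\<rfloor>}"
        using T by (auto intro!: floor_mono mult_right_mono)
      then show "finite ((\<lambda>r. \<lfloor>r * real (Suc n)\<rfloor>) ` space (time T))"
        by (rule finite_subset) simp
      fix k :: int
      have "(\<lambda>r. \<lfloor>r * real (Suc n)\<rfloor>) -` {k} \<inter> space (time T) = {0<..<T} \<inter> {of_int k / real (Suc n)..<(of_int k + 1) / real (Suc n)}"
        by (auto simp: floor_eq_iff field_simps) linarith
      also have "\<dots> \<in> sets (time T)"
        by (subst sets_restrict_space_iff) auto
      finally show "(\<lambda>r. \<lfloor>r * real (Suc n)\<rfloor>) -` {k} \<inter> space (time T) \<in> sets (time T)" .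
    qed
    then show ?thesis by (rule simple_function_compose1)
  qed
  show "AE t in time T. (\<lambda>n. N (c (?p n t) - c t)) \<longlonglongrightarrow> 0"
  proof (rule AE_I2)
    fix t assume "t \<in> space (time T)"
    then have t: "t \<in> {0<..<T}" by simp
    have "(\<lambda>n. t - inverse (real (Suc n))) \<longlonglongrightarrow> t - 0"
      by (intro tendsto_diff tendsto_const LIMSEQ_inverse_real_of_nat)
    then have lim: "(\<lambda>n. ?p n t) \<longlonglongrightarrow> t"
      by (intro tendsto_sandwich[OF always_eventually[OF allI[OF p_ge]] always_eventually[OF allI[OF p_le]] _ tendsto_const])
         simp
    have "((\<lambda>s. N (c s - c t)) \<longlongrightarrow> N (c t - c t)) (at t within {0..T})"
      using cont[of t] t by (simp add: N_zero)
    then have "continuous (at t within {0..T}) (\<lambda>s. N (c s - c t))"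
      by (simp add: continuous_within)
    then have "(\<lambda>n. N (c (?p n t) - c t)) \<longlonglongrightarrow> N (c t - c t)"
      by (rule continuous_within_tendsto_compose'[OF _ _ lim]) (use p_in[OF t] in auto)
    then show "(\<lambda>n. N (c (?p n t) - c t)) \<longlonglongrightarrow> 0" by (simp add: N_zero)
  qed
qed

lemma primitive_bochner_L2:
  assumes w: "w \<in> bochner_L2 T X N" and T: "T > 0"
  shows "primitive w \<in> bochner_L2 T X N"
proof (rule bochner_L2I_bounded)
  show "strongly_measurable T X N (primitive w)"
    by (rule strongly_measurable_continuous[OF T primitive(1)[OF w] primitive_continuous[OF w T]])
  show "integrable (time T) (\<lambda>t. (LINT r|time T. N (w r))\<^sup>2)"
    using finite_measure.integrable_const[OF finite_measure_time] .
  have nnw: "AE r in time T. 0 \<le> N (w r)"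
    using strongly_measurable_in[OF bochner_L2D(1)[OF w]] by eventually_elim (rule N_nonneg)
  show "AE t in time T. N (primitive w t) \<le> (LINT r|time T. N (w r))"
  proof (rule AE_I2)
    fix t assume "t \<in> space (time T)"
    then have t: "t \<in> {0..T}" "0 \<in> {0..T}" by auto
    have "N (primitive w t) \<le> N (primitive w t - primitive w 0)"
      using N_le_add[OF primitive(1)[OF w t(1)] primitive(1)[OF w t(2)]] N_primitive_0[OF w T] by simp
    also have "\<dots> \<le> \<bar>LINT r|time t. N (w r)\<bar>"
      using N_primitive_diff_time[OF w t] by simp
    also have "(LINT r|time t. N (w r)) = (LINT r|time T. indicator {..<t} r * N (w r))"
      by (rule time_integral(4)[OF bochner_L2D(3)[OF w] t(1)])
    also have "\<bar>\<dots>\<bar> \<le> (LINT r|time T. \<bar>indicator {..<t} r * N (w r)\<bar>)"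
      by (rule integral_abs_bound)
    also have "\<dots> \<le> (LINT r|time T. N (w r))"
    proof (rule integral_mono_AE)
      show "integrable (time T) (\<lambda>r. \<bar>indicator {..<t} r * N (w r)\<bar>)"
        by (intro integrable_abs integrable_bounded_times[OF borel_measurable_indicator_lessThan _ bochner_L2D(3)[OF w], where B=1])
           (simp add: indicator_def)
      show "AE r in time T. \<bar>indicator {..<t} r * N (w r)\<bar> \<le> N (w r)"
        using nnw by eventually_elim (auto simp: indicator_def)
    qed (rule bochner_L2D(3)[OF w])
    finally show "N (primitive w t) \<le> (LINT r|time T. N (w r))" .
  qed
qed

section \<open>Weak time derivatives tested by scalars\<close>

lemma bochner_L2_scaleR_bounded:
  assumes w: "w \<in> bochner_L2 T X N" and g: "g \<in> borel_measurable (time T)" "\<And>t. \<bar>g t\<bar> \<le> B"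
  shows "strongly_measurable T X N (\<lambda>t. g t *\<^sub>R w t)" "integrable (time T) (\<lambda>t. N (g t *\<^sub>R w t))"
proof -
  note W = bochner_L2D[OF w]
  show s: "strongly_measurable T X N (\<lambda>t. g t *\<^sub>R w t)"
    by (rule strongly_measurable_scaleR[OF g(1) W(1)])
  show "integrable (time T) (\<lambda>t. N (g t *\<^sub>R w t))"
  proof (rule integrable_N_bounded[OF s])
    show "integrable (time T) (\<lambda>t. B * N (w t))" using W by simp
    show "AE t in time T. N (g t *\<^sub>R w t) \<le> B * N (w t)"
      using strongly_measurable_in[OF W(1)]
      by eventually_elim (use g(2) N_nonneg in \<open>auto simp: N_scaleR intro!: mult_right_mono\<close>)
  qed
qed

lemma test_function_scaleR:
  assumes w: "w \<in> bochner_L2 T X N" and T: "T > 0" and \<psi>: "\<psi> \<in> test_functions {0<..<T}"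
  shows "strongly_measurable T X N (\<lambda>t. \<psi> t *\<^sub>R w t)" "integrable (time T) (\<lambda>t. N (\<psi> t *\<^sub>R w t))"
    "v \<in> X \<Longrightarrow> (LINT t|time T. ip (\<psi> t *\<^sub>R w t) v) = (LINT t|time T. \<psi> t * ip (w t) v)"
proof -
  obtain B where B: "\<And>x. \<bar>\<psi> x\<bar> \<le> B" by (rule test_function_bounded[OF \<psi> T]) blast
  have m: "\<psi> \<in> borel_measurable (time T)"
    using test_function_integrable[OF \<psi> T] by (rule borel_measurable_integrable)
  show s: "strongly_measurable T X N (\<lambda>t. \<psi> t *\<^sub>R w t)" "integrable (time T) (\<lambda>t. N (\<psi> t *\<^sub>R w t))"
    by (rule bochner_L2_scaleR_bounded[OF w m B])+
  assume v: "v \<in> X"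
  show "(LINT t|time T. ip (\<psi> t *\<^sub>R w t) v) = (LINT t|time T. \<psi> t * ip (w t) v)"
  proof (rule integral_cong_AE)
    show "AE t in time T. ip (\<psi> t *\<^sub>R w t) v = \<psi> t * ip (w t) v"
      using strongly_measurable_in[OF bochner_L2D(1)[OF w]] by eventually_elim (simp add: ip_scaleR_left v)
  qed (intro borel_measurable_ip[OF s(1) v] borel_measurable_times m borel_measurable_ip[OF bochner_L2D(1)[OF w] v])+
qed

text \<open>\<open>ip_bochner_integral\<close> moves the inner product inside both integrals, so the
  results for real functions apply to each component \<open>ip (q t) v\<close>.\<close>

lemma weak_derivative_test:
  assumes q: "q \<in> bochner_L2 T X N" and w: "w \<in> bochner_L2 T X N" and T: "T > 0"
    and wd: "has_weak_time_derivative T X N q w" and \<psi>: "\<psi> \<in> test_functions {0<..<T}" and v: "v \<in> X"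
  shows "(LINT t|time T. deriv \<psi> t * ip (q t) v) = - (LINT t|time T. \<psi> t * ip (w t) v)"
proof -
  obtain I where I: "has_bochner_integral_in T X N (\<lambda>t. deriv \<psi> t *\<^sub>R q t) I"
      "has_bochner_integral_in T X N (\<lambda>t. \<psi> t *\<^sub>R w t) (- I)"
    using wd \<psi> unfolding has_weak_time_derivative_def by blast
  have "I \<in> X" using I(1) by (simp add: has_bochner_integral_in_def)
  then have "ip (- I) v = - ip I v" using v by (rule ip_minus_left)
  then show ?thesis
    using ip_bochner_integral[OF I(1) _ v] ip_bochner_integral[OF I(2) _ v]
      test_function_scaleR[OF q T test_function_deriv[OF \<psi> T]] test_function_scaleR[OF w T \<psi>] v
    by simp
qed

text \<open>Both Bochner integrals exist separately. The scalar identities make their sum orthogonal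
  to every \<open>v\<close>, hence of seminorm zero, and
  \<open>has_bochner_integral_in_cong_value\<close> then replaces the second value by
  \<open>- I\<close> itself.\<close>

lemma weak_derivativeI:
  assumes q: "q \<in> bochner_L2 T X N" and w: "w \<in> bochner_L2 T X N" and T: "T > 0"
    and parts: "\<And>\<psi> v. \<psi> \<in> test_functions {0<..<T} \<Longrightarrow> v \<in> X \<Longrightarrow>
      (LINT t|time T. deriv \<psi> t * ip (q t) v) = - (LINT t|time T. \<psi> t * ip (w t) v)"
  shows "has_weak_time_derivative T X N q w"
  unfolding has_weak_time_derivative_def
proof
  fix \<psi> assume \<psi>: "\<psi> \<in> test_functions {0<..<T}"
  note Q = test_function_scaleR[OF q T test_function_deriv[OF \<psi> T]]
  note W = test_function_scaleR[OF w T \<psi>]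
  obtain I where I: "has_bochner_integral_in T X N (\<lambda>t. deriv \<psi> t *\<^sub>R q t) I"
    using bochner_integral_exists[OF Q(1,2)] by blast
  obtain J where J: "has_bochner_integral_in T X N (\<lambda>t. \<psi> t *\<^sub>R w t) J"
    using bochner_integral_exists[OF W(1,2)] by blast
  have X: "I \<in> X" "J \<in> X" using I J by (auto simp: has_bochner_integral_in_def)
  have "N (J - - I) = 0"
  proof (rule N_eq_0I)
    show "J - - I \<in> X" using X by (intro diff_in minus_in)
    show "ip (J - - I) v = 0" if v: "v \<in> X" for v
      using ip_bochner_integral[OF I Q(2) v] ip_bochner_integral[OF J W(2) v] parts[OF \<psi> v] Q(3) W(3) v X
      by (simp add: ip_add_left)
  qed
  then have "has_bochner_integral_in T X N (\<lambda>t. \<psi> t *\<^sub>R w t) (- I)"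
    using has_bochner_integral_in_cong_value[OF J] minus_in X by blast
  with I show "\<exists>I. has_bochner_integral_in T X N (\<lambda>t. deriv \<psi> t *\<^sub>R q t) I \<and>
      has_bochner_integral_in T X N (\<lambda>t. \<psi> t *\<^sub>R w t) (- I)" by blast
qed

lemma primitive_parts:
  assumes w: "w \<in> bochner_L2 T X N" and T: "T > 0" and \<psi>: "\<psi> \<in> test_functions {0<..<T}" and v: "v \<in> X"
  shows "(LINT t|time T. deriv \<psi> t * ip (primitive w t) v) = - (LINT t|time T. \<psi> t * ip (w t) v)"
proof -
  have "(LINT t|time T. deriv \<psi> t * ip (primitive w t) v) = (LINT t|time T. deriv \<psi> t * (LINT s|time t. ip (w s) v))"
    by (rule Bochner_Integration.integral_cong[OF refl]) (use primitive(2)[OF w _ v] in auto)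
  then show ?thesis
    using primitive_by_parts[OF integrable_ip[OF bochner_L2D(1,3)[OF w] v] T \<psi>] by simp
qed

lemma primitive_weak_derivative:
  assumes w: "w \<in> bochner_L2 T X N" and T: "T > 0"
  shows "has_weak_time_derivative T X N (primitive w) w"
  by (rule weak_derivativeI[OF primitive_bochner_L2[OF w T] w T primitive_parts[OF w T]])

lemma primitive_bochner_H10:
  assumes w: "w \<in> bochner_L2 T X N" and T: "T > 0"
  shows "primitive w \<in> bochner_H10 T X N"
proof -
  have "vanishes_initially T X N (primitive w)"
    unfolding vanishes_initially_def
    by (intro exI[of _ "primitive w"] conjI ballI primitive(1)[OF w] primitive_continuous[OF w T] N_primitive_0[OF w T])
       (auto simp: N_zero)
  then show ?thesis
    using primitive_bochner_L2[OF w T] primitive_weak_derivative[OF w T] w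
    by (auto simp: bochner_H10_def bochner_H1_def)
qed

text \<open>
  A strongly measurable function is essentially separably valued, so countably many test elements
  suffice.
\<close>

lemma AE_N_zero_if_weakly_zero:
  assumes u: "strongly_measurable T X N u" and z: "\<And>v. v \<in> X \<Longrightarrow> AE t in time T. ip (u t) v = 0"
  shows "AE t in time T. N (u t) = 0"
proof -
  obtain s where s: "\<And>n. simple_function (time T) (s n)" "\<And>n t. t \<in> {0<..<T} \<Longrightarrow> s n t \<in> X"
      "AE t in time T. (\<lambda>n. N (s n t - u t)) \<longlonglongrightarrow> 0"
    by (rule strongly_measurableE[OF u]) blast
  define D where "D = (\<Union>n. s n ` {0<..<T})"
  have "countable (s n ` {0<..<T})" for n
    using s(1)[of n] by (intro countable_finite) (simp add: simple_function_def)
  then have "countable D" unfolding D_def by (intro countable_UN) auto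
  moreover have "\<forall>v\<in>D. AE t in time T. ip (u t) v = 0" using z s(2) by (auto simp: D_def)
  ultimately have "AE t in time T. \<forall>v\<in>D. ip (u t) v = 0"
    by (subst AE_ball_countable)
  then show ?thesis
    using strongly_measurable_in[OF u] s(3) AE_space
  proof eventually_elim
    case (elim t)
    then have t: "t \<in> {0<..<T}" by simp
    \<comment> \<open>The test elements \<open>s n t\<close> lie in \<open>D\<close> and approximate
      \<open>u t\<close>, so in the limit \<open>u t\<close> is tested with itself.\<close>
    have "(\<lambda>n. ip (s n t) (u t)) \<longlonglongrightarrow> ip (u t) (u t)"
      by (rule ip_tendsto[OF elim(2) s(2)[OF t] elim(2,3)])
    moreover have "ip (s n t) (u t) = 0" for n
      using elim(1) t s(2)[OF t] ip_commute[OF elim(2) s(2)[OF t]] by (auto simp: D_def)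
    ultimately have "ip (u t) (u t) = 0" by (simp add: LIMSEQ_const_iff)
    then show ?case using elim(2) by (simp add: N_eq)
  qed
qed

text \<open>For fixed \<open>v\<close> this is the fundamental lemma. The exceptional null sets
  depend on \<open>v\<close>; \<open>AE_N_zero_if_weakly_zero\<close> merges them into one.\<close>

lemma weak_derivative_unique:
  assumes q: "q \<in> bochner_L2 T X N" and T: "T > 0"
    and w: "w \<in> bochner_L2 T X N" "has_weak_time_derivative T X N q w"
    and w': "w' \<in> bochner_L2 T X N" "has_weak_time_derivative T X N q w'"
  shows "AE t in time T. N (w t - w' t) = 0"
proof (rule AE_N_zero_if_weakly_zero)
  note W = bochner_L2D(1,3)[OF w(1)] and W' = bochner_L2D(1,3)[OF w'(1)]
  show "strongly_measurable T X N (\<lambda>t. w t - w' t)" by (intro strongly_measurable_diff W W')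
  fix v assume v: "v \<in> X"
  note i = integrable_ip[OF W v] integrable_ip[OF W' v]
  have "AE t in time T. ip (w t) v - ip (w' t) v = 0"
  proof (rule fundamental_lemma)
    fix \<psi> assume \<psi>: "\<psi> \<in> test_functions {0<..<T}"
    obtain B where B: "\<And>x. \<bar>\<psi> x\<bar> \<le> B" by (rule test_function_bounded[OF \<psi> T]) blast
    have i': "integrable (time T) (\<lambda>t. \<psi> t * ip (w t) v)" "integrable (time T) (\<lambda>t. \<psi> t * ip (w' t) v)"
      using i by (auto intro: integrable_bounded_times[OF borel_measurable_integrable[OF test_function_integrable[OF \<psi> T]] B])
    show "(LINT t|time T. \<psi> t * (ip (w t) v - ip (w' t) v)) = 0"
      using weak_derivative_test[OF q w(1) T w(2) \<psi> v] weak_derivative_test[OF q w'(1) T w'(2) \<psi> v] i'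
      by (simp add: right_diff_distrib)
  qed (use i in auto)
  then show "AE t in time T. ip (w t - w' t) v = 0"
    using strongly_measurable_in[OF W(1)] strongly_measurable_in[OF W'(1)]
    by eventually_elim (simp add: ip_diff_left v)
qed

lemma time_derivative:
  assumes "q \<in> bochner_H1 T X N"
  shows "q \<in> bochner_L2 T X N" "time_derivative T X N q \<in> bochner_L2 T X N"
    "has_weak_time_derivative T X N q (time_derivative T X N q)"
proof -
  show "q \<in> bochner_L2 T X N" using assms by (simp add: bochner_H1_def)
  have "\<exists>w. w \<in> bochner_L2 T X N \<and> has_weak_time_derivative T X N q w"
    using assms by (auto simp: bochner_H1_def)
  from someI_ex[OF this] show "time_derivative T X N q \<in> bochner_L2 T X N"
    "has_weak_time_derivative T X N q (time_derivative T X N q)"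
    by (auto simp: time_derivative_def)
qed

lemma time_derivative_primitive:
  assumes w: "w \<in> bochner_L2 T X N" and T: "T > 0"
  shows "AE t in time T. N (time_derivative T X N (primitive w) t - w t) = 0"
proof -
  have "primitive w \<in> bochner_H1 T X N"
    using primitive_bochner_H10[OF w T] by (simp add: bochner_H10_def)
  from time_derivative[OF this] show ?thesis
    using weak_derivative_unique[OF _ T _ _ w primitive_weak_derivative[OF w T]] by blast
qed

text \<open>By \<open>du_Bois_Reymond\<close> each component of \<open>q - primitive w\<close> is
  constant almost everywhere. The continuous representative \<open>c\<close> carries the constant to
  every time of \<open>[0,T]\<close>, and at time 0 both \<open>c\<close> and the primitive vanish,
  so the constant is 0.\<close>

lemma bochner_H10_eq_primitive:
  assumes q: "q \<in> bochner_H10 T X N" and T: "T > 0"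
  shows "AE t in time T. N (q t - primitive (time_derivative T X N q) t) = 0"
proof -
  define w where "w = time_derivative T X N q"
  have q1: "q \<in> bochner_H1 T X N" "vanishes_initially T X N q"
    using q by (auto simp: bochner_H10_def)
  note q2 = time_derivative[OF q1(1), folded w_def]
  note p = primitive_bochner_L2[OF q2(2) T]
  obtain c where c: "\<And>t. t \<in> {0..T} \<Longrightarrow> c t \<in> X"
    "\<And>t. t \<in> {0..T} \<Longrightarrow> ((\<lambda>s. N (c s - c t)) \<longlongrightarrow> 0) (at t within {0..T})"
    "AE t in time T. N (q t - c t) = 0" "N (c 0) = 0"
    using q1(2) unfolding vanishes_initially_def by blast
  have ip_cont: "continuous_on {0..T} (\<lambda>t. ip (d t) v)"
    if d: "\<And>t. t \<in> {0..T} \<Longrightarrow> d t \<in> X" and v: "v \<in> X"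
      and l: "\<And>t. t \<in> {0..T} \<Longrightarrow> ((\<lambda>s. N (d s - d t)) \<longlongrightarrow> 0) (at t within {0..T})" for d v
    unfolding continuous_on_def
  proof
    fix t assume t: "t \<in> {0..T}"
    have "((\<lambda>s. N (d s - d t) * N v) \<longlongrightarrow> 0) (at t within {0..T})"
      using tendsto_mult_right[OF l[OF t], of "N v"] by simp
    then have "((\<lambda>s. ip (d s) v - ip (d t) v) \<longlongrightarrow> 0) (at t within {0..T})"
    proof (rule Lim_null_comparison[rotated])
      show "\<forall>\<^sub>F s in at t within {0..T}. norm (ip (d s) v - ip (d t) v) \<le> N (d s - d t) * N v"
        unfolding eventually_at_filter
        by (intro always_eventually allI impI)
           (use Cauchy_Schwarz[OF diff_in[OF d d[OF t]] v] ip_diff_left[OF d d[OF t] v] in auto)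
    qed
    then show "((\<lambda>s. ip (d s) v) \<longlongrightarrow> ip (d t) v) (at t within {0..T})" by (simp add: LIM_zero_cancel)
  qed
  have eq: "ip (c t - primitive w t) v = 0" if t: "t \<in> {0..T}" and v: "v \<in> X" for t v
  proof -
    define h where "h t = ip (c t - primitive w t) v" for t
    have h_eq: "h t = ip (c t) v - ip (primitive w t) v" if "t \<in> {0..T}" for t
      using that v c(1) primitive(1)[OF q2(2)] by (simp add: h_def ip_diff_left)
    have "continuous_on {0..T} (\<lambda>t. ip (c t) v - ip (primitive w t) v)"
      by (intro continuous_on_diff ip_cont v c primitive(1)[OF q2(2)] primitive_continuous[OF q2(2) T])
    then have h_cont: "continuous_on {0..T} h"
      by (subst continuous_on_cong[OF refl h_eq]) auto
    define g where "g t = ip (q t) v - ip (primitive w t) v" for t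
    note iq = integrable_ip[OF bochner_L2D(1,3)[OF q2(1)] v]
    note iP = integrable_ip[OF bochner_L2D(1,3)[OF p] v]
    have "\<exists>k. AE t in time T. g t = k"
    proof (rule du_Bois_Reymond[OF _ T])
      show "integrable (time T) g" unfolding g_def using iq iP by simp
      fix \<psi> assume \<psi>: "\<psi> \<in> test_functions {0<..<T}"
      note d\<psi> = test_function_deriv[OF \<psi> T]
      obtain B where B: "\<And>x. \<bar>deriv \<psi> x\<bar> \<le> B" by (rule test_function_bounded[OF d\<psi> T]) blast
      note i = integrable_bounded_times[OF borel_measurable_integrable[OF test_function_integrable[OF d\<psi> T]] B]
      show "(LINT t|time T. deriv \<psi> t * g t) = 0"
        using weak_derivative_test[OF q2(1,2) T q2(3) \<psi> v] primitive_parts[OF q2(2) T \<psi> v] i[OF iq] i[OF iP]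
        by (simp add: g_def right_diff_distrib)
    qed
    then obtain k where k: "AE t in time T. g t = k" by blast
    have "AE t in time T. h t = k"
      using k c(3) strongly_measurable_in[OF bochner_L2D(1)[OF q2(1)]] AE_space
    proof eventually_elim
      case (elim t)
      then have t: "t \<in> {0..T}" by simp
      have "\<bar>ip (q t - c t) v\<bar> \<le> 0"
        using Cauchy_Schwarz[OF diff_in[OF elim(3) c(1)[OF t]] v] elim(2) by simp
      then have "ip (q t) v = ip (c t) v" using ip_diff_left[OF elim(3) c(1)[OF t] v] by simp
      then show ?case using elim(1) h_eq[OF t] by (simp add: g_def)
    qed
    then have ae: "AE t in lebesgue. t \<in> {0<..<T} \<longrightarrow> h t = k"
      by (simp add: AE_restrict_space_iff)
    \<comment> \<open>The level set of the continuous \<open>h\<close> is closed, and it meets every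
      subinterval because an interval of positive length is not null; so it is all of
      \<open>[0,T]\<close>, the endpoints included.\<close>
    have dense: "h t = k" if t: "t \<in> {0..T}" for t
    proof -
      let ?S = "{t \<in> {0<..<T}. h t = k}"
      have "?S \<subseteq> {t \<in> {0..T}. h t = k}" by auto
      moreover have "closed {t \<in> {0..T}. h t = k}"
        using continuous_closed_preimage_constant[OF h_cont, of k] by simp
      ultimately have "closure ?S \<subseteq> {t \<in> {0..T}. h t = k}" by (rule closure_minimal)
      moreover have "{0<..<T} \<subseteq> closure ?S"
      proof
        fix x assume x: "x \<in> {0<..<T}"
        show "x \<in> closure ?S"
          unfolding closure_approachable
        proof (intro allI impI)
          fix e :: real assume e: "e > 0"
          define a b where "a = max 0 (x - e)" and "b = min T (x + e)"
          have ab: "a < b" "{a<..<b} \<subseteq> {0<..<T}" using x e by (auto simp: a_def b_def)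
          obtain y where "y \<in> {a<..<b}" "h y = k"
          proof (rule ccontr)
            assume "\<not> thesis"
            then have no: "\<not> (\<exists>y\<in>{a<..<b}. h y = k)" using that by blast
            have "AE t in lebesgue. t \<notin> {a<..<b}"
              using ae by eventually_elim (use no ab in auto)
            then have "{a<..<b} \<in> null_sets lebesgue"
              by (subst (asm) AE_iff_null_sets[symmetric, of "{a<..<b}"]) auto
            then show False
              using ab(1) negligible_interval(2)[of a b] by (simp add: negligible_iff_null_sets box_real)
          qed
          then show "\<exists>y\<in>?S. dist y x < e"
            using ab(2) by (intro bexI[of _ y]) (auto simp: a_def b_def dist_real_def)
        qed
      qed
      then have "closure {0<..<T} \<subseteq> closure ?S"
        by (rule closure_minimal) simp
      ultimately have "closure {0<..<T} \<subseteq> {t \<in> {0..T}. h t = k}"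
        by blast
      then show ?thesis using t T by (auto simp: closure_greaterThanLessThan)
    qed
    have "h 0 = 0"
    proof -
      have z: "0 \<in> {0..T}" using T by simp
      have "\<bar>ip (c 0) v\<bar> \<le> 0" "\<bar>ip (primitive w 0) v\<bar> \<le> 0"
        using Cauchy_Schwarz[OF c(1)[OF z] v] Cauchy_Schwarz[OF primitive(1)[OF q2(2) z] v] c(4)
          N_primitive_0[OF q2(2) T] by simp_all
      then show ?thesis by (simp add: h_eq[OF z])
    qed
    then show ?thesis using dense[OF t] dense[of 0] T by (simp add: h_def)
  qed
  have "N (c t - primitive w t) = 0" if t: "t \<in> {0..T}" for t
    by (rule N_eq_0I[OF diff_in[OF c(1)[OF t] primitive(1)[OF q2(2) t]] eq[OF t]])
  then have *: "t \<in> {0..T} \<Longrightarrow> N (c t - primitive w t) = 0" for t by blast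
  show ?thesis
    using c(3) strongly_measurable_in[OF bochner_L2D(1)[OF q2(1)]] AE_space
  proof eventually_elim
    case (elim t)
    then have t: "t \<in> {0..T}" by simp
    show ?case
      using N_triangle3[OF elim(2) c(1)[OF t] primitive(1)[OF q2(2) t]] *[OF t] elim(1)
        N_nonneg[OF diff_in[OF elim(2) primitive(1)[OF q2(2) t]]] by (simp add: w_def)
  qed
qed

end

section \<open>Volterra equations\<close>

text \<open>An antiderivative of \<open>c exp (2 K s)\<close> is \<open>c / (2 K)\<close> times the
  exponential; the factor 2 in the exponent is what leaves \<open>1 / 2\<close> after multiplication
  by \<open>K\<close>.\<close>

lemma exp_weighted_integral_le:
  fixes g :: "real \<Rightarrow> real"
  assumes g: "integrable (time T) g" and K: "K > 0" and c: "c \<ge> 0" and t: "t \<in> {0..T}"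
    and le: "AE s in time T. g s \<le> c * exp (2 * K * s)"
  shows "K * (LINT s|time t. g s) \<le> c / 2 * exp (2 * K * t)"
proof -
  have i: "integrable (time T) (\<lambda>s. c * exp (2 * K * s))"
  proof (rule integrable_bounded_lebesgue_on)
    show "(\<lambda>s. c * exp (2 * K * s)) \<in> borel_measurable (time T)"
      by (intro continuous_borel_measurable_lebesgue_on continuous_intros) simp
    show "AE s in time T. \<bar>c * exp (2 * K * s)\<bar> \<le> c * exp (2 * K * T)"
      using K c by (intro AE_I2) (auto simp: abs_mult intro!: mult_left_mono)
  qed simp
  have "(LINT s|time t. g s) \<le> (LINT s|time t. c * exp (2 * K * s))"
  proof (rule integral_mono_AE)
    show "AE s in time t. g s \<le> c * exp (2 * K * s)"
      using le t by (auto simp: AE_restrict_space_iff elim!: eventually_mono)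
  qed (use time_integral(1)[OF g t] time_integral(1)[OF i t] in auto)
  also have "\<dots> = integral {0..t} (\<lambda>s. c * exp (2 * K * s))"
    by (rule time_integral(3)[OF i t])
  also have "\<dots> = c / (2 * K) * exp (2 * K * t) - c / (2 * K) * exp (2 * K * 0)"
  proof (rule integral_unique, rule fundamental_theorem_of_calculus)
    show "0 \<le> t" using t by simp
    fix x
    have "((\<lambda>s. c / (2 * K) * exp (2 * K * s)) has_real_derivative c * exp (2 * K * x)) (at x within {0..t})"
      using K by (auto intro!: derivative_eq_intros)
    then show "((\<lambda>s. c / (2 * K) * exp (2 * K * s)) has_vector_derivative c * exp (2 * K * x)) (at x within {0..t})"
      by (simp add: has_real_derivative_iff_has_vector_derivative)
  qed
  also have "\<dots> \<le> c / (2 * K) * exp (2 * K * t)" using K c by simp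
  finally have "K * (LINT s|time t. g s) \<le> K * (c / (2 * K) * exp (2 * K * t))"
    using K by (intro mult_left_mono) auto
  then show ?thesis using K by simp
qed

context semi_hilbert
begin

text \<open>For each \<open>n\<close> a simple function is chosen at mean distance below
  \<open>1 / Suc n\<close> from \<open>w n\<close>. Along a subsequence this distance tends to zero
  at almost every time, and there the triangle inequality gives convergence of the simple functions
  to \<open>u\<close>.\<close>

lemma strongly_measurable_limit:
  assumes w: "\<And>n. strongly_measurable T X N (w n)" "\<And>n. integrable (time T) (\<lambda>t. N (w n t))"
    and u: "AE t in time T. u t \<in> X" "AE t in time T. (\<lambda>n::nat. N (w n t - u t)) \<longlonglongrightarrow> 0"
  shows "strongly_measurable T X N u"
proof -
  have "\<exists>s. simple_function (time T) s \<and> (\<forall>t\<in>{0<..<T}. s t \<in> X) \<and>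
      integrable (time T) (\<lambda>t. N (s t - w n t)) \<and> (LINT t|time T. N (s t - w n t)) < 1 / real (Suc n)" for n
  proof -
    obtain s where s: "\<And>m. simple_function (time T) (s m)" "\<And>m t. t \<in> {0<..<T} \<Longrightarrow> s m t \<in> X"
      "\<And>m. integrable (time T) (\<lambda>t. N (s m t - w n t))"
      "(\<lambda>m. LINT t|time T. N (s m t - w n t)) \<longlonglongrightarrow> 0"
      by (rule L1_simple_approximation[OF w]) blast
    have "eventually (\<lambda>m. (LINT t|time T. N (s m t - w n t)) < 1 / real (Suc n)) sequentially"
      by (rule order_tendstoD(2)[OF s(4)]) simp
    then obtain m where "(LINT t|time T. N (s m t - w n t)) < 1 / real (Suc n)"
      by (auto simp: eventually_sequentially)
    then show ?thesis using s(1-3) by (intro exI[of _ "s m"]) blast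
  qed
  from choice[OF allI[OF this]] obtain s where s':
    "\<forall>n. simple_function (time T) (s n) \<and> (\<forall>t\<in>{0<..<T}. s n t \<in> X) \<and>
      integrable (time T) (\<lambda>t. N (s n t - w n t)) \<and> (LINT t|time T. N (s n t - w n t)) < 1 / real (Suc n)" ..
  then have s: "simple_function (time T) (s n)" "t \<in> {0<..<T} \<Longrightarrow> s n t \<in> X"
      "integrable (time T) (\<lambda>t. N (s n t - w n t))"
      "(LINT t|time T. N (s n t - w n t)) < 1 / real (Suc n)" for n t
    by blast+
  have X: "AE t in time T. \<forall>n. w n t \<in> X \<and> s n t \<in> X"
    unfolding AE_all_countable
  proof
    show "AE t in time T. w n t \<in> X \<and> s n t \<in> X" for n
      using strongly_measurable_in[OF w(1)[of n]] AE_space by eventually_elim (use s(2) in auto)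
  qed
  have eq: "(LINT t|time T. norm (N (s n t - w n t))) = (LINT t|time T. N (s n t - w n t))" for n
  proof (rule integral_cong_AE)
    show "AE t in time T. norm (N (s n t - w n t)) = N (s n t - w n t)"
      using X by eventually_elim (simp add: N_nonneg diff_in)
  qed (use s(3)[of n] in auto)
  have L1: "(\<lambda>n. LINT t|time T. norm (N (s n t - w n t))) \<longlonglongrightarrow> 0"
  proof (rule tendsto_zero_squeeze)
    show "(\<lambda>n. 1 / real (Suc n)) \<longlonglongrightarrow> 0"
      using LIMSEQ_inverse_real_of_nat by (simp add: inverse_eq_divide)
    show "(LINT t|time T. norm (N (s n t - w n t))) \<le> 1 / real (Suc n)" for n
      unfolding eq using s(4)[of n] by simp
  qed simp
  obtain r :: "nat \<Rightarrow> nat" where r: "strict_mono r" "AE t in time T. (\<lambda>n. N (s (r n) t - w (r n) t)) \<longlonglongrightarrow> 0"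
    using tendsto_L1_AE_subseq[of "time T" "\<lambda>n t. N (s n t - w n t)", OF s(3) L1] by blast
  show ?thesis
  proof (rule strongly_measurableI[where s="\<lambda>n. s (r n)"])
    show "AE t in time T. (\<lambda>n. N (s (r n) t - u t)) \<longlonglongrightarrow> 0"
      using X u r(2)
    proof eventually_elim
      case (elim t)
      have "(\<lambda>n. N (w (r n) t - u t)) \<longlonglongrightarrow> 0"
        using LIMSEQ_subseq_LIMSEQ[OF elim(3) r(1)] by (simp add: o_def)
      from tendsto_add[OF elim(4) this]
      have lim: "(\<lambda>n. N (s (r n) t - w (r n) t) + N (w (r n) t - u t)) \<longlonglongrightarrow> 0" by simp
      have "0 \<le> N (s (r n) t - u t)" "N (s (r n) t - u t) \<le> N (s (r n) t - w (r n) t) + N (w (r n) t - u t)" for n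
        using elim(1,2) by (auto intro!: N_nonneg diff_in N_triangle3)
      then show ?case by (rule tendsto_zero_squeeze[OF lim])
    qed
  qed (use s u in auto)
qed

section \<open>Picard iteration for Volterra operators\<close>

context
  fixes G :: "(real \<Rightarrow> 'v) \<Rightarrow> real \<Rightarrow> 'v" and T K :: real
  assumes T: "T > 0" and K: "K > 0"
    and G_in: "\<And>w. w \<in> bochner_L2 T X N \<Longrightarrow> G w \<in> bochner_L2 T X N"
    and G_Volterra: "\<And>u w. u \<in> bochner_L2 T X N \<Longrightarrow> w \<in> bochner_L2 T X N \<Longrightarrow>
      AE t in time T. N (G u t - G w t) \<le> K * (LINT s|time t. N (u s - w s))"
begin

text \<open>With the weight \<open>exp (2 K t)\<close>, a Volterra operator of constant \<open>K\<close> halves distances.\<close>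

lemma Volterra_contraction:
  assumes u: "u \<in> bochner_L2 T X N" and w: "w \<in> bochner_L2 T X N" and c: "c \<ge> 0"
    and le: "AE t in time T. N (u t - w t) \<le> c * exp (2 * K * t)"
  shows "AE t in time T. N (G u t - G w t) \<le> c / 2 * exp (2 * K * t)"
  using G_Volterra[OF u w] AE_space
proof eventually_elim
  case (elim t)
  then have "t \<in> {0..T}" by simp
  then show ?case
    using exp_weighted_integral_le[OF bochner_L2D(3)[OF bochner_L2_diff[OF u w]] K c _ le] elim(1)
    by (meson order_trans)
qed

text \<open>The start of the iteration: a difference of square integrable functions need not be
  bounded in time, but after one application of \<open>G\<close> it is, by \<open>K\<close> times
  the integral over the whole interval.\<close>

lemma Volterra_initial_bound:
  assumes u: "u \<in> bochner_L2 T X N" and w: "w \<in> bochner_L2 T X N"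
  obtains c where "c \<ge> 0" "AE t in time T. N (G u t - G w t) \<le> c * exp (2 * K * t)"
proof -
  note D = bochner_L2D(1,3)[OF bochner_L2_diff[OF u w]]
  define A where "A = (LINT s|time T. N (u s - w s))"
  have nn: "AE t in time T. 0 \<le> N (u t - w t)"
    using strongly_measurable_in[OF D(1)] by eventually_elim (rule N_nonneg)
  then have A: "0 \<le> A" unfolding A_def by (rule integral_nonneg_AE)
  have "AE t in time T. N (G u t - G w t) \<le> (K * A) * exp (2 * K * t)"
    using G_Volterra[OF u w] AE_space
  proof eventually_elim
    case (elim t)
    then have t: "t \<in> {0..T}" "0 \<le> t" by auto
    have "(LINT s|time t. N (u s - w s)) = (LINT s|time T. indicator {..<t} s * N (u s - w s))"
      by (rule time_integral(4)[OF D(2) t(1)])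
    also have "\<dots> \<le> A"
      unfolding A_def
    proof (rule integral_mono_AE)
      show "integrable (time T) (\<lambda>s. indicator {..<t} s * N (u s - w s))"
        by (rule integrable_bounded_times[OF borel_measurable_indicator_lessThan _ D(2), where B=1])
           (simp add: indicator_def)
      show "AE s in time T. indicator {..<t} s * N (u s - w s) \<le> N (u s - w s)"
        using nn by eventually_elim (auto simp: indicator_def)
    qed (rule D)
    finally have "K * (LINT s|time t. N (u s - w s)) \<le> K * A" using K by simp
    also have "\<dots> \<le> K * A * exp (2 * K * t)"
      using mult_left_mono[of 1 "exp (2 * K * t)" "K * A"] K A t by simp
    finally show ?case using elim(1) by simp
  qed
  then show thesis by (rule that[rotated]) (use K A in simp)
qed

text \<open>Since \<open>u\<close> and \<open>w\<close> agree with \<open>G u\<close> and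
  \<open>G w\<close>, the initial bound holds for their difference, and every further application of
  \<open>G\<close> halves it. The null sets of all \<open>n\<close> are collected before
  \<open>n\<close> tends to infinity.\<close>

lemma Volterra_unique:
  assumes u: "u \<in> bochner_L2 T X N" "AE t in time T. N (u t - G u t) = 0"
    and w: "w \<in> bochner_L2 T X N" "AE t in time T. N (w t - G w t) = 0"
  shows "AE t in time T. N (u t - w t) = 0"
proof -
  note X = strongly_measurable_in[OF bochner_L2D(1)[OF u(1)]] strongly_measurable_in[OF bochner_L2D(1)[OF w(1)]]
    strongly_measurable_in[OF bochner_L2D(1)[OF G_in[OF u(1)]]] strongly_measurable_in[OF bochner_L2D(1)[OF G_in[OF w(1)]]]
  have le: "AE t in time T. N (u t - w t) \<le> N (G u t - G w t)"
    using u(2) w(2) X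
  proof eventually_elim
    case (elim t)
    then show ?case
      using N_triangle3[of "u t" "G u t" "w t"] N_triangle3[of "G u t" "G w t" "w t"] N_commute[of "w t" "G w t"]
      by simp
  qed
  obtain c where c: "c \<ge> 0" "AE t in time T. N (G u t - G w t) \<le> c * exp (2 * K * t)"
    by (rule Volterra_initial_bound[OF u(1) w(1)])
  have "AE t in time T. N (u t - w t) \<le> c * (1/2) ^ n * exp (2 * K * t)" for n
  proof (induction n)
    case 0
    show ?case using le c(2) by eventually_elim simp
  next
    case (Suc n)
    have "AE t in time T. N (G u t - G w t) \<le> c * (1/2) ^ n / 2 * exp (2 * K * t)"
      by (rule Volterra_contraction[OF u(1) w(1) _ Suc]) (use c in simp)
    with le show ?case by eventually_elim simp
  qed
  then have "AE t in time T. \<forall>n. N (u t - w t) \<le> c * (1/2) ^ n * exp (2 * K * t)"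
    by (simp add: AE_all_countable)
  then show ?thesis
    using X(1,2)
  proof eventually_elim
    case (elim t)
    have "(\<lambda>n. c * (1/2) ^ n * exp (2 * K * t)) \<longlonglongrightarrow> c * 0 * exp (2 * K * t)"
      by (intro tendsto_intros LIMSEQ_power_zero) simp
    then have "N (u t - w t) \<le> c * 0 * exp (2 * K * t)"
      by (rule LIMSEQ_le_const) (use elim(1) in blast)
    then show ?case using N_nonneg[OF diff_in[OF elim(2,3)]] by simp
  qed
qed

text \<open>The iterates start from 0, and off one null set they are Cauchy in \<open>X\<close> at
  each time. The estimates begin with \<open>w 2 - w 1\<close>, because \<open>w 1 - w 0\<close>
  need not be bounded by a multiple of the weight; hence the shifts by \<open>Suc\<close>.\<close>

lemma Volterra_exists: "\<exists>w\<in>bochner_L2 T X N. AE t in time T. N (w t - G w t) = 0"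
proof -
  define w where "w n = (G ^^ n) (\<lambda>t. 0)" for n
  have w_Suc: "w (Suc n) = G (w n)" for n by (simp add: w_def)
  have "(\<lambda>t. 0) \<in> bochner_L2 T X N"
    using strongly_measurable_const[OF zero_in] by (simp add: bochner_L2_def N_zero)
  then have w: "w n \<in> bochner_L2 T X N" for n
    by (induction n) (auto simp: w_Suc G_in, simp add: w_def)
  obtain c where c: "c \<ge> 0" "AE t in time T. N (w 2 t - w 1 t) \<le> c * exp (2 * K * t)"
    using Volterra_initial_bound[OF w[of 1] w[of 0]] w_Suc[of 0] w_Suc[of 1] by (auto simp: numeral_2_eq_2)
  have step: "AE t in time T. N (w (Suc (Suc n)) t - w (Suc n) t) \<le> c * (1/2) ^ n * exp (2 * K * t)" for n
  proof (induction n)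
    case 0
    show ?case using c(2) by (simp add: numeral_2_eq_2)
  next
    case (Suc n)
    have "AE t in time T. N (G (w (Suc (Suc n))) t - G (w (Suc n)) t) \<le> c * (1/2) ^ n / 2 * exp (2 * K * t)"
      by (rule Volterra_contraction[OF w w _ Suc]) (use c in simp)
    then show ?case by (simp add: w_Suc)
  qed
  define M where "M = c * exp (2 * K * T)"
  have M: "0 \<le> M" using c by (simp add: M_def)
  have good: "AE t in time T. t \<in> {0<..<T} \<and> (\<forall>n. w n t \<in> X \<and>
      N (w (Suc (Suc n)) t - w (Suc n) t) \<le> M * (1/2) ^ n)"
  proof -
    have "AE t in time T. \<forall>n. w n t \<in> X"
      using strongly_measurable_in[OF bochner_L2D(1)[OF w]] by (simp add: AE_all_countable)
    moreover have "AE t in time T. \<forall>n. N (w (Suc (Suc n)) t - w (Suc n) t) \<le> c * (1/2) ^ n * exp (2 * K * t)"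
      using step by (simp add: AE_all_countable)
    ultimately show ?thesis using AE_space
    proof eventually_elim
      case (elim t)
      have "c * (1/2) ^ n * exp (2 * K * t) \<le> c * (1/2) ^ n * exp (2 * K * T)" for n
        using elim(3) K c by (intro mult_left_mono) auto
      then have "c * (1/2) ^ n * exp (2 * K * t) \<le> M * (1/2) ^ n" for n
        by (simp add: M_def mult_ac)
      then show ?case using elim by (auto intro: order_trans)
    qed
  qed
  \<comment> \<open>The partial geometric sum is kept exactly, with the factor
    \<open>1 - (1/2) ^ k\<close>, so that the induction closes.\<close>
  have tail: "N (w (Suc n + k) t - w (Suc n) t) \<le> 2 * M * (1/2) ^ n * (1 - (1/2) ^ k)"
    if t: "\<And>n. w n t \<in> X" "\<And>n. N (w (Suc (Suc n)) t - w (Suc n) t) \<le> M * (1/2) ^ n" for t n k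
  proof (induction k)
    case (Suc k)
    have "N (w (Suc n + Suc k) t - w (Suc n) t)
        \<le> N (w (Suc (Suc (n + k))) t - w (Suc (n + k)) t) + N (w (Suc n + k) t - w (Suc n) t)"
      using N_triangle3[OF t(1) t(1) t(1)] by simp
    also have "\<dots> \<le> M * (1/2) ^ (n + k) + 2 * M * (1/2) ^ n * (1 - (1/2) ^ k)"
      by (intro add_mono t(2) Suc)
    also have "\<dots> = 2 * M * (1/2) ^ n * (1 - (1/2) ^ Suc k)"
      by (simp add: power_add algebra_simps)
    finally show ?case .
  qed (simp add: N_zero)
  have tail': "N (w (Suc n + k) t - w (Suc n) t) \<le> 2 * M * (1/2) ^ n"
    if t: "\<And>n. w n t \<in> X" "\<And>n. N (w (Suc (Suc n)) t - w (Suc n) t) \<le> M * (1/2) ^ n" for t n k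
  proof -
    have "2 * M * (1/2) ^ n * (1 - (1/2) ^ k) \<le> 2 * M * (1/2) ^ n * 1"
      using M by (intro mult_left_mono) auto
    then show ?thesis using tail[OF t, of n k] by simp
  qed
  \<comment> \<open>The choice is made at every time; where the iterates have no limit its value is
    arbitrary, but these times form a null set.\<close>
  define u where "u t = (SOME z. z \<in> X \<and> (\<lambda>n. N (w n t - z)) \<longlonglongrightarrow> 0)" for t
  have lim0: "(\<lambda>n. 2 * M * (1/2) ^ n) \<longlonglongrightarrow> 0"
    using tendsto_mult_left[OF LIMSEQ_power_zero[of "1/2::real"], of "2 * M"] by simp
  have u: "AE t in time T. u t \<in> X \<and> (\<lambda>n. N (w n t - u t)) \<longlonglongrightarrow> 0 \<and>
      (\<forall>n. N (w (Suc n) t - u t) \<le> 2 * M * (1/2) ^ n)"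
    using good
  proof eventually_elim
    case (elim t)
    then have t: "\<And>n. w n t \<in> X" "\<And>n. N (w (Suc (Suc n)) t - w (Suc n) t) \<le> M * (1/2) ^ n" by auto
    have "\<exists>z\<in>X. (\<lambda>n. N (w n t - z)) \<longlonglongrightarrow> 0"
    proof (rule complete[OF t(1)])
      fix e :: real assume e: "e > 0"
      have "eventually (\<lambda>n. 2 * M * (1/2) ^ n < e / 2) sequentially"
        by (rule order_tendstoD(2)[OF lim0]) (use e in simp)
      then obtain n where n: "2 * M * (1/2) ^ n < e / 2" by (auto simp: eventually_sequentially)
      have "N (w i t - w j t) < e" if "i \<ge> Suc n" "j \<ge> Suc n" for i j
      proof -
        have "N (w i t - w (Suc n) t) < e / 2" "N (w j t - w (Suc n) t) < e / 2"
          using tail'[OF t, of n "i - Suc n"] tail'[OF t, of n "j - Suc n"] that n by auto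
        then show ?thesis
          using N_triangle3[OF t(1)[of i] t(1)[of "Suc n"] t(1)[of j]] N_commute[OF t(1)[of j] t(1)[of "Suc n"]] by simp
      qed
      then show "\<exists>K. \<forall>m\<ge>K. \<forall>n\<ge>K. N (w m t - w n t) < e" by blast
    qed
    then have "\<exists>z. z \<in> X \<and> (\<lambda>n. N (w n t - z)) \<longlonglongrightarrow> 0" by blast
    from someI_ex[OF this] have ut: "u t \<in> X" "(\<lambda>n. N (w n t - u t)) \<longlonglongrightarrow> 0"
      by (auto simp: u_def)
    have "N (w (Suc n) t - u t) \<le> 2 * M * (1/2) ^ n" for n
    proof -
      have "(\<lambda>k. N (w (k + Suc n) t - u t)) \<longlonglongrightarrow> 0"
        using LIMSEQ_ignore_initial_segment[OF ut(2), of "Suc n"] .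
      then have l: "(\<lambda>k. 2 * M * (1/2) ^ n + N (w (Suc n + k) t - u t)) \<longlonglongrightarrow> 2 * M * (1/2) ^ n + 0"
        by (intro tendsto_add tendsto_const) (simp add: add.commute)
      have "N (w (Suc n) t - u t) \<le> 2 * M * (1/2) ^ n + N (w (Suc n + k) t - u t)" for k
        using N_triangle3[OF t(1)[of "Suc n"] t(1)[of "Suc n + k"] ut(1)] tail'[OF t, of n k]
          N_commute[OF t(1)[of "Suc n + k"] t(1)[of "Suc n"]] by simp
      then have "N (w (Suc n) t - u t) \<le> 2 * M * (1/2) ^ n + 0"
        by (intro LIMSEQ_le_const[OF l]) blast
      then show ?thesis by simp
    qed
    then show ?case using ut by blast
  qed
  have uL2: "u \<in> bochner_L2 T X N"
  proof (rule bochner_L2I_bounded)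
    show "strongly_measurable T X N u"
    proof (rule strongly_measurable_limit[of T w])
      show "AE t in time T. u t \<in> X" "AE t in time T. (\<lambda>n. N (w n t - u t)) \<longlonglongrightarrow> 0"
        using u by (auto elim: eventually_mono)
    qed (use bochner_L2D[OF w] in auto)
    note W = bochner_L2D[OF w[of 1]]
    show "integrable (time T) (\<lambda>t. (N (w 1 t) + 2 * M)\<^sup>2)"
    proof -
      have "(\<lambda>t. (N (w 1 t) + 2 * M)\<^sup>2) = (\<lambda>t. (N (w 1 t))\<^sup>2 + 4 * M * N (w 1 t) + 4 * M\<^sup>2)"
        by (simp add: fun_eq_iff power2_eq_square algebra_simps)
      then show ?thesis
        by (simp only:) (intro Bochner_Integration.integrable_add W(2) integrable_mult_right[OF W(3)]
          finite_measure.integrable_const[OF finite_measure_time])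
    qed
    show "AE t in time T. N (u t) \<le> N (w 1 t) + 2 * M"
      using u good
    proof eventually_elim
      case (elim t)
      then have X: "u t \<in> X" "w 1 t \<in> X" by auto
      have "N (w (Suc 0) t - u t) \<le> 2 * M * (1/2) ^ 0" using elim(1) by blast
      then show ?case using N_le_add[OF X] N_commute[OF X] by simp
    qed
  qed
  have "AE t in time T. N (G (w (Suc n)) t - G u t) \<le> (2 * M * (1/2) ^ n) / 2 * exp (2 * K * t)" for n
  proof (rule Volterra_contraction[OF w uL2])
    show "0 \<le> 2 * M * (1/2) ^ n" using M by simp
    show "AE t in time T. N (w (Suc n) t - u t) \<le> 2 * M * (1/2) ^ n * exp (2 * K * t)"
      using u AE_space
    proof eventually_elim
      case (elim t)
      have "2 * M * (1/2) ^ n * 1 \<le> 2 * M * (1/2) ^ n * exp (2 * K * t)"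
        using M K elim(2) by (intro mult_left_mono) auto
      moreover have "N (w (Suc n) t - u t) \<le> 2 * M * (1/2) ^ n" using elim(1) by blast
      ultimately show ?case by linarith
    qed
  qed
  then have "AE t in time T. \<forall>n. N (G (w (Suc n)) t - G u t) \<le> (2 * M * (1/2) ^ n) / 2 * exp (2 * K * t)"
    by (simp add: AE_all_countable)
  then have "AE t in time T. N (u t - G u t) = 0"
    using u good strongly_measurable_in[OF bochner_L2D(1)[OF G_in[OF uL2]]]
  proof eventually_elim
    case (elim t)
    then have X: "u t \<in> X" "\<And>n. w n t \<in> X" "G u t \<in> X" by auto
    \<comment> \<open>The intermediate point is \<open>w (Suc (Suc n)) t\<close>, which is
      \<open>G (w (Suc n)) t\<close>: its distance to \<open>u t\<close> tends to zero by
      convergence, its distance to \<open>G u t\<close> by the Volterra estimate.\<close>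
    have "N (u t - G u t) \<le> N (w (Suc (Suc n)) t - u t) + (2 * M * (1/2) ^ n) / 2 * exp (2 * K * t)" for n
      using N_triangle3[OF X(1) X(2)[of "Suc (Suc n)"] X(3)] N_commute[OF X(1) X(2)[of "Suc (Suc n)"]] elim(1)
      by (auto simp: w_Suc[of "Suc n"] intro: order_trans)
    moreover have "(\<lambda>n. N (w (Suc (Suc n)) t - u t) + (2 * M * (1/2) ^ n) / 2 * exp (2 * K * t)) \<longlonglongrightarrow> 0 + 0 / 2 * exp (2 * K * t)"
    proof (intro tendsto_add tendsto_mult tendsto_divide tendsto_const lim0)
      show "(\<lambda>n. N (w (Suc (Suc n)) t - u t)) \<longlonglongrightarrow> 0"
        using LIMSEQ_ignore_initial_segment[of "\<lambda>n. N (w n t - u t)" 0 2] elim(2) by (simp add: numeral_2_eq_2)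
    qed simp
    ultimately have "N (u t - G u t) \<le> 0 + 0 / 2 * exp (2 * K * t)"
      by (intro LIMSEQ_le_const) auto
    then show ?case using N_nonneg[OF diff_in[OF X(1,3)]] by simp
  qed
  then show ?thesis using uL2 by blast
qed

end

end

section \<open>Lebesgue and Sobolev spaces are Hilbert spaces\<close>

text \<open>Covers scalar functions and gradient fields at once, so that completeness is proved a
  single time.\<close>

definition L2_fun :: "'a measure \<Rightarrow> ('a \<Rightarrow> 'b::euclidean_space) set"
  where "L2_fun M = {g. g \<in> borel_measurable M \<and> integrable M (\<lambda>x. (norm (g x))\<^sup>2)}"

lemma L2_eq: "L2 S = L2_fun (lebesgue_on S)"
  by (simp add: L2_def L2_fun_def)

lemma L2_field_eq: "L2_field S = L2_fun (lebesgue_on S)"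
  by (simp add: L2_field_def L2_fun_def)

lemma L2_funD: "g \<in> L2_fun M \<Longrightarrow> g \<in> borel_measurable M" "g \<in> L2_fun M \<Longrightarrow> integrable M (\<lambda>x. (norm (g x))\<^sup>2)"
  by (auto simp: L2_fun_def)

lemma L2_funI_bounded:
  assumes "g \<in> borel_measurable M" "integrable M h" "\<And>x. x \<in> space M \<Longrightarrow> (norm (g x))\<^sup>2 \<le> h x"
  shows "g \<in> L2_fun M"
proof -
  have "integrable M (\<lambda>x. (norm (g x))\<^sup>2)"
  proof (rule Bochner_Integration.integrable_bound[OF assms(2)])
    show "AE x in M. norm ((norm (g x))\<^sup>2) \<le> norm (h x)"
    proof (rule AE_I2)
      fix x assume "x \<in> space M"
      from assms(3)[OF this] show "norm ((norm (g x))\<^sup>2) \<le> norm (h x)" by simp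
    qed
  qed (use assms in measurable)
  then show ?thesis using assms by (simp add: L2_fun_def)
qed

lemma power2_norm_add_le:
  fixes a b :: "'b::real_normed_vector"
  shows "(norm (a + b))\<^sup>2 \<le> 2 * (norm a)\<^sup>2 + 2 * (norm b)\<^sup>2"
proof -
  have "(norm (a + b))\<^sup>2 \<le> (norm a + norm b)\<^sup>2" by (intro power_mono norm_triangle_ineq) simp
  also have "\<dots> \<le> 2 * (norm a)\<^sup>2 + 2 * (norm b)\<^sup>2"
    using sum_squares_bound[of "norm a" "norm b"] by (simp add: power2_sum)
  finally show ?thesis .
qed

lemma L2_fun_add: "f \<in> L2_fun M \<Longrightarrow> g \<in> L2_fun M \<Longrightarrow> (\<lambda>x. f x + g x) \<in> L2_fun M"
  by (rule L2_funI_bounded[where h="\<lambda>x. 2 * (norm (f x))\<^sup>2 + 2 * (norm (g x))\<^sup>2"])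
     (auto simp: L2_funD power2_norm_add_le intro!: borel_measurable_add)

lemma L2_fun_scaleR: "f \<in> L2_fun M \<Longrightarrow> (\<lambda>x. c *\<^sub>R f x) \<in> L2_fun M"
  by (rule L2_funI_bounded[where h="\<lambda>x. c\<^sup>2 * (norm (f x))\<^sup>2"])
     (auto simp: L2_funD power_mult_distrib intro!: borel_measurable_scaleR)

lemma L2_fun_diff: "f \<in> L2_fun M \<Longrightarrow> g \<in> L2_fun M \<Longrightarrow> (\<lambda>x. f x - g x) \<in> L2_fun M"
  using L2_fun_add[of f M "\<lambda>x. (-1) *\<^sub>R g x"] L2_fun_scaleR[of g M "-1"] by simp

lemma L2_fun_zero: "(\<lambda>x. 0) \<in> L2_fun M"
  by (simp add: L2_fun_def)

lemma L2_fun_inner: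
  assumes "f \<in> L2_fun M" "g \<in> L2_fun M"
  shows "integrable M (\<lambda>x. f x \<bullet> g x)"
proof (rule Bochner_Integration.integrable_bound)
  show "integrable M (\<lambda>x. (norm (f x))\<^sup>2 + (norm (g x))\<^sup>2)" using assms by (simp add: L2_funD)
  have "\<bar>f x \<bullet> g x\<bar> \<le> (norm (f x))\<^sup>2 + (norm (g x))\<^sup>2" for x
    using Cauchy_Schwarz_ineq2[of "f x" "g x"] sum_squares_bound[of "norm (f x)" "norm (g x)"]
      mult_nonneg_nonneg[of "norm (f x)" "norm (g x)"] by simp
  then show "AE x in M. norm (f x \<bullet> g x) \<le> norm ((norm (f x))\<^sup>2 + (norm (g x))\<^sup>2)"
    by (intro AE_I2) simp
qed (use assms L2_funD in \<open>auto intro!: borel_measurable_inner\<close>)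

lemma L2_fun_component:
  assumes "g \<in> L2_fun M"
  shows "(\<lambda>x. g x \<bullet> b) \<in> L2_fun M"
proof (rule L2_funI_bounded[where h="\<lambda>x. (norm b)\<^sup>2 * (norm (g x))\<^sup>2"])
  show "(norm (g x \<bullet> b))\<^sup>2 \<le> (norm b)\<^sup>2 * (norm (g x))\<^sup>2" for x
    using power_mono[OF Cauchy_Schwarz_ineq2[of "g x" b], of 2] by (simp add: power_mult_distrib mult.commute)
qed (use L2_funD[OF assms] in auto)

lemma (in finite_measure) L2_fun_integrable_norm:
  assumes "g \<in> L2_fun M"
  shows "integrable M (\<lambda>x. norm (g x))" "integrable M g"
proof -
  show i: "integrable M (\<lambda>x. norm (g x))"
  proof (rule Bochner_Integration.integrable_bound)
    show "integrable M (\<lambda>x. 1 + (norm (g x))\<^sup>2)"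
      using L2_funD[OF assms] by (intro Bochner_Integration.integrable_add integrable_const)
    have "norm y \<le> 1 + (norm y)\<^sup>2" for y :: 'b
    proof -
      have "norm y \<le> 2 * norm y" by simp
      also have "\<dots> \<le> 1 + (norm y)\<^sup>2" using sum_squares_bound[of "norm y" 1] by simp
      finally show ?thesis .
    qed
    then show "AE x in M. norm (norm (g x)) \<le> norm (1 + (norm (g x))\<^sup>2)"
      by (intro AE_I2) simp
  qed (use L2_funD[OF assms] in measurable)
  then show "integrable M g" using L2_funD[OF assms] by (simp add: integrable_norm_iff)
qed

text \<open>Riesz-Fischer: on a finite measure a Cauchy sequence in the square mean is Cauchy in the
  mean, so a subsequence converges almost everywhere, and Fatou's lemma carries the quadratic Cauchy
  bound over to the limit.\<close>

lemma (in finite_measure) L2_fun_complete: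
  fixes s :: "nat \<Rightarrow> 'a \<Rightarrow> 'b::euclidean_space"
  assumes s: "\<And>n. s n \<in> L2_fun M"
    and cauchy: "\<And>e. e > 0 \<Longrightarrow> \<exists>K. \<forall>m\<ge>K. \<forall>n\<ge>K. (LINT x|M. (norm (s m x - s n x))\<^sup>2) < e"
  shows "\<exists>g\<in>L2_fun M. (\<lambda>n. LINT x|M. (norm (s n x - g x))\<^sup>2) \<longlonglongrightarrow> 0"
proof -
  note [measurable] = L2_funD(1)[OF s]
  note d = L2_fun_diff[OF s s]
  have L1: "\<exists>K. \<forall>m\<ge>K. \<forall>n\<ge>K. (LINT x|M. norm (s m x - s n x)) < e" if e: "e > 0" for e
  proof -
    define \<mu> where "\<mu> = measure M (space M)"
    \<comment> \<open>Used in \<open>a \<le> \<delta> / 2 + a^2 / (2 * \<delta>)\<close>: this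
      \<open>\<delta>\<close> makes the constant part integrate to at most \<open>e / 2\<close>, and
      the threshold \<open>\<delta> * e\<close> leaves less than \<open>e / 2\<close> for the
      square. The summand 1 avoids dividing by zero on a null space.\<close>
    define \<delta> where "\<delta> = e / (\<mu> + 1)"
    have \<mu>: "0 \<le> \<mu>" by (simp add: \<mu>_def)
    have \<delta>: "\<delta> > 0" using e \<mu> by (simp add: \<delta>_def)
    obtain K where K: "\<And>m n. m \<ge> K \<Longrightarrow> n \<ge> K \<Longrightarrow> (LINT x|M. (norm (s m x - s n x))\<^sup>2) < \<delta> * e"
      using cauchy[of "\<delta> * e"] \<delta> e by auto
    have "(LINT x|M. norm (s m x - s n x)) < e" if mn: "m \<ge> K" "n \<ge> K" for m n
    proof -
      have i: "integrable M (\<lambda>x. (norm (s m x - s n x))\<^sup>2)" using L2_funD(2)[OF d] .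
      have le: "a \<le> \<delta> / 2 + a\<^sup>2 / (2 * \<delta>)" for a
        using zero_le_power2[of "a - \<delta>"] \<delta> by (simp add: field_simps power2_eq_square)
      have "(LINT x|M. norm (s m x - s n x)) \<le> (LINT x|M. \<delta> / 2 + (norm (s m x - s n x))\<^sup>2 / (2 * \<delta>))"
        using L2_fun_integrable_norm[OF d] i le by (intro integral_mono) auto
      also have "\<dots> = \<mu> * (\<delta> / 2) + (LINT x|M. (norm (s m x - s n x))\<^sup>2) / (2 * \<delta>)"
        using i by (simp add: \<mu>_def)
      also have "\<dots> < e / 2 + e / 2"
      proof (rule add_le_less_mono)
        show "\<mu> * (\<delta> / 2) \<le> e / 2" using e \<mu> by (simp add: \<delta>_def field_simps)
        show "(LINT x|M. (norm (s m x - s n x))\<^sup>2) / (2 * \<delta>) < e / 2"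
          using K[OF mn] \<delta> by (simp add: field_simps)
      qed
      finally show ?thesis by simp
    qed
    then show ?thesis by blast
  qed
  obtain r where r: "strict_mono r" "AE x in M. Cauchy (\<lambda>i. s (r i) x)"
    by (rule cauchy_L1_AE_cauchy_subseq[OF L2_fun_integrable_norm(2)[OF s] L1])
  define g where "g x = lim (\<lambda>i. s (r i) x)" for x
  have [measurable]: "g \<in> borel_measurable M" unfolding g_def by (rule borel_measurable_lim_metric) measurable
  have lim: "AE x in M. (\<lambda>i. s (r i) x) \<longlonglongrightarrow> g x"
    using r(2) by eventually_elim (simp add: g_def Cauchy_convergent_iff convergent_LIMSEQ_iff)
  have bound: "(\<integral>\<^sup>+x. ennreal ((norm (s m x - g x))\<^sup>2) \<partial>M) \<le> ennreal e"
    if "e > 0" and K: "\<And>m n. m \<ge> K \<Longrightarrow> n \<ge> K \<Longrightarrow> (LINT x|M. (norm (s m x - s n x))\<^sup>2) < e" and m: "m \<ge> K" for e K m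
  proof -
    have "(\<integral>\<^sup>+x. ennreal ((norm (s m x - g x))\<^sup>2) \<partial>M)
        = (\<integral>\<^sup>+x. liminf (\<lambda>i. ennreal ((norm (s m x - s (r i) x))\<^sup>2)) \<partial>M)"
    proof (rule nn_integral_cong_AE)
      show "AE x in M. ennreal ((norm (s m x - g x))\<^sup>2) = liminf (\<lambda>i. ennreal ((norm (s m x - s (r i) x))\<^sup>2))"
        using lim
      proof eventually_elim
        case (elim x)
        have "(\<lambda>i. ennreal ((norm (s m x - s (r i) x))\<^sup>2)) \<longlonglongrightarrow> ennreal ((norm (s m x - g x))\<^sup>2)"
          by (intro tendsto_ennrealI tendsto_power tendsto_norm tendsto_diff tendsto_const elim)
        then show ?case by (intro lim_imp_Liminf[symmetric]) auto
      qed
    qed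
    also have "\<dots> \<le> liminf (\<lambda>i. \<integral>\<^sup>+x. ennreal ((norm (s m x - s (r i) x))\<^sup>2) \<partial>M)"
      by (rule nn_integral_liminf) measurable
    also have "\<dots> \<le> ennreal e"
    proof (rule Liminf_le)
      have "eventually (\<lambda>i. r i \<ge> K) sequentially"
        using filterlim_subseq[OF r(1)] by (auto simp: filterlim_at_top)
      then show "eventually (\<lambda>i. (\<integral>\<^sup>+x. ennreal ((norm (s m x - s (r i) x))\<^sup>2) \<partial>M) \<le> ennreal e) sequentially"
      proof eventually_elim
        case (elim i)
        have "(\<integral>\<^sup>+x. ennreal ((norm (s m x - s (r i) x))\<^sup>2) \<partial>M) = ennreal (LINT x|M. (norm (s m x - s (r i) x))\<^sup>2)"
          by (rule nn_integral_eq_integral[OF L2_funD(2)[OF d]]) simp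
        then show ?case using K[OF m elim] by (simp add: ennreal_leI)
      qed
    qed simp
    finally show ?thesis .
  qed
  have L2d: "(\<lambda>x. s m x - g x) \<in> L2_fun M \<and> (LINT x|M. (norm (s m x - g x))\<^sup>2) \<le> e"
    if "e > 0" and K: "\<And>m n. m \<ge> K \<Longrightarrow> n \<ge> K \<Longrightarrow> (LINT x|M. (norm (s m x - s n x))\<^sup>2) < e" and m: "m \<ge> K" for e K m
  proof -
    note b = bound[OF that]
    have "integrable M (\<lambda>x. (norm (s m x - g x))\<^sup>2)"
      by (rule integrableI_bounded) (use b in \<open>auto simp: top_unique less_top[symmetric] intro: le_less_trans\<close>)
    moreover from this have "(LINT x|M. (norm (s m x - g x))\<^sup>2) \<le> e"
      using b nn_integral_eq_integral[of M "\<lambda>x. (norm (s m x - g x))\<^sup>2"] \<open>e > 0\<close> by simp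
    ultimately show ?thesis by (simp add: L2_fun_def)
  qed
  obtain K1 where K1: "\<And>m n. m \<ge> K1 \<Longrightarrow> n \<ge> K1 \<Longrightarrow> (LINT x|M. (norm (s m x - s n x))\<^sup>2) < 1"
    using cauchy[of 1] by auto
  have "g \<in> L2_fun M"
  proof -
    have "(\<lambda>x. s K1 x - g x) \<in> L2_fun M" using L2d[of 1 K1 K1] K1 by simp
    from L2_fun_diff[OF s[of K1] this] show ?thesis by simp
  qed
  moreover have "(\<lambda>n. LINT x|M. (norm (s n x - g x))\<^sup>2) \<longlonglongrightarrow> 0"
  proof (rule LIMSEQ_I)
    fix e :: real assume e: "e > 0"
    obtain K where K: "\<And>m n. m \<ge> K \<Longrightarrow> n \<ge> K \<Longrightarrow> (LINT x|M. (norm (s m x - s n x))\<^sup>2) < e / 2"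
      using cauchy[of "e / 2"] e by auto
    have "norm ((LINT x|M. (norm (s n x - g x))\<^sup>2) - 0) < e" if "n \<ge> K" for n
    proof -
      have "0 \<le> (LINT x|M. (norm (s n x - g x))\<^sup>2)" by simp
      moreover have "(LINT x|M. (norm (s n x - g x))\<^sup>2) \<le> e / 2" using L2d[OF _ K that] e by simp
      ultimately show ?thesis using e by simp
    qed
    then show "\<exists>K. \<forall>n\<ge>K. norm ((LINT x|M. (norm (s n x - g x))\<^sup>2) - 0) < e" by blast
  qed
  ultimately show ?thesis by blast
qed

lemma semi_hilbert_L2:
  fixes S :: "'a::euclidean_space set"
  assumes S: "S \<in> lmeasurable"
  shows "semi_hilbert (L2 S) (L2_norm S) (L2_inner S)"
proof
  interpret finite_measure "lebesgue_on S" by (rule finite_measure_lebesgue_on[OF S])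
  note i = L2_fun_inner[where 'b=real, simplified]
  show "0 \<in> L2 S" using L2_fun_zero[where 'b=real] by (simp add: L2_eq zero_fun_def)
  show "u + v \<in> L2 S" if "u \<in> L2 S" "v \<in> L2 S" for u v
    using that L2_fun_add by (auto simp: L2_eq plus_fun_def)
  show "c *\<^sub>R u \<in> L2 S" if "u \<in> L2 S" for c u
    using that L2_fun_scaleR[where 'b=real] by (simp add: L2_eq scaleR_fun_def)
  show "L2_inner S u v = L2_inner S v u" for u v by (simp add: L2_inner_def mult.commute)
  show "L2_inner S (u + v) w = L2_inner S u w + L2_inner S v w"
    if "u \<in> L2 S" "v \<in> L2 S" "w \<in> L2 S" for u v w
    using i[OF that(1,3)[unfolded L2_eq]] i[OF that(2,3)[unfolded L2_eq]]
    by (simp add: L2_inner_def plus_fun_def distrib_right)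
  show "L2_inner S (c *\<^sub>R u) w = c * L2_inner S u w" for c u w
    by (simp add: L2_inner_def scaleR_fun_def mult.assoc)
  show "0 \<le> L2_inner S u u" for u by (simp add: L2_inner_def)
  show "L2_norm S u = sqrt (L2_inner S u u)" for u
    by (simp add: L2_norm_def L2_inner_def power2_eq_square)
  fix s :: "nat \<Rightarrow> 'a \<Rightarrow> real"
  assume s: "\<And>n. s n \<in> L2 S"
    and c: "\<And>e. e > 0 \<Longrightarrow> \<exists>K. \<forall>m\<ge>K. \<forall>n\<ge>K. L2_norm S (s m - s n) < e"
  have sq: "(L2_norm S u)\<^sup>2 = (LINT x|lebesgue_on S. (norm (u x))\<^sup>2)" for u
    by (simp add: L2_norm_def)
  have "\<exists>g\<in>L2_fun (lebesgue_on S). (\<lambda>n. LINT x|lebesgue_on S. (norm (s n x - g x))\<^sup>2) \<longlonglongrightarrow> 0"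
  proof (rule L2_fun_complete)
    show "s n \<in> L2_fun (lebesgue_on S)" for n using s by (simp add: L2_eq)
    fix e :: real assume e: "e > 0"
    then obtain K where K: "\<And>m n. m \<ge> K \<Longrightarrow> n \<ge> K \<Longrightarrow> L2_norm S (s m - s n) < sqrt e"
      using c[of "sqrt e"] by auto
    have "(LINT x|lebesgue_on S. (norm (s m x - s n x))\<^sup>2) < e" if "m \<ge> K" "n \<ge> K" for m n
      using power_strict_mono[OF K[OF that], of 2] sq[of "s m - s n"] e by (simp add: L2_norm_def)
    then show "\<exists>K. \<forall>m\<ge>K. \<forall>n\<ge>K. (LINT x|lebesgue_on S. (norm (s m x - s n x))\<^sup>2) < e" by blast
  qed
  then obtain g where g: "g \<in> L2 S" "(\<lambda>n. LINT x|lebesgue_on S. (norm (s n x - g x))\<^sup>2) \<longlonglongrightarrow> 0"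
    by (auto simp: L2_eq)
  have "(\<lambda>n. L2_norm S (s n - g)) \<longlonglongrightarrow> 0"
    using tendsto_real_sqrt[OF g(2)] by (simp add: L2_norm_def)
  then show "\<exists>u\<in>L2 S. (\<lambda>n. L2_norm S (s n - u)) \<longlonglongrightarrow> 0" using g by blast
qed

lemma integrable_continuous_times:
  fixes f g :: "'a::euclidean_space \<Rightarrow> real"
  assumes S: "bounded S" "S \<in> sets lebesgue" and f: "continuous_on UNIV f" and g: "integrable (lebesgue_on S) g"
  shows "integrable (lebesgue_on S) (\<lambda>x. f x * g x)"
proof -
  have "compact (f ` closure S)"
    using S(1) f continuous_on_subset by (intro compact_continuous_image) (auto simp: compact_closure)
  from compact_imp_bounded[OF this] obtain B where B: "\<forall>y\<in>f ` closure S. \<bar>y\<bar> \<le> B"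
    unfolding bounded_real ..
  show ?thesis
  proof (rule Bochner_Integration.integrable_bound)
    show "integrable (lebesgue_on S) (\<lambda>x. B * \<bar>g x\<bar>)" using g by simp
    have "\<bar>f x\<bar> \<le> B" if "x \<in> S" for x using B that closure_subset by blast
    then show "AE x in lebesgue_on S. norm (f x * g x) \<le> norm (B * \<bar>g x\<bar>)"
      by (intro AE_I2) (auto simp: abs_mult intro!: mult_right_mono order_trans[OF _ abs_ge_self[of B]])
  qed (use continuous_borel_measurable_lebesgue_on[OF f S(2)] g in auto)
qed

lemma continuous_L2:
  fixes f :: "'a::euclidean_space \<Rightarrow> real"
  assumes S: "bounded S" "S \<in> lmeasurable" and f: "continuous_on UNIV f"
  shows "f \<in> L2 S"
proof -
  have m: "S \<in> sets lebesgue" using S by auto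
  have "integrable (lebesgue_on S) (\<lambda>x. 1)"
    using finite_measure.integrable_const[OF finite_measure_lebesgue_on[OF S(2)]] .
  from integrable_continuous_times[OF S(1) m f integrable_continuous_times[OF S(1) m f this]]
  have "integrable (lebesgue_on S) (\<lambda>x. (f x)\<^sup>2)" by (simp add: power2_eq_square)
  then show ?thesis
    using continuous_borel_measurable_lebesgue_on[OF f m] by (simp add: L2_def)
qed

lemma test_function_continuous:
  assumes "\<psi> \<in> test_functions S"
  shows "continuous_on UNIV \<psi>" "b \<in> Basis \<Longrightarrow> continuous_on UNIV (\<lambda>x. frechet_derivative \<psi> (at x) b)"
proof -
  have "Ck 0 \<psi>" "Ck (Suc 0) \<psi>" using assms by (auto simp: test_functions_def)
  then show "continuous_on UNIV \<psi>" "b \<in> Basis \<Longrightarrow> continuous_on UNIV (\<lambda>x. frechet_derivative \<psi> (at x) b)"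
    by auto
qed

section \<open>Weak gradients on a bounded domain\<close>

locale bounded_domain =
  fixes \<Omega> :: "'a::euclidean_space set"
  assumes open_domain: "open \<Omega>" and bounded_domain: "bounded \<Omega>"
begin

lemma lmeasurable_domain: "\<Omega> \<in> lmeasurable"
  using open_domain bounded_domain by (simp add: lmeasurable_open)

lemma lebesgue_domain: "\<Omega> \<in> sets lebesgue"
  using lmeasurable_domain by auto

sublocale M: finite_measure "lebesgue_on \<Omega>"
  by (rule finite_measure_lebesgue_on[OF lmeasurable_domain])

sublocale L2: semi_hilbert "L2 \<Omega>" "L2_norm \<Omega>" "L2_inner \<Omega>"
  by (rule semi_hilbert_L2[OF lmeasurable_domain])

lemma integrable_L2: "u \<in> L2 \<Omega> \<Longrightarrow> integrable (lebesgue_on \<Omega>) u"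
  using M.L2_fun_integrable_norm(2) by (simp add: L2_eq)

lemma integrable_test:
  assumes "u \<in> L2 \<Omega>" "continuous_on UNIV \<psi>"
  shows "integrable (lebesgue_on \<Omega>) (\<lambda>x. u x * \<psi> x)"
  using integrable_continuous_times[OF bounded_domain lebesgue_domain assms(2) integrable_L2[OF assms(1)]]
  by (simp add: mult.commute)

lemma L2_field_component: "g \<in> L2_field \<Omega> \<Longrightarrow> (\<lambda>x. g x \<bullet> b) \<in> L2 \<Omega>"
  using L2_fun_component by (simp add: L2_field_eq L2_eq)

text \<open>Each component of the difference is integrable on the bounded domain and orthogonal to
  all test functions, so the fundamental lemma applies.\<close>

lemma weak_gradient_unique:
  assumes g: "g \<in> L2_field \<Omega>" "has_weak_gradient \<Omega> u g" and h: "h \<in> L2_field \<Omega>" "has_weak_gradient \<Omega> u h"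
  shows "AE x in lebesgue_on \<Omega>. g x = h x"
proof -
  have "AE x in lebesgue_on \<Omega>. g x \<bullet> b - h x \<bullet> b = 0" if b: "b \<in> Basis" for b
  proof (rule fundamental_lemma[OF open_domain])
    note c = L2_field_component[OF g(1)] L2_field_component[OF h(1)]
    show "integrable (lebesgue_on \<Omega>) (\<lambda>x. g x \<bullet> b - h x \<bullet> b)"
      using c integrable_L2 by (intro Bochner_Integration.integrable_diff) auto
    fix \<psi> assume \<psi>: "\<psi> \<in> test_functions \<Omega>"
    note i = c[THEN integrable_test, OF test_function_continuous(1)[OF \<psi>]]
    have "(LINT x|lebesgue_on \<Omega>. (g x \<bullet> b) * \<psi> x) = (LINT x|lebesgue_on \<Omega>. (h x \<bullet> b) * \<psi> x)"
      using bspec[OF bspec[OF g(2)[unfolded has_weak_gradient_def] \<psi>] b]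
        bspec[OF bspec[OF h(2)[unfolded has_weak_gradient_def] \<psi>] b] by simp
    then show "(LINT x|lebesgue_on \<Omega>. \<psi> x * (g x \<bullet> b - h x \<bullet> b)) = 0"
      using i by (simp add: right_diff_distrib mult.commute)
  qed
  then have "AE x in lebesgue_on \<Omega>. \<forall>b\<in>Basis. g x \<bullet> b - h x \<bullet> b = 0"
    by (subst AE_ball_countable) (auto simp: countable_finite)
  then show ?thesis by eventually_elim (auto intro: euclidean_eqI)
qed

lemma weak_gradient_add:
  assumes u: "u \<in> L2 \<Omega>" "v \<in> L2 \<Omega>" and g: "g \<in> L2_field \<Omega>" "has_weak_gradient \<Omega> u g"
    and h: "h \<in> L2_field \<Omega>" "has_weak_gradient \<Omega> v h"
  shows "has_weak_gradient \<Omega> (u + v) (\<lambda>x. g x + h x)"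
  unfolding has_weak_gradient_def
proof (intro ballI)
  fix \<psi> and b :: 'a assume \<psi>: "\<psi> \<in> test_functions \<Omega>" and b: "b \<in> Basis"
  note i = u[THEN integrable_test, OF test_function_continuous(2)[OF \<psi> b]]
    integrable_test[OF L2_field_component[OF g(1)] test_function_continuous(1)[OF \<psi>]]
    integrable_test[OF L2_field_component[OF h(1)] test_function_continuous(1)[OF \<psi>]]
  show "(LINT x|lebesgue_on \<Omega>. (u + v) x * frechet_derivative \<psi> (at x) b) =
      - (LINT x|lebesgue_on \<Omega>. ((g x + h x) \<bullet> b) * \<psi> x)"
    using i g(2) h(2) \<psi> b by (simp add: has_weak_gradient_def inner_add_left distrib_right plus_fun_def)
qed

lemma weak_gradient_scaleR:
  assumes "has_weak_gradient \<Omega> u g"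
  shows "has_weak_gradient \<Omega> (c *\<^sub>R u) (\<lambda>x. c *\<^sub>R g x)"
  using assms by (simp add: has_weak_gradient_def scaleR_fun_def mult.assoc)

lemma grad:
  assumes "u \<in> H1 \<Omega>"
  shows "grad \<Omega> u \<in> L2_field \<Omega>" "has_weak_gradient \<Omega> u (grad \<Omega> u)"
proof -
  have "\<exists>g. g \<in> L2_field \<Omega> \<and> has_weak_gradient \<Omega> u g" using assms by (auto simp: H1_def)
  from someI_ex[OF this] show "grad \<Omega> u \<in> L2_field \<Omega>" "has_weak_gradient \<Omega> u (grad \<Omega> u)"
    by (auto simp: grad_def)
qed

lemma H1_subset_L2: "u \<in> H1 \<Omega> \<Longrightarrow> u \<in> L2 \<Omega>"
  by (simp add: H1_def)

text \<open>\<open>grad\<close> is a choice and is computed by exhibiting some weak gradient. Its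
  linearity follows from this, almost everywhere only.\<close>

lemma grad_eqI:
  assumes "u \<in> L2 \<Omega>" "g \<in> L2_field \<Omega>" "has_weak_gradient \<Omega> u g"
  shows "u \<in> H1 \<Omega>" "AE x in lebesgue_on \<Omega>. grad \<Omega> u x = g x"
proof -
  show u: "u \<in> H1 \<Omega>" using assms by (auto simp: H1_def)
  show "AE x in lebesgue_on \<Omega>. grad \<Omega> u x = g x"
    by (rule weak_gradient_unique[OF grad[OF u] assms(2,3)])
qed

lemma H1_add:
  assumes u: "u \<in> H1 \<Omega>" and v: "v \<in> H1 \<Omega>"
  shows "u + v \<in> H1 \<Omega>" "AE x in lebesgue_on \<Omega>. grad \<Omega> (u + v) x = grad \<Omega> u x + grad \<Omega> v x"
proof -
  note 1 = L2.add_in[OF H1_subset_L2[OF u] H1_subset_L2[OF v]]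
  have 2: "(\<lambda>x. grad \<Omega> u x + grad \<Omega> v x) \<in> L2_field \<Omega>"
    using grad(1)[OF u] grad(1)[OF v] L2_fun_add by (simp add: L2_field_eq)
  note 3 = weak_gradient_add[OF H1_subset_L2[OF u] H1_subset_L2[OF v] grad[OF u] grad[OF v]]
  show "u + v \<in> H1 \<Omega>" "AE x in lebesgue_on \<Omega>. grad \<Omega> (u + v) x = grad \<Omega> u x + grad \<Omega> v x"
    by (rule grad_eqI[OF 1 2 3])+
qed

lemma H1_scaleR:
  assumes u: "u \<in> H1 \<Omega>"
  shows "c *\<^sub>R u \<in> H1 \<Omega>" "AE x in lebesgue_on \<Omega>. grad \<Omega> (c *\<^sub>R u) x = c *\<^sub>R grad \<Omega> u x"
proof -
  have 2: "(\<lambda>x. c *\<^sub>R grad \<Omega> u x) \<in> L2_field \<Omega>"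
    using grad(1)[OF u] L2_fun_scaleR by (simp add: L2_field_eq)
  show "c *\<^sub>R u \<in> H1 \<Omega>" "AE x in lebesgue_on \<Omega>. grad \<Omega> (c *\<^sub>R u) x = c *\<^sub>R grad \<Omega> u x"
    by (rule grad_eqI[OF L2.scaleR_in[OF H1_subset_L2[OF u]] 2 weak_gradient_scaleR[OF grad(2)[OF u]]])+
qed

lemma grad_measurable: "u \<in> H1 \<Omega> \<Longrightarrow> grad \<Omega> u \<in> borel_measurable (lebesgue_on \<Omega>)"
  using grad(1) by (simp add: L2_field_def)

lemma integrable_grad_inner:
  "u \<in> H1 \<Omega> \<Longrightarrow> v \<in> H1 \<Omega> \<Longrightarrow> integrable (lebesgue_on \<Omega>) (\<lambda>x. grad \<Omega> u x \<bullet> grad \<Omega> v x)"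
  by (rule L2_fun_inner[OF grad(1)[unfolded L2_field_eq] grad(1)[unfolded L2_field_eq]])

lemma grad_inner_add_left:
  assumes u: "u \<in> H1 \<Omega>" and v: "v \<in> H1 \<Omega>" and w: "w \<in> H1 \<Omega>"
  shows "grad_inner \<Omega> (u + v) w = grad_inner \<Omega> u w + grad_inner \<Omega> v w"
proof -
  have "grad_inner \<Omega> (u + v) w = (LINT x|lebesgue_on \<Omega>. grad \<Omega> u x \<bullet> grad \<Omega> w x + grad \<Omega> v x \<bullet> grad \<Omega> w x)"
    unfolding grad_inner_def
  proof (rule integral_cong_AE)
    show "AE x in lebesgue_on \<Omega>. grad \<Omega> (u + v) x \<bullet> grad \<Omega> w x
        = grad \<Omega> u x \<bullet> grad \<Omega> w x + grad \<Omega> v x \<bullet> grad \<Omega> w x"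
      using H1_add(2)[OF u v] by eventually_elim (simp add: inner_add_left)
  qed (use grad_measurable u v w H1_add(1)[OF u v] in \<open>auto intro!: borel_measurable_add borel_measurable_inner\<close>)
  then show ?thesis using integrable_grad_inner[OF u w] integrable_grad_inner[OF v w] by (simp add: grad_inner_def)
qed

lemma grad_inner_scaleR_left:
  assumes u: "u \<in> H1 \<Omega>" and w: "w \<in> H1 \<Omega>"
  shows "grad_inner \<Omega> (c *\<^sub>R u) w = c * grad_inner \<Omega> u w"
proof -
  have "grad_inner \<Omega> (c *\<^sub>R u) w = (LINT x|lebesgue_on \<Omega>. c * (grad \<Omega> u x \<bullet> grad \<Omega> w x))"
    unfolding grad_inner_def
  proof (rule integral_cong_AE)
    show "AE x in lebesgue_on \<Omega>. grad \<Omega> (c *\<^sub>R u) x \<bullet> grad \<Omega> w x = c * (grad \<Omega> u x \<bullet> grad \<Omega> w x)"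
      using H1_scaleR(2)[OF u, of c] by eventually_elim simp
  qed (use grad_measurable u w H1_scaleR(1)[OF u] in \<open>auto intro!: borel_measurable_times borel_measurable_inner\<close>)
  then show ?thesis by (simp add: grad_inner_def)
qed

lemma grad_norm_power2: "(grad_norm \<Omega> u)\<^sup>2 = grad_inner \<Omega> u u"
  by (simp add: grad_norm_def grad_inner_def power2_norm_eq_inner)

lemma grad_inner_nonneg: "0 \<le> grad_inner \<Omega> u u"
  by (simp add: grad_inner_def)

text \<open>The weak gradient is a closed operator: both sides of its defining identity are
  \<open>L2\<close> inner products with fixed functions and so pass to the limit.\<close>

lemma weak_gradient_limit:
  assumes s: "\<And>n. s n \<in> H1 \<Omega>" and u: "u \<in> L2 \<Omega>" "(\<lambda>n::nat. L2_norm \<Omega> (s n - u)) \<longlonglongrightarrow> 0"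
    and g: "g \<in> L2_field \<Omega>" "(\<lambda>n. LINT x|lebesgue_on \<Omega>. (norm (grad \<Omega> (s n) x - g x))\<^sup>2) \<longlonglongrightarrow> 0"
  shows "has_weak_gradient \<Omega> u g"
  unfolding has_weak_gradient_def
proof (intro ballI)
  fix \<psi> and b :: 'a assume \<psi>: "\<psi> \<in> test_functions \<Omega>" and b: "b \<in> Basis"
  note L = continuous_L2[OF bounded_domain lmeasurable_domain]
  note c = L[OF test_function_continuous(1)[OF \<psi>]] L[OF test_function_continuous(2)[OF \<psi> b]]
  let ?G = "\<lambda>n x. grad \<Omega> (s n) x \<bullet> b" and ?g = "\<lambda>x. g x \<bullet> b"
  have G: "?G n \<in> L2 \<Omega>" for n by (rule L2_field_component[OF grad(1)[OF s]])
  have lim1: "(\<lambda>n. L2_inner \<Omega> (s n) (\<lambda>x. frechet_derivative \<psi> (at x) b))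
      \<longlonglongrightarrow> L2_inner \<Omega> u (\<lambda>x. frechet_derivative \<psi> (at x) b)"
    by (rule L2.ip_tendsto[OF u(1) H1_subset_L2[OF s] c(2) u(2)])
  have "(\<lambda>n. L2_norm \<Omega> (?G n - ?g)) \<longlonglongrightarrow> 0"
  proof (rule tendsto_zero_squeeze)
    show "(\<lambda>n. sqrt (LINT x|lebesgue_on \<Omega>. (norm (grad \<Omega> (s n) x - g x))\<^sup>2)) \<longlonglongrightarrow> 0"
      using tendsto_real_sqrt[OF g(2)] by simp
    show "0 \<le> L2_norm \<Omega> (?G n - ?g)" for n by (simp add: L2_norm_def)
    show "L2_norm \<Omega> (?G n - ?g) \<le> sqrt (LINT x|lebesgue_on \<Omega>. (norm (grad \<Omega> (s n) x - g x))\<^sup>2)" for n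
      unfolding L2_norm_def
    proof (rule real_sqrt_le_mono, rule integral_mono)
      have "?G n - ?g \<in> L2 \<Omega>" by (intro L2.diff_in G L2_field_component g)
      then show "integrable (lebesgue_on \<Omega>) (\<lambda>x. ((?G n - ?g) x)\<^sup>2)" by (simp add: L2_def)
      show "integrable (lebesgue_on \<Omega>) (\<lambda>x. (norm (grad \<Omega> (s n) x - g x))\<^sup>2)"
        by (rule L2_funD(2)[OF L2_fun_diff[OF grad(1)[OF s, unfolded L2_field_eq] g(1)[unfolded L2_field_eq]]])
      show "((?G n - ?g) x)\<^sup>2 \<le> (norm (grad \<Omega> (s n) x - g x))\<^sup>2" for x
      proof -
        have "\<bar>(grad \<Omega> (s n) x - g x) \<bullet> b\<bar> \<le> norm (grad \<Omega> (s n) x - g x)"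
          using Basis_le_norm[OF b] .
        then have "((grad \<Omega> (s n) x - g x) \<bullet> b)\<^sup>2 \<le> (norm (grad \<Omega> (s n) x - g x))\<^sup>2"
          using power_mono[of "\<bar>(grad \<Omega> (s n) x - g x) \<bullet> b\<bar>" _ 2] by simp
        then show ?thesis by (simp add: inner_diff_left)
      qed
    qed
  qed
  then have lim2: "(\<lambda>n. L2_inner \<Omega> (?G n) \<psi>) \<longlonglongrightarrow> L2_inner \<Omega> ?g \<psi>"
    by (rule L2.ip_tendsto[OF L2_field_component[OF g(1)] G c(1)])
  have "L2_inner \<Omega> (s n) (\<lambda>x. frechet_derivative \<psi> (at x) b) = - L2_inner \<Omega> (?G n) \<psi>" for n
    using grad(2)[OF s[of n]] \<psi> b by (simp add: L2_inner_def has_weak_gradient_def)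
  then have "(\<lambda>n. L2_inner \<Omega> (s n) (\<lambda>x. frechet_derivative \<psi> (at x) b)) \<longlonglongrightarrow> - L2_inner \<Omega> ?g \<psi>"
    using tendsto_minus[OF lim2] by simp
  from LIMSEQ_unique[OF lim1 this]
  show "(LINT x|lebesgue_on \<Omega>. u x * frechet_derivative \<psi> (at x) b) = - (LINT x|lebesgue_on \<Omega>. (g x \<bullet> b) * \<psi> x)"
    by (simp add: L2_inner_def)
qed

lemma H1_minus: "u \<in> H1 \<Omega> \<Longrightarrow> v \<in> H1 \<Omega> \<Longrightarrow> u - v \<in> H1 \<Omega>"
  using H1_add(1)[of u "(-1) *\<^sub>R v"] H1_scaleR(1)[of v "-1"] by simp

lemma grad_minus:
  assumes u: "u \<in> H1 \<Omega>" and v: "v \<in> H1 \<Omega>"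
  shows "AE x in lebesgue_on \<Omega>. grad \<Omega> (u - v) x = grad \<Omega> u x - grad \<Omega> v x"
proof -
  have "AE x in lebesgue_on \<Omega>. grad \<Omega> (u + (-1) *\<^sub>R v) x = grad \<Omega> u x + grad \<Omega> ((-1) *\<^sub>R v) x"
    by (rule H1_add(2)[OF u H1_scaleR(1)[OF v]])
  with H1_scaleR(2)[OF v, of "-1"] show ?thesis
    by eventually_elim simp
qed

text \<open>The weak form of \<open>- \<alpha> \<Delta> + \<beta>\<close>; for
  \<open>\<alpha> = \<beta> = 1\<close> it is the inner product of \<open>H1\<close>.\<close>

definition elliptic_form :: "real \<Rightarrow> real \<Rightarrow> ('a \<Rightarrow> real) \<Rightarrow> ('a \<Rightarrow> real) \<Rightarrow> real"
  where "elliptic_form \<alpha> \<beta> u v = \<alpha> * grad_inner \<Omega> u v + \<beta> * L2_inner \<Omega> u v"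

definition elliptic_norm :: "real \<Rightarrow> real \<Rightarrow> ('a \<Rightarrow> real) \<Rightarrow> real"
  where "elliptic_norm \<alpha> \<beta> u = sqrt (elliptic_form \<alpha> \<beta> u u)"

text \<open>Completeness is the point. The form controls functions and gradients in
  \<open>L2\<close>, so both are Cauchy separately; their limits belong together by
  \<open>weak_gradient_limit\<close>, and the chosen gradient of the limit agrees with the limit
  field almost everywhere.\<close>

lemma semi_hilbert_H1:
  assumes \<alpha>: "\<alpha> > 0" and \<beta>: "\<beta> > 0"
  shows "semi_hilbert (H1 \<Omega>) (elliptic_norm \<alpha> \<beta>) (elliptic_form \<alpha> \<beta>)"
proof
  show "0 \<in> H1 \<Omega>"
  proof (rule grad_eqI(1)[OF L2.zero_in])
    show "(\<lambda>x. 0) \<in> L2_field \<Omega>" by (simp add: L2_field_eq L2_fun_zero)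
    show "has_weak_gradient \<Omega> 0 (\<lambda>x. 0)" by (simp add: has_weak_gradient_def zero_fun_def)
  qed
  show "u + v \<in> H1 \<Omega>" if "u \<in> H1 \<Omega>" "v \<in> H1 \<Omega>" for u v using that by (rule H1_add(1))
  show "c *\<^sub>R u \<in> H1 \<Omega>" if "u \<in> H1 \<Omega>" for c u using that by (rule H1_scaleR(1))
  show "elliptic_form \<alpha> \<beta> u v = elliptic_form \<alpha> \<beta> v u" for u v
    by (simp add: elliptic_form_def grad_inner_def L2_inner_def inner_commute mult.commute)
  show "elliptic_form \<alpha> \<beta> (u + v) w = elliptic_form \<alpha> \<beta> u w + elliptic_form \<alpha> \<beta> v w"
    if "u \<in> H1 \<Omega>" "v \<in> H1 \<Omega>" "w \<in> H1 \<Omega>" for u v w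
    using that by (simp add: elliptic_form_def grad_inner_add_left L2.ip_add_left H1_subset_L2 distrib_left)
  show "elliptic_form \<alpha> \<beta> (c *\<^sub>R u) w = c * elliptic_form \<alpha> \<beta> u w" if "u \<in> H1 \<Omega>" "w \<in> H1 \<Omega>" for c u w
    using that by (simp add: elliptic_form_def grad_inner_scaleR_left L2.ip_scaleR_left H1_subset_L2 distrib_left)
  show "0 \<le> elliptic_form \<alpha> \<beta> u u" if "u \<in> H1 \<Omega>" for u
    using that \<alpha> \<beta> by (simp add: elliptic_form_def grad_inner_nonneg L2.ip_nonneg H1_subset_L2)
  show "elliptic_norm \<alpha> \<beta> u = sqrt (elliptic_form \<alpha> \<beta> u u)" for u by (simp add: elliptic_norm_def)
  fix s :: "nat \<Rightarrow> 'a \<Rightarrow> real"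
  assume s: "\<And>n. s n \<in> H1 \<Omega>"
    and c: "\<And>e. e > 0 \<Longrightarrow> \<exists>K. \<forall>m\<ge>K. \<forall>n\<ge>K. elliptic_norm \<alpha> \<beta> (s m - s n) < e"
  let ?D = "\<lambda>m n. LINT x|lebesgue_on \<Omega>. (norm (grad \<Omega> (s m) x - grad \<Omega> (s n) x))\<^sup>2"
  have gd: "grad_inner \<Omega> (u - v) (u - v) = (LINT x|lebesgue_on \<Omega>. (norm (grad \<Omega> u x - grad \<Omega> v x))\<^sup>2)"
    if u: "u \<in> H1 \<Omega>" and v: "v \<in> H1 \<Omega>" for u v
    unfolding grad_inner_def
  proof (rule integral_cong_AE)
    show "AE x in lebesgue_on \<Omega>. grad \<Omega> (u - v) x \<bullet> grad \<Omega> (u - v) x = (norm (grad \<Omega> u x - grad \<Omega> v x))\<^sup>2"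
      using grad_minus[OF u v] by eventually_elim (simp add: power2_norm_eq_inner)
  qed (use grad_measurable u v H1_minus[OF u v] in
      \<open>auto intro!: borel_measurable_inner borel_measurable_power borel_measurable_norm borel_measurable_diff\<close>)
  have sq: "elliptic_form \<alpha> \<beta> (s m - s n) (s m - s n) = \<alpha> * ?D m n + \<beta> * (L2_norm \<Omega> (s m - s n))\<^sup>2" for m n
    using L2.N_power2[OF H1_subset_L2[OF H1_minus[OF s s]], of m n] gd[OF s s, of m n]
    by (simp add: elliptic_form_def)
  have cauchy: "\<exists>K. \<forall>m\<ge>K. \<forall>n\<ge>K. ?D m n < e \<and> (L2_norm \<Omega> (s m - s n))\<^sup>2 < e" if e: "e > 0" for e
  proof -
    \<comment> \<open>The smaller coefficient makes \<open>d\<close> at most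
      \<open>\<alpha> * e\<close> and \<open>\<beta> * e\<close>, so a bound by \<open>d\<close> on
      the sum bounds each nonnegative summand.\<close>
    define d where "d = min \<alpha> \<beta> * e"
    have d: "d > 0" using \<alpha> \<beta> e by (simp add: d_def)
    obtain K where K: "\<And>m n. m \<ge> K \<Longrightarrow> n \<ge> K \<Longrightarrow> elliptic_norm \<alpha> \<beta> (s m - s n) < sqrt d"
      using c[of "sqrt d"] d by auto
    have "?D m n < e \<and> (L2_norm \<Omega> (s m - s n))\<^sup>2 < e" if mn: "m \<ge> K" "n \<ge> K" for m n
    proof -
      have lt: "\<alpha> * ?D m n + \<beta> * (L2_norm \<Omega> (s m - s n))\<^sup>2 < d"
        using K[OF mn] sq[of m n] by (simp add: elliptic_norm_def)
      have "0 \<le> ?D m n" by simp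
      then have nn: "0 \<le> \<alpha> * ?D m n" "0 \<le> \<beta> * (L2_norm \<Omega> (s m - s n))\<^sup>2" using \<alpha> \<beta> by auto
      have "d \<le> \<alpha> * e" "d \<le> \<beta> * e" unfolding d_def using e by (auto intro: mult_right_mono)
      then have "\<alpha> * ?D m n < \<alpha> * e" "\<beta> * (L2_norm \<Omega> (s m - s n))\<^sup>2 < \<beta> * e" using lt nn by linarith+
      then show ?thesis using \<alpha> \<beta> by simp
    qed
    then show ?thesis by blast
  qed
  have "\<exists>u\<in>L2 \<Omega>. (\<lambda>n. L2_norm \<Omega> (s n - u)) \<longlonglongrightarrow> 0"
  proof (rule L2.complete[OF H1_subset_L2[OF s]])
    fix e :: real assume e: "e > 0"
    obtain K where K: "\<And>m n. m \<ge> K \<Longrightarrow> n \<ge> K \<Longrightarrow> (L2_norm \<Omega> (s m - s n))\<^sup>2 < e\<^sup>2"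
      using cauchy[of "e\<^sup>2"] e by auto
    then have "L2_norm \<Omega> (s m - s n) < e" if "m \<ge> K" "n \<ge> K" for m n
      using power2_less_imp_less[OF K[OF that]] e by simp
    then show "\<exists>K. \<forall>m\<ge>K. \<forall>n\<ge>K. L2_norm \<Omega> (s m - s n) < e" by blast
  qed
  then obtain u where u: "u \<in> L2 \<Omega>" "(\<lambda>n. L2_norm \<Omega> (s n - u)) \<longlonglongrightarrow> 0" by blast
  have "\<exists>g\<in>L2_fun (lebesgue_on \<Omega>). (\<lambda>n. LINT x|lebesgue_on \<Omega>. (norm (grad \<Omega> (s n) x - g x))\<^sup>2) \<longlonglongrightarrow> 0"
  proof (rule M.L2_fun_complete)
    show "grad \<Omega> (s n) \<in> L2_fun (lebesgue_on \<Omega>)" for n using grad(1)[OF s] by (simp add: L2_field_eq)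
  qed (use cauchy in blast)
  then obtain g where g: "g \<in> L2_field \<Omega>" "(\<lambda>n. LINT x|lebesgue_on \<Omega>. (norm (grad \<Omega> (s n) x - g x))\<^sup>2) \<longlonglongrightarrow> 0"
    by (auto simp: L2_field_eq)
  note h = grad_eqI[OF u(1) g(1) weak_gradient_limit[OF s u g]]
  have "(LINT x|lebesgue_on \<Omega>. (norm (grad \<Omega> (s n) x - g x))\<^sup>2)
      = (LINT x|lebesgue_on \<Omega>. (norm (grad \<Omega> (s n) x - grad \<Omega> u x))\<^sup>2)" for n
  proof (rule integral_cong_AE)
    show "AE x in lebesgue_on \<Omega>. (norm (grad \<Omega> (s n) x - g x))\<^sup>2 = (norm (grad \<Omega> (s n) x - grad \<Omega> u x))\<^sup>2"
      using h(2) by eventually_elim simp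
  qed (use grad_measurable s h(1) g(1) in
      \<open>auto simp: L2_field_def intro!: borel_measurable_power borel_measurable_norm borel_measurable_diff\<close>)
  then have "(\<lambda>n. grad_inner \<Omega> (s n - u) (s n - u)) \<longlonglongrightarrow> 0"
    using g(2) gd[OF s h(1)] by simp
  moreover have "(\<lambda>n. L2_inner \<Omega> (s n - u) (s n - u)) \<longlonglongrightarrow> 0"
    using tendsto_power[OF u(2), of 2] L2.N_power2[OF L2.diff_in[OF H1_subset_L2[OF s] u(1)]] by simp
  ultimately have "(\<lambda>n. elliptic_form \<alpha> \<beta> (s n - u) (s n - u)) \<longlonglongrightarrow> \<alpha> * 0 + \<beta> * 0"
    unfolding elliptic_form_def by (intro tendsto_intros)
  then have "(\<lambda>n. elliptic_norm \<alpha> \<beta> (s n - u)) \<longlonglongrightarrow> sqrt (\<alpha> * 0 + \<beta> * 0)"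
    unfolding elliptic_norm_def by (rule tendsto_real_sqrt)
  then show "\<exists>u\<in>H1 \<Omega>. (\<lambda>n. elliptic_norm \<alpha> \<beta> (s n - u)) \<longlonglongrightarrow> 0" using h(1) by auto
qed

end

section \<open>The elliptic equation and the rate equation\<close>

lemma dual_spaceD:
  assumes "F \<in> dual_space X N" "u \<in> X"
  shows "v \<in> X \<Longrightarrow> F (u + v) = F u + F v" "F (c *\<^sub>R u) = c * F u"
  using assms by (auto simp: dual_space_def bounded_linear_between_def)

section \<open>Bounded functionals and the dual norm\<close>

context seminormed_set
begin

lemma dual_norm_bdd:
  assumes "F \<in> dual_space X N"
  shows "bdd_above ((\<lambda>u. \<bar>F u\<bar>) ` {u \<in> X. N u \<le> 1})"
proof -
  obtain C where C: "\<forall>u\<in>X. \<bar>F u\<bar> \<le> C * N u"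
    using assms by (auto simp: dual_space_def bounded_linear_between_def)
  have "\<bar>F u\<bar> \<le> \<bar>C\<bar>" if "u \<in> X" "N u \<le> 1" for u
  proof -
    have "C * N u \<le> \<bar>C\<bar> * 1" using that N_nonneg by (intro mult_mono) auto
    then show ?thesis using bspec[OF C that(1)] by simp
  qed
  then show ?thesis by (intro bdd_aboveI2) auto
qed

lemma dual_norm_nonneg:
  assumes "F \<in> dual_space X N"
  shows "0 \<le> dual_norm X N F"
  unfolding dual_norm_def operator_norm_def
  by (rule cSUP_upper2[OF dual_norm_bdd[OF assms], of 0]) (auto simp: zero_in N_zero)

text \<open>For positive \<open>N u\<close> by scaling into the unit ball. If \<open>N u = 0\<close>
  there is nothing to scale by, and boundedness itself forces \<open>F u = 0\<close>.\<close>

lemma dual_norm_bound: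
  assumes F: "F \<in> dual_space X N" and u: "u \<in> X"
  shows "\<bar>F u\<bar> \<le> dual_norm X N F * N u"
proof (cases "N u = 0")
  case True
  then show ?thesis using assms by (auto simp: dual_space_def bounded_linear_between_def)
next
  case False
  then have n: "0 < N u" using N_nonneg[OF u] by simp
  have "\<bar>F ((1 / N u) *\<^sub>R u)\<bar> \<le> dual_norm X N F"
    unfolding dual_norm_def operator_norm_def
    by (rule cSUP_upper[OF _ dual_norm_bdd[OF F]]) (use n u in \<open>auto simp: scaleR_in N_scaleR\<close>)
  then show ?thesis using n by (simp add: dual_spaceD(2)[OF F u] abs_mult field_simps)
qed

lemma dual_space_diff:
  assumes F: "F \<in> dual_space X N" and G: "G \<in> dual_space X N"
  shows "F - G \<in> dual_space X N"
proof -
  have "\<bar>(F - G) u\<bar> \<le> (dual_norm X N F + dual_norm X N G) * N u" if "u \<in> X" for u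
    using dual_norm_bound[OF F that] dual_norm_bound[OF G that] by (simp add: distrib_right)
  then show ?thesis
    using dual_spaceD[OF F] dual_spaceD[OF G]
    by (auto simp: dual_space_def bounded_linear_between_def right_diff_distrib)
qed

lemma dual_norm_zero: "dual_norm X N 0 = 0"
proof -
  have "{u \<in> X. N u \<le> 1} \<noteq> {}" using zero_in N_zero by auto
  then show ?thesis by (simp add: dual_norm_def operator_norm_def)
qed

end

context bounded_domain
begin

lemma H1_norm_elliptic: "H1_norm \<Omega> = elliptic_norm 1 1"
proof
  fix u
  have "(L2_norm \<Omega> u)\<^sup>2 = L2_inner \<Omega> u u"
    by (simp add: L2_norm_def L2_inner_def flip: power2_eq_square)
  then show "H1_norm \<Omega> u = elliptic_norm 1 1 u"
    by (simp add: H1_norm_def elliptic_norm_def elliptic_form_def grad_norm_power2 add.commute)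
qed

sublocale H1: semi_hilbert "H1 \<Omega>" "H1_norm \<Omega>" "elliptic_form 1 1"
  unfolding H1_norm_elliptic by (rule semi_hilbert_H1) simp_all

abbreviation "dual \<equiv> dual_space (H1 \<Omega>) (H1_norm \<Omega>)"
abbreviation "dnorm \<equiv> dual_norm (H1 \<Omega>) (H1_norm \<Omega>)"

lemma L2_norm_le_H1_norm: "L2_norm \<Omega> u \<le> H1_norm \<Omega> u"
  by (simp add: H1_norm_def L2_norm_def grad_norm_def real_le_rsqrt)

lemma L2_norm_eq_0_iff:
  assumes "u \<in> L2 \<Omega>"
  shows "L2_norm \<Omega> u = 0 \<longleftrightarrow> (AE x in lebesgue_on \<Omega>. u x = 0)"
proof -
  have "integrable (lebesgue_on \<Omega>) (\<lambda>x. (u x)\<^sup>2)" using assms by (simp add: L2_def)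
  from integral_nonneg_eq_0_iff_AE[OF this] show ?thesis by (simp add: L2_norm_def)
qed

lemma L2_mult_integrable: "u \<in> L2 \<Omega> \<Longrightarrow> v \<in> L2 \<Omega> \<Longrightarrow> integrable (lebesgue_on \<Omega>) (\<lambda>x. u x * v x)"
  using L2_fun_inner[of u _ v] by (simp add: L2_eq)

lemma L2_dominated:
  assumes v: "v \<in> L2 \<Omega>" and u: "u \<in> borel_measurable (lebesgue_on \<Omega>)"
    and le: "\<And>x. x \<in> \<Omega> \<Longrightarrow> \<bar>u x\<bar> \<le> \<bar>v x\<bar>"
  shows "u \<in> L2 \<Omega>" "L2_norm \<Omega> u \<le> L2_norm \<Omega> v"
proof -
  have sq: "(u x)\<^sup>2 \<le> (v x)\<^sup>2" if "x \<in> \<Omega>" for x using le[OF that] by (simp add: abs_le_square_iff)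
  have vi: "integrable (lebesgue_on \<Omega>) (\<lambda>x. (v x)\<^sup>2)" using v by (simp add: L2_def)
  have "u \<in> L2_fun (lebesgue_on \<Omega>)"
    by (rule L2_funI_bounded[OF u vi]) (use sq in simp)
  then show *: "u \<in> L2 \<Omega>" by (simp add: L2_eq)
  show "L2_norm \<Omega> u \<le> L2_norm \<Omega> v"
    unfolding L2_norm_def
    by (rule real_sqrt_le_mono, rule integral_mono) (use vi * sq in \<open>auto simp: L2_def\<close>)
qed

lemma L2_abs: "u \<in> L2 \<Omega> \<Longrightarrow> (\<lambda>x. \<bar>u x\<bar>) \<in> L2 \<Omega>" "L2_norm \<Omega> (\<lambda>x. \<bar>u x\<bar>) = L2_norm \<Omega> u"
  by (auto simp: L2_def L2_norm_def)

lemma L2_Lipschitz_bound: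
  assumes v: "v \<in> L2 \<Omega>" "w \<in> L2 \<Omega>" and ab: "a \<ge> 0" "b \<ge> 0"
    and u: "u \<in> borel_measurable (lebesgue_on \<Omega>)"
    and le: "\<And>x. x \<in> \<Omega> \<Longrightarrow> \<bar>u x\<bar> \<le> a * \<bar>v x\<bar> + b * \<bar>w x\<bar>"
  shows "u \<in> L2 \<Omega>" "L2_norm \<Omega> u \<le> a * L2_norm \<Omega> v + b * L2_norm \<Omega> w"
proof -
  define z where "z = a *\<^sub>R (\<lambda>x. \<bar>v x\<bar>) + b *\<^sub>R (\<lambda>x. \<bar>w x\<bar>)"
  have X: "a *\<^sub>R (\<lambda>x. \<bar>v x\<bar>) \<in> L2 \<Omega>" "b *\<^sub>R (\<lambda>x. \<bar>w x\<bar>) \<in> L2 \<Omega>"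
    using v by (auto intro: L2.scaleR_in L2_abs)
  then have z: "z \<in> L2 \<Omega>" unfolding z_def by (rule L2.add_in)
  have "\<bar>u x\<bar> \<le> \<bar>z x\<bar>" if "x \<in> \<Omega>" for x
    using le[OF that] by (simp add: z_def scaleR_fun_def)
  note d = L2_dominated[OF z u this]
  show "u \<in> L2 \<Omega>" by (rule d(1))
  have "L2_norm \<Omega> z \<le> a * L2_norm \<Omega> v + b * L2_norm \<Omega> w"
    using L2.N_triangle[OF X] v ab by (simp add: z_def L2.N_scaleR L2_abs)
  then show "L2_norm \<Omega> u \<le> a * L2_norm \<Omega> v + b * L2_norm \<Omega> w" using d(2) by simp
qed

section \<open>The elliptic problem for a fixed damage variable\<close>

definition load :: "real \<Rightarrow> ('a \<Rightarrow> real) \<Rightarrow> (('a \<Rightarrow> real) \<Rightarrow> real) \<Rightarrow> ('a \<Rightarrow> real) \<Rightarrow> real"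
  where "load \<beta> q l \<psi> = \<beta> * L2_inner \<Omega> q \<psi> + l \<psi>"

definition solves :: "real \<Rightarrow> real \<Rightarrow> ('a \<Rightarrow> real) \<Rightarrow> (('a \<Rightarrow> real) \<Rightarrow> real) \<Rightarrow> ('a \<Rightarrow> real) \<Rightarrow> bool"
  where "solves \<alpha> \<beta> q l \<phi> \<longleftrightarrow> \<phi> \<in> H1 \<Omega> \<and> (\<forall>\<psi>\<in>H1 \<Omega>. elliptic_form \<alpha> \<beta> \<phi> \<psi> = load \<beta> q l \<psi>)"

text \<open>A choice among solutions that agree up to \<open>H1\<close> seminorm zero; it is
  harmless because \<open>solves_Lipschitz\<close> compares arbitrary solutions.\<close>

definition sol :: "real \<Rightarrow> real \<Rightarrow> ('a \<Rightarrow> real) \<Rightarrow> (('a \<Rightarrow> real) \<Rightarrow> real) \<Rightarrow> 'a \<Rightarrow> real"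
  where "sol \<alpha> \<beta> q l = (SOME \<phi>. solves \<alpha> \<beta> q l \<phi>)"

context
  fixes \<alpha> \<beta> :: real
  assumes \<alpha>: "\<alpha> > 0" and \<beta>: "\<beta> > 0"
begin

interpretation V: semi_hilbert "H1 \<Omega>" "elliptic_norm \<alpha> \<beta>" "elliptic_form \<alpha> \<beta>"
  by (rule semi_hilbert_H1[OF \<alpha> \<beta>])

lemma min_pos: "0 < min \<alpha> \<beta>"
  using \<alpha> \<beta> by simp

lemma elliptic_coercive:
  assumes "u \<in> H1 \<Omega>"
  shows "min \<alpha> \<beta> * (H1_norm \<Omega> u)\<^sup>2 \<le> elliptic_form \<alpha> \<beta> u u"
proof -
  have n: "0 \<le> grad_inner \<Omega> u u" "0 \<le> L2_inner \<Omega> u u"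
    using assms by (auto simp: grad_inner_nonneg L2.ip_nonneg H1_subset_L2)
  have "min \<alpha> \<beta> * (H1_norm \<Omega> u)\<^sup>2 = min \<alpha> \<beta> * grad_inner \<Omega> u u + min \<alpha> \<beta> * L2_inner \<Omega> u u"
    using H1.N_power2[OF assms] by (simp add: elliptic_form_def distrib_left)
  also have "\<dots> \<le> \<alpha> * grad_inner \<Omega> u u + \<beta> * L2_inner \<Omega> u u"
    using n by (intro add_mono mult_right_mono) auto
  finally show ?thesis by (simp add: elliptic_form_def)
qed

lemma load_linear:
  assumes "q \<in> L2 \<Omega>" "l \<in> dual" "u \<in> H1 \<Omega>"
  shows "v \<in> H1 \<Omega> \<Longrightarrow> load \<beta> q l (u + v) = load \<beta> q l u + load \<beta> q l v" "load \<beta> q l (c *\<^sub>R u) = c * load \<beta> q l u"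
  using assms by (auto simp: load_def L2.ip_add_right L2.ip_scaleR_right dual_spaceD H1_subset_L2 distrib_left)

lemma load_bound:
  assumes q: "q \<in> L2 \<Omega>" and l: "l \<in> dual" and u: "u \<in> H1 \<Omega>"
  shows "\<bar>load \<beta> q l u\<bar> \<le> (\<beta> * L2_norm \<Omega> q + dnorm l) * H1_norm \<Omega> u"
proof -
  have "\<bar>load \<beta> q l u\<bar> \<le> \<beta> * \<bar>L2_inner \<Omega> q u\<bar> + \<bar>l u\<bar>"
    using \<beta> by (simp add: load_def abs_mult abs_triangle_ineq[THEN order_trans])
  also have "\<dots> \<le> \<beta> * (L2_norm \<Omega> q * H1_norm \<Omega> u) + dnorm l * H1_norm \<Omega> u"
  proof (intro add_mono mult_left_mono H1.dual_norm_bound[OF l u])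
    have "\<bar>L2_inner \<Omega> q u\<bar> \<le> L2_norm \<Omega> q * L2_norm \<Omega> u"
      by (rule L2.Cauchy_Schwarz[OF q H1_subset_L2[OF u]])
    also have "\<dots> \<le> L2_norm \<Omega> q * H1_norm \<Omega> u"
      by (intro mult_left_mono L2_norm_le_H1_norm L2.N_nonneg q)
    finally show "\<bar>L2_inner \<Omega> q u\<bar> \<le> L2_norm \<Omega> q * H1_norm \<Omega> u" .
  qed (use \<beta> in simp)
  finally show ?thesis by (simp add: algebra_simps)
qed

text \<open>The form is symmetric, so Riesz representation in its own inner product takes the place
  of Lax-Milgram; coercivity turns the \<open>H1\<close> bound of the load into one in the elliptic
  norm.\<close>

lemma solves_exists:
  assumes q: "q \<in> L2 \<Omega>" and l: "l \<in> dual"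
  shows "\<exists>\<phi>. solves \<alpha> \<beta> q l \<phi>"
proof -
  have "\<exists>\<phi>\<in>H1 \<Omega>. \<forall>\<psi>\<in>H1 \<Omega>. elliptic_form \<alpha> \<beta> \<phi> \<psi> = load \<beta> q l \<psi>"
  proof (rule V.Riesz_representation[OF load_linear(1)[OF q l] load_linear(2)[OF q l]])
    fix u assume u: "u \<in> H1 \<Omega>"
    have "sqrt (min \<alpha> \<beta>) * H1_norm \<Omega> u = sqrt (min \<alpha> \<beta> * (H1_norm \<Omega> u)\<^sup>2)"
      using H1.N_nonneg[OF u] by (simp add: real_sqrt_mult)
    also have "\<dots> \<le> elliptic_norm \<alpha> \<beta> u"
      unfolding elliptic_norm_def by (rule real_sqrt_le_mono[OF elliptic_coercive[OF u]])
    finally have le: "H1_norm \<Omega> u \<le> elliptic_norm \<alpha> \<beta> u / sqrt (min \<alpha> \<beta>)"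
      using min_pos by (simp add: field_simps)
    have "\<bar>load \<beta> q l u\<bar> \<le> (\<beta> * L2_norm \<Omega> q + dnorm l) * H1_norm \<Omega> u" by (rule load_bound[OF q l u])
    also have "\<dots> \<le> (\<beta> * L2_norm \<Omega> q + dnorm l) * (elliptic_norm \<alpha> \<beta> u / sqrt (min \<alpha> \<beta>))"
      using \<beta> L2.N_nonneg[OF q] H1.dual_norm_nonneg[OF l] by (intro mult_left_mono le) simp
    finally show "\<bar>load \<beta> q l u\<bar> \<le> ((\<beta> * L2_norm \<Omega> q + dnorm l) / sqrt (min \<alpha> \<beta>)) * elliptic_norm \<alpha> \<beta> u"
      by simp
  qed
  then show ?thesis by (auto simp: solves_def)
qed

text \<open>The two equations are subtracted and tested with the difference of the solutions;
  coercivity on the left and \<open>load_bound\<close> on the right each leave one factor of its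
  norm to cancel. Equal data give uniqueness up to seminorm zero.\<close>

lemma solves_Lipschitz:
  assumes q: "q \<in> L2 \<Omega>" "q' \<in> L2 \<Omega>" and l: "l \<in> dual" "l' \<in> dual"
    and s: "solves \<alpha> \<beta> q l \<phi>" "solves \<alpha> \<beta> q' l' \<phi>'"
  shows "H1_norm \<Omega> (\<phi> - \<phi>') \<le> \<beta> / min \<alpha> \<beta> * L2_norm \<Omega> (q - q') + 1 / min \<alpha> \<beta> * dnorm (l - l')"
proof -
  define d where "d = \<phi> - \<phi>'"
  have H: "\<phi> \<in> H1 \<Omega>" "\<phi>' \<in> H1 \<Omega>" using s by (auto simp: solves_def)
  then have d: "d \<in> H1 \<Omega>" unfolding d_def by (rule H1.diff_in)
  note Q = L2.diff_in[OF q] and L = H1.dual_space_diff[OF l]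
  have "min \<alpha> \<beta> * (H1_norm \<Omega> d)\<^sup>2 \<le> elliptic_form \<alpha> \<beta> d d" by (rule elliptic_coercive[OF d])
  also have "\<dots> = load \<beta> q l d - load \<beta> q' l' d"
    using s d V.ip_diff_left[OF H d] by (simp add: solves_def d_def[symmetric])
  also have "\<dots> = load \<beta> (q - q') (l - l') d"
    using L2.ip_diff_left[OF q H1_subset_L2[OF d]] by (simp add: load_def right_diff_distrib)
  also have "\<dots> \<le> (\<beta> * L2_norm \<Omega> (q - q') + dnorm (l - l')) * H1_norm \<Omega> d"
    using load_bound[OF Q L d] by simp
  finally have le: "min \<alpha> \<beta> * H1_norm \<Omega> d * H1_norm \<Omega> d \<le> (\<beta> * L2_norm \<Omega> (q - q') + dnorm (l - l')) * H1_norm \<Omega> d"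
    by (simp add: power2_eq_square)
  have "min \<alpha> \<beta> * H1_norm \<Omega> d \<le> \<beta> * L2_norm \<Omega> (q - q') + dnorm (l - l')"
  proof (cases "H1_norm \<Omega> d = 0")
    case True
    then show ?thesis using \<beta> L2.N_nonneg[OF Q] H1.dual_norm_nonneg[OF L] by simp
  next
    case False
    then have "0 < H1_norm \<Omega> d" using H1.N_nonneg[OF d] by simp
    then show ?thesis using le by simp
  qed
  then have "H1_norm \<Omega> d \<le> (\<beta> * L2_norm \<Omega> (q - q') + dnorm (l - l')) / min \<alpha> \<beta>"
    using min_pos by (simp only: pos_le_divide_eq mult.commute)
  then show ?thesis by (simp add: d_def add_divide_distrib)
qed

lemma solves_sol: "q \<in> L2 \<Omega> \<Longrightarrow> l \<in> dual \<Longrightarrow> solves \<alpha> \<beta> q l (sol \<alpha> \<beta> q l)"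
  unfolding sol_def by (rule someI_ex[OF solves_exists])

text \<open>The last summand does not depend on \<open>\<phi>\<close>, so minimising the energy is
  the quadratic problem of \<open>minimizer_iff\<close> with the load as functional.\<close>

lemma energy_eq:
  assumes q: "q \<in> L2 \<Omega>" and \<phi>: "\<phi> \<in> H1 \<Omega>"
  shows "energy \<Omega> \<alpha> \<beta> ell t \<phi> q = (elliptic_norm \<alpha> \<beta> \<phi>)\<^sup>2 / 2 - load \<beta> q (ell t) \<phi> + \<beta> / 2 * (L2_norm \<Omega> q)\<^sup>2"
proof -
  have eq: "(L2_norm \<Omega> (\<phi> - q))\<^sup>2 = L2_inner \<Omega> \<phi> \<phi> - 2 * L2_inner \<Omega> q \<phi> + (L2_norm \<Omega> q)\<^sup>2"
    using L2.N_power2_add_scaleR[OF H1_subset_L2[OF \<phi>] q, of "-1"] L2.ip_commute[OF q H1_subset_L2[OF \<phi>]]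
    by (simp add: L2.N_power2[OF H1_subset_L2[OF \<phi>]])
  show ?thesis
    unfolding energy_def load_def grad_norm_power2 eq V.N_power2[OF \<phi>] elliptic_form_def
    by (simp add: field_simps)
qed

lemma is_arg_min_energy_iff:
  assumes q: "q \<in> L2 \<Omega>" and l: "ell t \<in> dual"
  shows "is_arg_min (\<lambda>\<psi>. energy \<Omega> \<alpha> \<beta> ell t \<psi> q) (\<lambda>\<psi>. \<psi> \<in> H1 \<Omega>) \<phi> \<longleftrightarrow> solves \<alpha> \<beta> q (ell t) \<phi>"
proof (cases "\<phi> \<in> H1 \<Omega>")
  case True
  have "is_arg_min (\<lambda>\<psi>. energy \<Omega> \<alpha> \<beta> ell t \<psi> q) (\<lambda>\<psi>. \<psi> \<in> H1 \<Omega>) \<phi>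
      \<longleftrightarrow> (\<forall>\<psi>\<in>H1 \<Omega>. energy \<Omega> \<alpha> \<beta> ell t \<phi> q \<le> energy \<Omega> \<alpha> \<beta> ell t \<psi> q)"
    using True by (auto simp: is_arg_min_def not_less)
  also have "\<dots> \<longleftrightarrow> (\<forall>\<psi>\<in>H1 \<Omega>. (elliptic_norm \<alpha> \<beta> \<phi>)\<^sup>2 / 2 - load \<beta> q (ell t) \<phi>
      \<le> (elliptic_norm \<alpha> \<beta> \<psi>)\<^sup>2 / 2 - load \<beta> q (ell t) \<psi>)"
    using True by (auto simp: energy_eq[OF q])
  also have "\<dots> \<longleftrightarrow> solves \<alpha> \<beta> q (ell t) \<phi>"
    using V.minimizer_iff[OF load_linear(1)[OF q l] load_linear(2)[OF q l] True] True by (simp add: solves_def)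
  finally show ?thesis .
qed (simp add: is_arg_min_def solves_def)

text \<open>The energy is quadratic in the damage variable, so the remainder is exactly
  \<open>\<beta> / 2\<close> times the squared norm of the increment; it is at most \<open>e\<close>
  times the norm once that is below \<open>2 * e / \<beta>\<close>.\<close>

lemma has_L2_gradient_energy:
  assumes \<phi>: "\<phi> \<in> L2 \<Omega>" and q: "q \<in> L2 \<Omega>"
  shows "has_L2_gradient \<Omega> (\<lambda>p. energy \<Omega> \<alpha> \<beta> ell t \<phi> p) q (\<beta> *\<^sub>R (q - \<phi>))"
  unfolding has_L2_gradient_def
proof (intro conjI allI impI)
  show "\<beta> *\<^sub>R (q - \<phi>) \<in> L2 \<Omega>" by (intro L2.scaleR_in L2.diff_in q \<phi>)
  fix e :: real assume e: "e > 0"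
  have "\<bar>energy \<Omega> \<alpha> \<beta> ell t \<phi> (q + \<eta>) - energy \<Omega> \<alpha> \<beta> ell t \<phi> q - L2_inner \<Omega> (\<beta> *\<^sub>R (q - \<phi>)) \<eta>\<bar> \<le> e * L2_norm \<Omega> \<eta>"
    if \<eta>: "\<eta> \<in> L2 \<Omega>" and small: "L2_norm \<Omega> \<eta> < 2 * e / \<beta>" for \<eta>
  proof -
    have "(L2_norm \<Omega> (\<phi> - (q + \<eta>)))\<^sup>2 = (L2_norm \<Omega> (\<phi> - q))\<^sup>2 + 2 * L2_inner \<Omega> (q - \<phi>) \<eta> + (L2_norm \<Omega> \<eta>)\<^sup>2"
      using L2.N_power2_add_scaleR[OF L2.diff_in[OF \<phi> q] \<eta>, of "-1"] L2.ip_minus_left[OF L2.diff_in[OF q \<phi>] \<eta>]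
      by (simp add: algebra_simps)
    then have "energy \<Omega> \<alpha> \<beta> ell t \<phi> (q + \<eta>) - energy \<Omega> \<alpha> \<beta> ell t \<phi> q - L2_inner \<Omega> (\<beta> *\<^sub>R (q - \<phi>)) \<eta>
        = \<beta> / 2 * L2_norm \<Omega> \<eta> * L2_norm \<Omega> \<eta>"
      using L2.ip_scaleR_left[OF L2.diff_in[OF q \<phi>] \<eta>, of \<beta>] by (simp add: energy_def field_simps power2_eq_square)
    moreover have "\<beta> / 2 * L2_norm \<Omega> \<eta> * L2_norm \<Omega> \<eta> \<le> e * L2_norm \<Omega> \<eta>"
      using small \<beta> by (intro mult_right_mono L2.N_nonneg \<eta>) (simp add: field_simps)
    moreover have "0 \<le> \<beta> / 2 * L2_norm \<Omega> \<eta> * L2_norm \<Omega> \<eta>" using \<beta> L2.N_nonneg[OF \<eta>] by simp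
    ultimately show ?thesis by linarith
  qed
  then show "\<exists>d>0. \<forall>\<eta>\<in>L2 \<Omega>. L2_norm \<Omega> \<eta> < d \<longrightarrow>
      \<bar>energy \<Omega> \<alpha> \<beta> ell t \<phi> (q + \<eta>) - energy \<Omega> \<alpha> \<beta> ell t \<phi> q - L2_inner \<Omega> (\<beta> *\<^sub>R (q - \<phi>)) \<eta>\<bar> \<le> e * L2_norm \<Omega> \<eta>"
    using e \<beta> by (intro exI[of _ "2 * e / \<beta>"]) simp
qed

text \<open>Along a small multiple \<open>s\<close> of \<open>\<eta>\<close> both linear terms
  approximate the same increment of \<open>J\<close> up to \<open>e\<close> times its norm; dividing
  by \<open>s\<close> leaves an arbitrarily small bound.\<close>

lemma L2_gradient_unique:
  assumes g: "has_L2_gradient \<Omega> J q g" and h: "has_L2_gradient \<Omega> J q h" and \<eta>: "\<eta> \<in> L2 \<Omega>"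
  shows "L2_inner \<Omega> g \<eta> = L2_inner \<Omega> h \<eta>"
proof -
  have gh: "g \<in> L2 \<Omega>" "h \<in> L2 \<Omega>" using g h by (auto simp: has_L2_gradient_def)
  have le: "\<bar>L2_inner \<Omega> g \<eta> - L2_inner \<Omega> h \<eta>\<bar> \<le> 2 * e * L2_norm \<Omega> \<eta>" if e: "e > 0" for e
  proof -
    obtain d where d: "d > 0" "\<And>\<eta>. \<eta> \<in> L2 \<Omega> \<Longrightarrow> L2_norm \<Omega> \<eta> < d \<Longrightarrow> \<bar>J (q + \<eta>) - J q - L2_inner \<Omega> g \<eta>\<bar> \<le> e * L2_norm \<Omega> \<eta>"
      using g e unfolding has_L2_gradient_def by blast
    obtain d' where d': "d' > 0" "\<And>\<eta>. \<eta> \<in> L2 \<Omega> \<Longrightarrow> L2_norm \<Omega> \<eta> < d' \<Longrightarrow> \<bar>J (q + \<eta>) - J q - L2_inner \<Omega> h \<eta>\<bar> \<le> e * L2_norm \<Omega> \<eta>"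
      using h e unfolding has_L2_gradient_def by blast
    define m where "m = min d d'"
    have m: "m > 0" "m \<le> d" "m \<le> d'" using d(1) d'(1) by (auto simp: m_def)
    \<comment> \<open>The denominator is at least 2, so the scaled \<open>\<eta>\<close> has norm
      below \<open>m\<close> even if \<open>\<eta>\<close> has norm zero.\<close>
    define s where "s = m / (2 * (L2_norm \<Omega> \<eta> + 1))"
    have n: "0 \<le> L2_norm \<Omega> \<eta>" by (rule L2.N_nonneg[OF \<eta>])
    have s: "s > 0" using m n by (simp add: s_def)
    have "L2_norm \<Omega> (s *\<^sub>R \<eta>) = s * L2_norm \<Omega> \<eta>" using s by (simp add: L2.N_scaleR[OF \<eta>])
    also have "\<dots> < m"
    proof -
      have "m * L2_norm \<Omega> \<eta> < m * (2 * (L2_norm \<Omega> \<eta> + 1))"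
        using m n by (intro mult_strict_left_mono) auto
      then show ?thesis using n by (simp add: s_def divide_less_eq)
    qed
    finally have small: "L2_norm \<Omega> (s *\<^sub>R \<eta>) < d" "L2_norm \<Omega> (s *\<^sub>R \<eta>) < d'" using m by auto
    have "\<bar>s * L2_inner \<Omega> g \<eta> - s * L2_inner \<Omega> h \<eta>\<bar> \<le> 2 * (e * (s * L2_norm \<Omega> \<eta>))"
      using d(2)[OF L2.scaleR_in[OF \<eta>] small(1)] d'(2)[OF L2.scaleR_in[OF \<eta>] small(2)]
        L2.ip_scaleR_right[OF \<eta> gh(1), of s] L2.ip_scaleR_right[OF \<eta> gh(2), of s] s
      by (simp add: L2.N_scaleR[OF \<eta>])
    then have "s * \<bar>L2_inner \<Omega> g \<eta> - L2_inner \<Omega> h \<eta>\<bar> \<le> s * (2 * e * L2_norm \<Omega> \<eta>)"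
      using s by (simp add: right_diff_distrib[symmetric] abs_mult mult_ac)
    then show ?thesis using s by simp
  qed
  have "\<bar>L2_inner \<Omega> g \<eta> - L2_inner \<Omega> h \<eta>\<bar> \<le> 0"
  proof (rule field_le_epsilon)
    fix \<delta> :: real assume \<delta>: "\<delta> > 0"
    have n: "0 \<le> L2_norm \<Omega> \<eta>" by (rule L2.N_nonneg[OF \<eta>])
    have "2 * (\<delta> / (2 * (L2_norm \<Omega> \<eta> + 1))) * L2_norm \<Omega> \<eta> = \<delta> * (L2_norm \<Omega> \<eta> / (L2_norm \<Omega> \<eta> + 1))"
      using n by (simp add: field_simps)
    also have "\<dots> \<le> \<delta> * 1" using \<delta> n by (intro mult_left_mono) auto
    finally have "2 * (\<delta> / (2 * (L2_norm \<Omega> \<eta> + 1))) * L2_norm \<Omega> \<eta> \<le> \<delta>" by simp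
    then show "\<bar>L2_inner \<Omega> g \<eta> - L2_inner \<Omega> h \<eta>\<bar> \<le> 0 + \<delta>"
      using le[of "\<delta> / (2 * (L2_norm \<Omega> \<eta> + 1))"] \<delta> n by simp
  qed
  then show ?thesis by simp
qed

text \<open>\<open>energy_dq\<close> is a choice among gradients and is known only through its inner
  products, which are all that the subdifferential inequality sees.\<close>

lemma energy_dq:
  assumes \<phi>: "\<phi> \<in> L2 \<Omega>" and q: "q \<in> L2 \<Omega>"
  shows "energy_dq \<Omega> \<alpha> \<beta> ell t \<phi> q \<in> L2 \<Omega>"
    "\<eta> \<in> L2 \<Omega> \<Longrightarrow> L2_inner \<Omega> (energy_dq \<Omega> \<alpha> \<beta> ell t \<phi> q) \<eta> = L2_inner \<Omega> (\<beta> *\<^sub>R (q - \<phi>)) \<eta>"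
proof -
  note g = has_L2_gradient_energy[OF \<phi> q, of ell t]
  have h: "has_L2_gradient \<Omega> (\<lambda>p. energy \<Omega> \<alpha> \<beta> ell t \<phi> p) q (energy_dq \<Omega> \<alpha> \<beta> ell t \<phi> q)"
    unfolding energy_dq_def by (rule someI[of _ "\<beta> *\<^sub>R (q - \<phi>)"]) (rule g)
  then show "energy_dq \<Omega> \<alpha> \<beta> ell t \<phi> q \<in> L2 \<Omega>" by (simp add: has_L2_gradient_def)
  show "L2_inner \<Omega> (energy_dq \<Omega> \<alpha> \<beta> ell t \<phi> q) \<eta> = L2_inner \<Omega> (\<beta> *\<^sub>R (q - \<phi>)) \<eta>" if "\<eta> \<in> L2 \<Omega>"
    by (rule L2_gradient_unique[OF h g that])
qed

end

section \<open>The dissipation inequality and the rate\<close>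

lemma Nemytskii_L2:
  assumes f: "Lf-lipschitz_on UNIV f" and \<omega>: "\<omega> \<in> L2 \<Omega>"
  shows "f \<circ> \<omega> \<in> L2 \<Omega>"
proof -
  have m: "f \<circ> \<omega> \<in> borel_measurable (lebesgue_on \<Omega>)"
    unfolding comp_def
    using \<omega> borel_measurable_continuous_onI[OF lipschitz_on_continuous_on[OF f]]
    by (intro measurable_compose[of \<omega> _ borel f]) (simp_all add: L2_def)
  \<comment> \<open>The growth bound for \<open>f\<close> contains the constant
    \<open>\<bar>f 0\<bar>\<close>, which is square integrable because the domain is
    bounded.\<close>
  have c: "(\<lambda>x. \<bar>f 0\<bar>) \<in> L2 \<Omega>"
    by (rule continuous_L2[OF bounded_domain lmeasurable_domain]) simp
  show ?thesis
  proof (rule L2_Lipschitz_bound(1)[OF c \<omega> _ _ m, of 1 Lf])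
    fix x
    have "\<bar>f (\<omega> x) - f 0\<bar> \<le> Lf * \<bar>\<omega> x\<bar>"
      using lipschitz_onD[OF f, of "\<omega> x" 0] by (simp add: dist_real_def)
    then show "\<bar>(f \<circ> \<omega>) x\<bar> \<le> 1 * \<bar>\<bar>f 0\<bar>\<bar> + Lf * \<bar>\<omega> x\<bar>" by simp
  qed (use lipschitz_on_nonneg[OF f] in auto)
qed

definition rate :: "real \<Rightarrow> (real \<Rightarrow> real) \<Rightarrow> ('a \<Rightarrow> real) \<Rightarrow> ('a \<Rightarrow> real) \<Rightarrow> 'a \<Rightarrow> real"
  where "rate \<epsilon> f b \<omega> = (\<lambda>x. 1 / \<epsilon> * max (b x - f (\<omega> x)) 0)"

context
  fixes \<epsilon> :: real
  assumes \<epsilon>: "\<epsilon> > 0"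
begin

text \<open>
  The maximum is the projection of \<open>(\<xi> - f \<circ> \<omega>) / \<epsilon>\<close> onto the cone of nonnegative functions; the
  dissipation inequality is the variational characterisation of that projection.
\<close>

lemma dissipation_inequality_iff:
  assumes \<xi>: "\<xi> \<in> L2 \<Omega>" and v: "v \<in> L2 \<Omega>" and k: "f \<circ> \<omega> \<in> L2 \<Omega>"
  shows "dissipation \<Omega> \<epsilon> f \<omega> v < \<infinity> \<and>
      (\<forall>\<eta>\<in>L2 \<Omega>. ereal (L2_inner \<Omega> \<xi> (\<eta> - v)) \<le> dissipation \<Omega> \<epsilon> f \<omega> \<eta> - dissipation \<Omega> \<epsilon> f \<omega> v)
    \<longleftrightarrow> (AE x in lebesgue_on \<Omega>. v x = 1 / \<epsilon> * max (\<xi> x - f (\<omega> x)) 0)" (is "?L \<longleftrightarrow> ?R")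
proof -
  define p where "p = \<xi> - (f \<circ> \<omega>)"
  have p: "p \<in> L2 \<Omega>" unfolding p_def by (rule L2.diff_in[OF \<xi> k])
  define z where "z x = 1 / \<epsilon> * max (p x) 0" for x
  have z: "z \<in> L2 \<Omega>"
  proof (rule L2_dominated(1)[OF L2.scaleR_in[OF p, of "1 / \<epsilon>"]])
    show "z \<in> borel_measurable (lebesgue_on \<Omega>)"
      using p unfolding z_def[abs_def] L2_def by (auto intro!: borel_measurable_times borel_measurable_max)
    show "\<bar>z x\<bar> \<le> \<bar>((1 / \<epsilon>) *\<^sub>R p) x\<bar>" for x
      using \<epsilon> by (simp add: z_def scaleR_fun_def abs_mult divide_right_mono)
  qed
  have z_nn: "0 \<le> z x" for x using \<epsilon> by (simp add: z_def)
  have dis: "dissipation \<Omega> \<epsilon> f \<omega> \<eta> = ereal (L2_inner \<Omega> (f \<circ> \<omega>) \<eta> + \<epsilon> / 2 * (L2_norm \<Omega> \<eta>)\<^sup>2)"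
    if "AE x in lebesgue_on \<Omega>. 0 \<le> \<eta> x" for \<eta>
    using that by (simp add: dissipation_def)
  \<comment> \<open>The residual \<open>p - \<epsilon> z\<close> is the minimum of \<open>p\<close>
    and 0. It is zero where \<open>p\<close> is positive; elsewhere \<open>z\<close> vanishes while
    \<open>\<eta>\<close> is nonnegative, so its product with \<open>\<eta> - z\<close> is at most
    zero almost everywhere.\<close>
  have cone: "L2_inner \<Omega> p (\<eta> - z) \<le> \<epsilon> * L2_inner \<Omega> z (\<eta> - z)"
    if \<eta>: "\<eta> \<in> L2 \<Omega>" and nn: "AE x in lebesgue_on \<Omega>. 0 \<le> \<eta> x" for \<eta>
  proof -
    have "L2_inner \<Omega> p (\<eta> - z) \<le> (LINT x|lebesgue_on \<Omega>. \<epsilon> * (z x * (\<eta> - z) x))"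
      unfolding L2_inner_def
    proof (rule integral_mono_AE)
      show "integrable (lebesgue_on \<Omega>) (\<lambda>x. p x * (\<eta> - z) x)" "integrable (lebesgue_on \<Omega>) (\<lambda>x. \<epsilon> * (z x * (\<eta> - z) x))"
        by (intro integrable_mult_right L2_mult_integrable p z L2.diff_in[OF \<eta> z])+
      show "AE x in lebesgue_on \<Omega>. p x * (\<eta> - z) x \<le> \<epsilon> * (z x * (\<eta> - z) x)"
        using nn
      proof eventually_elim
        case (elim x)
        show ?case
        proof (cases "p x \<le> 0")
          case True
          then have "z x = 0" by (simp add: z_def)
          then show ?thesis using True elim by (simp add: mult_le_0_iff)
        next
          case False
          then have "p x = \<epsilon> * z x" using \<epsilon> by (simp add: z_def)
          then show ?thesis by simp
        qed
      qed
    qed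
    then show ?thesis by (simp add: L2_inner_def)
  qed
  have square: "(L2_norm \<Omega> \<eta>)\<^sup>2 = (L2_norm \<Omega> u)\<^sup>2 + 2 * L2_inner \<Omega> u (\<eta> - u) + (L2_norm \<Omega> (\<eta> - u))\<^sup>2"
    if "\<eta> \<in> L2 \<Omega>" "u \<in> L2 \<Omega>" for \<eta> u
    using L2.N_power2_add_scaleR[OF that(2) L2.diff_in[OF that], of 1] by simp
  have split: "L2_inner \<Omega> \<xi> (\<eta> - u) = L2_inner \<Omega> p (\<eta> - u) + L2_inner \<Omega> (f \<circ> \<omega>) \<eta> - L2_inner \<Omega> (f \<circ> \<omega>) u"
    if "\<eta> \<in> L2 \<Omega>" "u \<in> L2 \<Omega>" for \<eta> u
    using L2.ip_diff_left[OF \<xi> k L2.diff_in[OF that]] L2.ip_diff_right[OF that k] by (simp add: p_def)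
  have R_iff: "?R \<longleftrightarrow> L2_norm \<Omega> (v - z) = 0"
    using L2_norm_eq_0_iff[OF L2.diff_in[OF v z]] by (simp add: z_def p_def)
  show ?thesis
  proof
    assume L: ?L
    then have nn: "AE x in lebesgue_on \<Omega>. 0 \<le> v x" by (auto simp: dissipation_def split: if_splits)
    \<comment> \<open>The competitor is the projection \<open>z\<close> itself.\<close>
    have "ereal (L2_inner \<Omega> \<xi> (z - v)) \<le> dissipation \<Omega> \<epsilon> f \<omega> z - dissipation \<Omega> \<epsilon> f \<omega> v"
      using L z by blast
    then have "L2_inner \<Omega> \<xi> (z - v) \<le> L2_inner \<Omega> (f \<circ> \<omega>) z + \<epsilon> / 2 * (L2_norm \<Omega> z)\<^sup>2
        - (L2_inner \<Omega> (f \<circ> \<omega>) v + \<epsilon> / 2 * (L2_norm \<Omega> v)\<^sup>2)"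
      using dis[OF nn] dis[of z] z_nn by simp
    then have 1: "L2_inner \<Omega> p (z - v) \<le> \<epsilon> / 2 * (L2_norm \<Omega> z)\<^sup>2 - \<epsilon> / 2 * (L2_norm \<Omega> v)\<^sup>2"
      using split[OF z v] by simp
    have 2: "L2_inner \<Omega> p (z - v) = - L2_inner \<Omega> p (v - z)"
      using L2.ip_diff_right[OF z v p] L2.ip_diff_right[OF v z p] by simp
    have 3: "\<epsilon> / 2 * (L2_norm \<Omega> v)\<^sup>2 = \<epsilon> / 2 * (L2_norm \<Omega> z)\<^sup>2 + \<epsilon> * L2_inner \<Omega> z (v - z) + \<epsilon> / 2 * (L2_norm \<Omega> (v - z))\<^sup>2"
      unfolding square[OF v z] by (simp add: field_simps)
    \<comment> \<open>Combining the inequality for the competitor \<open>z\<close> with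
      \<open>cone\<close> at \<open>v\<close> cancels everything but the squared distance of
      \<open>v\<close> and \<open>z\<close>.\<close>
    have "\<epsilon> / 2 * (L2_norm \<Omega> (v - z))\<^sup>2 \<le> 0" using 1 2 3 cone[OF v nn] by linarith
    then have "(L2_norm \<Omega> (v - z))\<^sup>2 \<le> 0" using \<epsilon> by (simp add: mult_le_0_iff)
    then show ?R unfolding R_iff by simp
  next
    assume R: ?R
    then have vz: "L2_norm \<Omega> (v - z) = 0" unfolding R_iff .
    have nn: "AE x in lebesgue_on \<Omega>. 0 \<le> v x"
      using R by eventually_elim (use \<epsilon> in simp)
    have eq: "L2_inner \<Omega> u z = L2_inner \<Omega> u v" if u: "u \<in> L2 \<Omega>" for u
      using L2.Cauchy_Schwarz[OF u L2.diff_in[OF v z]] L2.ip_diff_right[OF v z u] vz by simp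
    have "ereal (L2_inner \<Omega> \<xi> (\<eta> - v)) \<le> dissipation \<Omega> \<epsilon> f \<omega> \<eta> - dissipation \<Omega> \<epsilon> f \<omega> v"
      if \<eta>: "\<eta> \<in> L2 \<Omega>" for \<eta>
    proof (cases "AE x in lebesgue_on \<Omega>. 0 \<le> \<eta> x")
      case True
      have "L2_inner \<Omega> p (\<eta> - v) = L2_inner \<Omega> p (\<eta> - z)"
        using L2.ip_diff_right[OF \<eta> v p] L2.ip_diff_right[OF \<eta> z p] eq[OF p] by simp
      also have "\<dots> \<le> \<epsilon> * L2_inner \<Omega> z (\<eta> - z)" by (rule cone[OF \<eta> True])
      also have "\<dots> \<le> \<epsilon> / 2 * (L2_norm \<Omega> \<eta>)\<^sup>2 - \<epsilon> / 2 * (L2_norm \<Omega> z)\<^sup>2"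
        unfolding square[OF \<eta> z] using \<epsilon> by (simp add: field_simps)
      finally have "L2_inner \<Omega> p (\<eta> - v) \<le> \<epsilon> / 2 * (L2_norm \<Omega> \<eta>)\<^sup>2 - \<epsilon> / 2 * (L2_norm \<Omega> z)\<^sup>2" .
      moreover have "L2_norm \<Omega> z = L2_norm \<Omega> v"
        using L2.abs_N_diff[OF v z] vz by simp
      ultimately show ?thesis using dis[OF nn] dis[OF True] split[OF \<eta> v] by simp
    next
      case False
      then have "dissipation \<Omega> \<epsilon> f \<omega> \<eta> = \<infinity>" by (simp add: dissipation_def)
      then show ?thesis using dis[OF nn] by simp
    qed
    then show ?L using dis[OF nn] by simp
  qed
qed

lemma rate_L2:
  assumes f: "Lf-lipschitz_on UNIV f" and b: "b \<in> L2 \<Omega>" and \<omega>: "\<omega> \<in> L2 \<Omega>"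
  shows "rate \<epsilon> f b \<omega> \<in> L2 \<Omega>"
proof -
  have p: "b - (f \<circ> \<omega>) \<in> L2 \<Omega>" by (rule L2.diff_in[OF b Nemytskii_L2[OF f \<omega>]])
  have pm: "(\<lambda>x. b x - f (\<omega> x)) \<in> borel_measurable (lebesgue_on \<Omega>)"
    using p by (simp add: L2_def fun_diff_def)
  show ?thesis
  proof (rule L2_dominated(1)[OF L2.scaleR_in[OF p, of "1 / \<epsilon>"]])
    show "rate \<epsilon> f b \<omega> \<in> borel_measurable (lebesgue_on \<Omega>)"
      unfolding rate_def using pm by (intro borel_measurable_times borel_measurable_max) auto
    show "\<bar>rate \<epsilon> f b \<omega> x\<bar> \<le> \<bar>((1 / \<epsilon>) *\<^sub>R (b - (f \<circ> \<omega>))) x\<bar>" for x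
      using \<epsilon> by (simp add: rate_def scaleR_fun_def abs_mult divide_right_mono)
  qed
qed

lemma rate_Lipschitz:
  assumes f: "Lf-lipschitz_on UNIV f" and b: "b \<in> L2 \<Omega>" "b' \<in> L2 \<Omega>" and \<omega>: "\<omega> \<in> L2 \<Omega>" "\<omega>' \<in> L2 \<Omega>"
  shows "L2_norm \<Omega> (rate \<epsilon> f b \<omega> - rate \<epsilon> f b' \<omega>')
    \<le> 1 / \<epsilon> * L2_norm \<Omega> (b - b') + Lf / \<epsilon> * L2_norm \<Omega> (\<omega> - \<omega>')"
proof (rule L2_Lipschitz_bound(2)[OF L2.diff_in[OF b] L2.diff_in[OF \<omega>]])
  have "rate \<epsilon> f b \<omega> - rate \<epsilon> f b' \<omega>' \<in> L2 \<Omega>" by (intro L2.diff_in rate_L2[OF f] b \<omega>)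
  then show "rate \<epsilon> f b \<omega> - rate \<epsilon> f b' \<omega>' \<in> borel_measurable (lebesgue_on \<Omega>)" by (simp add: L2_def)
  show "0 \<le> 1 / \<epsilon>" "0 \<le> Lf / \<epsilon>" using \<epsilon> lipschitz_on_nonneg[OF f] by auto
  fix x
  have "\<bar>f (\<omega> x) - f (\<omega>' x)\<bar> \<le> Lf * \<bar>\<omega> x - \<omega>' x\<bar>"
    using lipschitz_onD[OF f, of "\<omega> x" "\<omega>' x"] by (simp add: dist_real_def)
  then have "\<bar>max (b x - f (\<omega> x)) 0 - max (b' x - f (\<omega>' x)) 0\<bar> \<le> \<bar>b x - b' x\<bar> + Lf * \<bar>\<omega> x - \<omega>' x\<bar>"
    by linarith
  then have "1 / \<epsilon> * \<bar>max (b x - f (\<omega> x)) 0 - max (b' x - f (\<omega>' x)) 0\<bar> \<le> 1 / \<epsilon> * (\<bar>b x - b' x\<bar> + Lf * \<bar>\<omega> x - \<omega>' x\<bar>)"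
    using \<epsilon> by (intro mult_left_mono) auto
  then show "\<bar>(rate \<epsilon> f b \<omega> - rate \<epsilon> f b' \<omega>') x\<bar> \<le> 1 / \<epsilon> * \<bar>(b - b') x\<bar> + Lf / \<epsilon> * \<bar>(\<omega> - \<omega>') x\<bar>"
    using \<epsilon> by (simp add: rate_def right_diff_distrib[symmetric] diff_divide_distrib[symmetric] abs_mult distrib_left add_divide_distrib)
qed

end

end

section \<open>The fatigue damage evolution\<close>

text \<open>Comparison with \<open>A 0 0\<close> turns the Lipschitz bound into linear growth, and
  the constant \<open>N (A 0 0)\<close> is square integrable on the bounded time interval. The
  factors 3 come from estimating the square of a sum of three terms.\<close>

lemma (in semi_hilbert) bochner_L2_lipschitz2:
  assumes u: "u \<in> bochner_L2 T Y M" and v: "v \<in> bochner_L2 T Z M'" and zero: "0 \<in> Y" "0 \<in> Z"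
    and A: "\<And>y z. y \<in> Y \<Longrightarrow> z \<in> Z \<Longrightarrow> A y z \<in> X"
    and lip: "\<And>y z y' z'. \<lbrakk>y \<in> Y; z \<in> Z; y' \<in> Y; z' \<in> Z\<rbrakk>
      \<Longrightarrow> N (A y z - A y' z') \<le> C * M (y - y') + D * M' (z - z')"
  shows "(\<lambda>t. A (u t) (v t)) \<in> bochner_L2 T X N"
proof -
  have u': "strongly_measurable T Y M u" "integrable (time T) (\<lambda>t. (M (u t))\<^sup>2)"
    and v': "strongly_measurable T Z M' v" "integrable (time T) (\<lambda>t. (M' (v t))\<^sup>2)"
    using u v by (auto simp: bochner_L2_def)
  have sm: "strongly_measurable T X N (\<lambda>t. A (u t) (v t))"
    by (rule strongly_measurable_lipschitz2[OF u'(1) v'(1) A N_nonneg[OF diff_in] lip])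
  define c where "c = N (A 0 0)"
  let ?h = "\<lambda>t. 3 * c\<^sup>2 + 3 * C\<^sup>2 * (M (u t))\<^sup>2 + 3 * D\<^sup>2 * (M' (v t))\<^sup>2"
  have "integrable (time T) (\<lambda>t. (N (A (u t) (v t)))\<^sup>2)"
  proof (rule Bochner_Integration.integrable_bound)
    show "integrable (time T) ?h"
      by (intro Bochner_Integration.integrable_add integrable_mult_right u' v'
          finite_measure.integrable_const[OF finite_measure_time])
    show "(\<lambda>t. (N (A (u t) (v t)))\<^sup>2) \<in> borel_measurable (time T)"
      by (intro borel_measurable_power borel_measurable_N sm)
    show "AE t in time T. norm ((N (A (u t) (v t)))\<^sup>2) \<le> norm (?h t)"
      using strongly_measurable_in[OF u'(1)] strongly_measurable_in[OF v'(1)]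
    proof eventually_elim
      case (elim t)
      have sq: "(a + b + d)\<^sup>2 \<le> 3 * a\<^sup>2 + 3 * b\<^sup>2 + 3 * d\<^sup>2" for a b d :: real
        using sum_squares_bound[of a b] sum_squares_bound[of a d] sum_squares_bound[of b d]
        by (simp add: power2_eq_square algebra_simps)
      have "N (A (u t) (v t)) \<le> c + C * M (u t) + D * M' (v t)"
        using N_le_add[OF A[OF elim] A[OF zero]] lip[OF elim zero] by (simp add: c_def)
      then have "(N (A (u t) (v t)))\<^sup>2 \<le> (c + C * M (u t) + D * M' (v t))\<^sup>2"
        by (intro power_mono N_nonneg A elim)
      also have "\<dots> \<le> ?h t"
        using sq[of c "C * M (u t)" "D * M' (v t)"] by (simp add: power_mult_distrib mult.assoc)
      finally show ?case by simp
    qed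
  qed
  then show ?thesis using sm by (simp add: bochner_L2_def)
qed

lemma (in seminormed_set) dual_space_zero: "0 \<in> dual_space X N"
  by (auto simp: dual_space_def bounded_linear_between_def intro!: exI[of _ 0])

lemma AE_iff_AE:
  assumes "AE t in M. P t \<longleftrightarrow> Q t"
  shows "(AE t in M. P t) \<longleftrightarrow> (AE t in M. Q t)"
proof
  assume "AE t in M. P t"
  with assms show "AE t in M. Q t" by eventually_elim simp
next
  assume "AE t in M. Q t"
  with assms show "AE t in M. P t" by eventually_elim simp
qed

locale fatigue = bounded_domain \<Omega> for \<Omega> :: "'a::euclidean_space set" +
  fixes T \<alpha> \<beta> \<epsilon> Lf LH :: real
    and H :: "(real \<Rightarrow> 'a \<Rightarrow> real) \<Rightarrow> real \<Rightarrow> 'a \<Rightarrow> real"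
    and f :: "real \<Rightarrow> real"
    and ell :: "real \<Rightarrow> ('a \<Rightarrow> real) \<Rightarrow> real"
  assumes T: "T > 0" and \<alpha>: "\<alpha> > 0" and \<beta>: "\<beta> > 0" and \<epsilon>: "\<epsilon> > 0"
    and f: "Lf-lipschitz_on UNIV f" and ell: "ell \<in> L2_H1_dual T \<Omega>"
    and LH: "LH > 0" and H_L2: "\<And>q. q \<in> L2_L2 T \<Omega> \<Longrightarrow> H q \<in> L2_L2 T \<Omega>"
    and H_Lipschitz: "\<And>q q'. q \<in> L2_L2 T \<Omega> \<Longrightarrow> q' \<in> L2_L2 T \<Omega> \<Longrightarrow> AE t in time T.
      L2_norm \<Omega> (H q t - H q' t) \<le> LH * (LINT s|time t. L2_norm \<Omega> (q s - q' s))"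
begin

section \<open>The reduced rate equation\<close>

definition drive :: "('a \<Rightarrow> real) \<Rightarrow> (('a \<Rightarrow> real) \<Rightarrow> real) \<Rightarrow> 'a \<Rightarrow> real"
  where "drive q l = (- \<beta>) *\<^sub>R (q - sol \<alpha> \<beta> q l)"

text \<open>The right-hand side of the rate equation after elimination of \<open>\<phi>\<close>:
  \<open>drive\<close> is minus the derivative of the energy in the damage variable, evaluated at
  the elliptic solution.\<close>

definition rhs :: "(real \<Rightarrow> 'a \<Rightarrow> real) \<Rightarrow> real \<Rightarrow> 'a \<Rightarrow> real"
  where "rhs q t = rate \<epsilon> f (drive (q t) (ell t)) (H q t)"

text \<open>The Lipschitz constant of \<open>sol\<close> in the damage variable, from
  \<open>L2\<close> to \<open>H1\<close>: the load contributes \<open>\<beta>\<close>, coercivity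
  \<open>min \<alpha> \<beta>\<close>.\<close>

definition sol_const :: real
  where "sol_const = \<beta> / min \<alpha> \<beta>"

lemma sol_const_nonneg: "0 \<le> sol_const"
  using \<beta> min_pos[OF \<alpha> \<beta>] by (simp add: sol_const_def)

lemma ell_dual: "AE t in time T. ell t \<in> dual"
  using ell by (auto simp: bochner_L2_def strongly_measurable_def)

lemma L2_L2_in: "q \<in> L2_L2 T \<Omega> \<Longrightarrow> AE t in time T. q t \<in> L2 \<Omega>"
  by (auto simp: bochner_L2_def strongly_measurable_def)

lemma sol_H1:
  assumes "q \<in> L2 \<Omega>" "l \<in> dual"
  shows "sol \<alpha> \<beta> q l \<in> H1 \<Omega>"
  using solves_sol[OF \<alpha> \<beta> assms] by (simp add: solves_def)

lemma sol_Lipschitz: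
  assumes "q \<in> L2 \<Omega>" "l \<in> dual" "q' \<in> L2 \<Omega>" "l' \<in> dual"
  shows "H1_norm \<Omega> (sol \<alpha> \<beta> q l - sol \<alpha> \<beta> q' l')
    \<le> sol_const * L2_norm \<Omega> (q - q') + 1 / min \<alpha> \<beta> * dnorm (l - l')"
  unfolding sol_const_def
  by (rule solves_Lipschitz[OF \<alpha> \<beta> assms(1,3,2,4) solves_sol[OF \<alpha> \<beta> assms(1,2)] solves_sol[OF \<alpha> \<beta> assms(3,4)]])

lemma drive_L2: "q \<in> L2 \<Omega> \<Longrightarrow> l \<in> dual \<Longrightarrow> drive q l \<in> L2 \<Omega>"
  unfolding drive_def by (intro L2.scaleR_in L2.diff_in H1_subset_L2[OF sol_H1])

lemma drive_Lipschitz: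
  assumes q: "q \<in> L2 \<Omega>" "l \<in> dual" and q': "q' \<in> L2 \<Omega>" "l' \<in> dual"
  shows "L2_norm \<Omega> (drive q l - drive q' l')
    \<le> \<beta> * (1 + sol_const) * L2_norm \<Omega> (q - q') + \<beta> / min \<alpha> \<beta> * dnorm (l - l')"
proof -
  let ?d = "sol \<alpha> \<beta> q l - sol \<alpha> \<beta> q' l'"
  have d: "?d \<in> L2 \<Omega>" by (intro L2.diff_in H1_subset_L2[OF sol_H1] q q')
  note qq = L2.diff_in[OF q(1) q'(1)]
  have "drive q l - drive q' l' = (- \<beta>) *\<^sub>R ((q - q') - ?d)"
    by (simp add: drive_def algebra_simps)
  then have "L2_norm \<Omega> (drive q l - drive q' l') = \<beta> * L2_norm \<Omega> ((q - q') - ?d)"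
    using L2.N_scaleR[OF L2.diff_in[OF qq d], of "- \<beta>"] \<beta> by simp
  also have "\<dots> \<le> \<beta> * (L2_norm \<Omega> (q - q') + (sol_const * L2_norm \<Omega> (q - q') + 1 / min \<alpha> \<beta> * dnorm (l - l')))"
    using \<beta> L2.N_triangle_diff[OF qq d] L2_norm_le_H1_norm[of ?d] sol_Lipschitz[OF q q']
    by (intro mult_left_mono) linarith+
  finally show ?thesis by (simp add: algebra_simps)
qed

lemma drive_bochner_L2:
  assumes q: "q \<in> L2_L2 T \<Omega>"
  shows "(\<lambda>t. drive (q t) (ell t)) \<in> L2_L2 T \<Omega>"
  by (rule L2.bochner_L2_lipschitz2[where A=drive, OF q ell L2.zero_in H1.dual_space_zero])
     (erule (1) drive_L2, erule (3) drive_Lipschitz)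

lemma sol_bochner_L2:
  assumes q: "q \<in> L2_L2 T \<Omega>"
  shows "(\<lambda>t. sol \<alpha> \<beta> (q t) (ell t)) \<in> L2_H1 T \<Omega>"
  by (rule H1.bochner_L2_lipschitz2[where A="sol \<alpha> \<beta>", OF q ell L2.zero_in H1.dual_space_zero])
     (erule (1) sol_H1, erule (3) sol_Lipschitz)

lemma rhs_bochner_L2:
  assumes q: "q \<in> L2_L2 T \<Omega>"
  shows "rhs q \<in> L2_L2 T \<Omega>"
  unfolding rhs_def[abs_def]
  by (rule L2.bochner_L2_lipschitz2[where A="rate \<epsilon> f", OF drive_bochner_L2[OF q] H_L2[OF q] L2.zero_in L2.zero_in])
     (erule (1) rate_L2[OF \<epsilon> f], rule rate_Lipschitz[OF \<epsilon> f])

text \<open>The damage variable enters \<open>drive\<close> once directly and once through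
  \<open>sol\<close>, which gives \<open>\<beta> (1 + sol_const)\<close>; \<open>rate\<close>
  divides by \<open>\<epsilon>\<close>.\<close>

definition rhs_const :: real
  where "rhs_const = \<beta> * (1 + sol_const) / \<epsilon>"

lemma rhs_const_pos: "0 < rhs_const"
  using \<beta> \<epsilon> sol_const_nonneg by (simp add: rhs_const_def)

text \<open>Both sides carry the same load, so its share in the bound for \<open>drive\<close> is
  zero. The instantaneous term comes from \<open>drive\<close>, the memory term from
  \<open>f\<close> and \<open>H\<close>.\<close>

lemma rhs_Lipschitz:
  assumes q: "q \<in> L2_L2 T \<Omega>" and q': "q' \<in> L2_L2 T \<Omega>"
  shows "AE t in time T. L2_norm \<Omega> (rhs q t - rhs q' t)
    \<le> rhs_const * L2_norm \<Omega> (q t - q' t) + Lf * LH / \<epsilon> * (LINT s|time t. L2_norm \<Omega> (q s - q' s))"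
  using H_Lipschitz[OF q q'] L2_L2_in[OF q] L2_L2_in[OF q'] L2_L2_in[OF H_L2[OF q]]
    L2_L2_in[OF H_L2[OF q']] ell_dual
proof eventually_elim
  case (elim t)
  note d = drive_L2[OF elim(2,6)] drive_L2[OF elim(3,6)]
  have "L2_norm \<Omega> (rhs q t - rhs q' t)
    \<le> 1 / \<epsilon> * L2_norm \<Omega> (drive (q t) (ell t) - drive (q' t) (ell t)) + Lf / \<epsilon> * L2_norm \<Omega> (H q t - H q' t)"
    unfolding rhs_def by (rule rate_Lipschitz[OF \<epsilon> f d elim(4,5)])
  also have "\<dots> \<le> 1 / \<epsilon> * (\<beta> * (1 + sol_const) * L2_norm \<Omega> (q t - q' t))
      + Lf / \<epsilon> * (LH * (LINT s|time t. L2_norm \<Omega> (q s - q' s)))"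
    using drive_Lipschitz[OF elim(2,6) elim(3,6)] \<epsilon> lipschitz_on_nonneg[OF f]
    by (intro add_mono mult_left_mono elim(1)) (auto simp: H1.dual_norm_zero)
  finally show ?case by (simp add: rhs_const_def)
qed

section \<open>The fixed point equation for the rate\<close>

abbreviation "prim \<equiv> L2.primitive"

text \<open>The factor \<open>T\<close> belongs to the memory term alone: for primitives it is a
  double time integral, and the outer integration costs at most \<open>T\<close>.\<close>

definition Volterra_const :: real
  where "Volterra_const = rhs_const + Lf * LH / \<epsilon> * T"

lemma Volterra_const_pos: "0 < Volterra_const"
  using rhs_const_pos lipschitz_on_nonneg[OF f] LH T \<epsilon> by (simp add: Volterra_const_def add_pos_nonneg)

text \<open>Both terms of \<open>rhs_Lipschitz\<close> become integrals of the rates: at every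
  \<open>s \<le> t\<close> the difference of the primitives is bounded by the single number
  \<open>D\<close>, the integral of the difference of the rates up to \<open>t\<close>.\<close>

lemma rhs_primitive_Volterra:
  assumes u: "u \<in> L2_L2 T \<Omega>" and w: "w \<in> L2_L2 T \<Omega>"
  shows "AE t in time T. L2_norm \<Omega> (rhs (prim u) t - rhs (prim w) t)
    \<le> Volterra_const * (LINT s|time t. L2_norm \<Omega> (u s - w s))"
  using rhs_Lipschitz[OF L2.primitive_bochner_L2[OF u T] L2.primitive_bochner_L2[OF w T]] AE_space
proof eventually_elim
  case (elim t)
  then have t: "t \<in> {0..T}" by simp
  note uw = L2.bochner_L2D(1,3)[OF L2.bochner_L2_diff[OF u w]]
  note pp = L2.bochner_L2D(1,3)[OF L2.bochner_L2_diff[OF L2.primitive_bochner_L2[OF u T] L2.primitive_bochner_L2[OF w T]]]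
  define D where "D = (LINT s|time t. L2_norm \<Omega> (u s - w s))"
  have le: "L2_norm \<Omega> (prim u s - prim w s) \<le> D" if s: "0 \<le> s" "s \<le> t" for s
  proof -
    have "L2_norm \<Omega> (prim u s - prim w s) \<le> (LINT r|time s. L2_norm \<Omega> (u r - w r))"
      by (rule L2.N_primitive_diff[OF u w]) (use s t in auto)
    also have "\<dots> = (LINT r|time t. indicator {..<s} r * L2_norm \<Omega> (u r - w r))"
      by (rule time_integral(4)[OF time_integral(1)[OF uw(2) t]]) (use s in auto)
    also have "\<dots> \<le> D"
      unfolding D_def
    proof (rule integral_mono_AE)
      show "integrable (time t) (\<lambda>r. indicator {..<s} r * L2_norm \<Omega> (u r - w r))"
        by (rule integrable_bounded_times[OF borel_measurable_indicator_lessThan _ time_integral(1)[OF uw(2) t], where B=1])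
           (simp add: indicator_def)
      show "AE r in time t. indicator {..<s} r * L2_norm \<Omega> (u r - w r) \<le> L2_norm \<Omega> (u r - w r)"
        by (intro AE_I2) (simp add: indicator_def L2_norm_def)
    qed (rule time_integral(1)[OF uw(2) t])
    finally show ?thesis .
  qed
  have D: "0 \<le> D" unfolding D_def by (rule integral_nonneg_AE) (simp add: L2_norm_def)
  have "(LINT s|time t. L2_norm \<Omega> (prim u s - prim w s)) \<le> (LINT s|time t. D)"
    using time_integral(1)[OF pp(2) t] finite_measure.integrable_const[OF finite_measure_time] le
    by (intro integral_mono) auto
  also have "\<dots> = t * D"
    using t by (simp add: measure_restrict_space)
  also have "\<dots> \<le> T * D" using t D by (intro mult_right_mono) auto
  finally have "Lf * LH / \<epsilon> * (LINT s|time t. L2_norm \<Omega> (prim u s - prim w s)) \<le> Lf * LH / \<epsilon> * (T * D)"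
    using lipschitz_on_nonneg[OF f] LH \<epsilon> by (intro mult_left_mono) auto
  moreover have "rhs_const * L2_norm \<Omega> (prim u t - prim w t) \<le> rhs_const * D"
    using rhs_const_pos t by (intro mult_left_mono le) auto
  ultimately have "L2_norm \<Omega> (rhs (prim u) t - rhs (prim w) t) \<le> rhs_const * D + Lf * LH / \<epsilon> * (T * D)"
    using elim(1) by linarith
  also have "\<dots> = Volterra_const * D" by (simp add: Volterra_const_def distrib_right)
  finally show ?case by (simp only: D_def)
qed

lemma rhs_primitive_L2: "w \<in> L2_L2 T \<Omega> \<Longrightarrow> rhs (prim w) \<in> L2_L2 T \<Omega>"
  by (intro rhs_bochner_L2 L2.primitive_bochner_L2 T)

lemma fixed_point_exists: "\<exists>w\<in>L2_L2 T \<Omega>. AE t in time T. L2_norm \<Omega> (w t - rhs (prim w) t) = 0"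
  by (rule L2.Volterra_exists[OF T Volterra_const_pos, of "\<lambda>w. rhs (prim w)"])
     (erule rhs_primitive_L2, erule (1) rhs_primitive_Volterra)

lemma fixed_point_unique:
  assumes "u \<in> L2_L2 T \<Omega>" "AE t in time T. L2_norm \<Omega> (u t - rhs (prim u) t) = 0"
    and "w \<in> L2_L2 T \<Omega>" "AE t in time T. L2_norm \<Omega> (w t - rhs (prim w) t) = 0"
  shows "AE t in time T. L2_norm \<Omega> (u t - w t) = 0"
  by (rule L2.Volterra_unique[OF T Volterra_const_pos, of "\<lambda>w. rhs (prim w)", OF _ _ assms])
     (erule rhs_primitive_L2, erule (1) rhs_primitive_Volterra)

section \<open>Equivalence of the inclusion and the system\<close>

lemma subdifferential_iff:
  assumes q: "q \<in> L2 \<Omega>" and \<phi>: "\<phi> \<in> L2 \<Omega>" and v: "v \<in> L2 \<Omega>" and \<omega>: "\<omega> \<in> L2 \<Omega>"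
  shows "- energy_dq \<Omega> \<alpha> \<beta> ell t \<phi> q \<in> L2_subdifferential \<Omega> (dissipation \<Omega> \<epsilon> f \<omega>) v
    \<longleftrightarrow> (AE x in lebesgue_on \<Omega>. v x = 1 / \<epsilon> * max (- \<beta> * (q x - \<phi> x) - f (\<omega> x)) 0)"
proof -
  note g = energy_dq[OF \<alpha> \<beta> \<phi> q, where ell=ell and t=t]
  define \<xi> where "\<xi> = - (\<beta> *\<^sub>R (q - \<phi>))"
  have qp: "\<beta> *\<^sub>R (q - \<phi>) \<in> L2 \<Omega>" by (intro L2.scaleR_in L2.diff_in q \<phi>)
  then have \<xi>: "\<xi> \<in> L2 \<Omega>" unfolding \<xi>_def by (rule L2.minus_in)
  \<comment> \<open>The chosen derivative and the explicit \<open>\<xi>\<close> have the same inner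
    products, and the inequality involves nothing else; so \<open>\<xi>\<close> may take its
    place.\<close>
  have "L2_inner \<Omega> (- energy_dq \<Omega> \<alpha> \<beta> ell t \<phi> q) \<eta> = L2_inner \<Omega> \<xi> \<eta>" if "\<eta> \<in> L2 \<Omega>" for \<eta>
    using g(2)[OF that] L2.ip_minus_left[OF g(1) that] L2.ip_minus_left[OF qp that] by (simp add: \<xi>_def)
  then have "- energy_dq \<Omega> \<alpha> \<beta> ell t \<phi> q \<in> L2_subdifferential \<Omega> (dissipation \<Omega> \<epsilon> f \<omega>) v
    \<longleftrightarrow> dissipation \<Omega> \<epsilon> f \<omega> v < \<infinity> \<and>
      (\<forall>\<eta>\<in>L2 \<Omega>. ereal (L2_inner \<Omega> \<xi> (\<eta> - v)) \<le> dissipation \<Omega> \<epsilon> f \<omega> \<eta> - dissipation \<Omega> \<epsilon> f \<omega> v)"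
    using L2.minus_in[OF g(1)] v L2.diff_in[OF _ v] by (auto simp: L2_subdifferential_def)
  also have "\<dots> \<longleftrightarrow> (AE x in lebesgue_on \<Omega>. v x = 1 / \<epsilon> * max (\<xi> x - f (\<omega> x)) 0)"
    by (rule dissipation_inequality_iff[OF \<epsilon> \<xi> v Nemytskii_L2[OF f \<omega>]])
  finally show ?thesis by (simp add: \<xi>_def scaleR_fun_def)
qed

lemma solves_iff:
  "solves \<alpha> \<beta> q (ell t) \<phi> \<longleftrightarrow> \<phi> \<in> H1 \<Omega> \<and> (\<forall>\<psi>\<in>H1 \<Omega>.
    - \<alpha> * laplacian \<Omega> \<phi> \<psi> + \<beta> * L2_functional \<Omega> \<phi> \<psi> = \<beta> * L2_functional \<Omega> q \<psi> + ell t \<psi>)"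
  by (simp add: solves_def load_def elliptic_form_def laplacian_def L2_functional_def)

text \<open>The conditions are compared at one fixed time, after discarding the null set of times at
  which some value lies outside its space; the initial condition is common to both.\<close>

lemma problem_iff_system:
  assumes q: "q \<in> H10_L2 T \<Omega>" and \<phi>: "\<phi> \<in> L2_H1 T \<Omega>"
  shows "fatigue_damage_problem T \<Omega> \<alpha> \<beta> \<epsilon> H f ell q \<phi> \<longleftrightarrow> fatigue_damage_system T \<Omega> \<alpha> \<beta> \<epsilon> H f ell q \<phi>"
proof -
  have q1: "q \<in> H1_L2 T \<Omega>" using q by (simp add: bochner_H10_def)
  note q2 = L2.time_derivative[OF q1]
  have \<phi>_in: "AE t in time T. \<phi> t \<in> H1 \<Omega>" using \<phi> by (auto simp: bochner_L2_def strongly_measurable_def)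
  note reg = L2_L2_in[OF q2(1)] L2_L2_in[OF q2(2)] L2_L2_in[OF H_L2[OF q2(1)]] \<phi>_in ell_dual
  have "AE t in time T. is_arg_min (\<lambda>\<psi>. energy \<Omega> \<alpha> \<beta> ell t \<psi> (q t)) (\<lambda>\<psi>. \<psi> \<in> H1 \<Omega>) (\<phi> t) \<longleftrightarrow>
      (\<forall>\<psi>\<in>H1 \<Omega>. - \<alpha> * laplacian \<Omega> (\<phi> t) \<psi> + \<beta> * L2_functional \<Omega> (\<phi> t) \<psi>
        = \<beta> * L2_functional \<Omega> (q t) \<psi> + ell t \<psi>)"
    using reg
  proof eventually_elim
    case (elim t)
    show ?case
      using is_arg_min_energy_iff[OF \<alpha> \<beta> elim(1), where ell=ell and t=t, OF elim(5)] elim(4) by (simp add: solves_iff)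
  qed
  note 1 = AE_iff_AE[OF this]
  have "AE t in time T. - energy_dq \<Omega> \<alpha> \<beta> ell t (\<phi> t) (q t)
         \<in> L2_subdifferential \<Omega> (dissipation \<Omega> \<epsilon> f (H q t)) (dot T \<Omega> q t) \<longleftrightarrow>
      (AE x in lebesgue_on \<Omega>. dot T \<Omega> q t x = 1 / \<epsilon> * max (- \<beta> * (q t x - \<phi> t x) - f (H q t x)) 0)"
    using reg
  proof eventually_elim
    case (elim t)
    show ?case by (rule subdifferential_iff[OF elim(1) H1_subset_L2[OF elim(4)] elim(2,3)])
  qed
  note 2 = AE_iff_AE[OF this]
  show ?thesis unfolding fatigue_damage_problem_def fatigue_damage_system_def 1 2 by blast
qed

lemma rate_eq_AE:
  assumes v: "v \<in> L2 \<Omega>" and b: "b \<in> L2 \<Omega>" and \<omega>: "\<omega> \<in> L2 \<Omega>"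
  shows "(AE x in lebesgue_on \<Omega>. v x = 1 / \<epsilon> * max (b x - f (\<omega> x)) 0) \<longleftrightarrow> L2_norm \<Omega> (v - rate \<epsilon> f b \<omega>) = 0"
  using L2_norm_eq_0_iff[OF L2.diff_in[OF v rate_L2[OF \<epsilon> f b \<omega>]]] by (simp add: rate_def)

text \<open>The system determines \<open>\<phi> t\<close> only up to seminorm zero, while
  \<open>rhs\<close> uses the chosen solution \<open>sol\<close>. \<open>solves_Lipschitz\<close>
  with equal data makes their difference vanish, and \<open>rate_Lipschitz\<close> carries this over
  to the rate.\<close>

lemma system_rhs:
  assumes q: "q \<in> H10_L2 T \<Omega>" and \<phi>: "\<phi> \<in> L2_H1 T \<Omega>"
    and sys: "fatigue_damage_system T \<Omega> \<alpha> \<beta> \<epsilon> H f ell q \<phi>"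
  shows "AE t in time T. L2_norm \<Omega> (dot T \<Omega> q t - rhs q t) = 0"
    "AE t in time T. solves \<alpha> \<beta> (q t) (ell t) (\<phi> t)"
proof -
  have q1: "q \<in> H1_L2 T \<Omega>" using q by (simp add: bochner_H10_def)
  note q2 = L2.time_derivative[OF q1]
  have \<phi>_in: "AE t in time T. \<phi> t \<in> H1 \<Omega>" using \<phi> by (auto simp: bochner_L2_def strongly_measurable_def)
  have EL: "AE t in time T. \<forall>\<psi>\<in>H1 \<Omega>. - \<alpha> * laplacian \<Omega> (\<phi> t) \<psi> + \<beta> * L2_functional \<Omega> (\<phi> t) \<psi>
        = \<beta> * L2_functional \<Omega> (q t) \<psi> + ell t \<psi>"
    and ODE: "AE t in time T. AE x in lebesgue_on \<Omega>.
       dot T \<Omega> q t x = 1 / \<epsilon> * max (- \<beta> * (q t x - \<phi> t x) - f (H q t x)) 0"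
    using sys by (auto simp: fatigue_damage_system_def)
  show solves: "AE t in time T. solves \<alpha> \<beta> (q t) (ell t) (\<phi> t)"
    using EL \<phi>_in by eventually_elim (simp add: solves_iff)
  show "AE t in time T. L2_norm \<Omega> (dot T \<Omega> q t - rhs q t) = 0"
    using ODE solves \<phi>_in L2_L2_in[OF q2(1)] L2_L2_in[OF q2(2)] L2_L2_in[OF H_L2[OF q2(1)]] ell_dual
  proof eventually_elim
    case (elim t)
    let ?b = "(- \<beta>) *\<^sub>R (q t - \<phi> t)"
    note \<phi>t = H1_subset_L2[OF elim(3)] and s = H1_subset_L2[OF sol_H1[OF elim(4,7)]]
    have b: "?b \<in> L2 \<Omega>" by (intro L2.scaleR_in L2.diff_in elim(4) \<phi>t)
    note d = drive_L2[OF elim(4,7)]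
    have "L2_norm \<Omega> (dot T \<Omega> q t - rate \<epsilon> f ?b (H q t)) = 0"
      using rate_eq_AE[OF elim(5) b elim(6)] elim(1) by (simp add: scaleR_fun_def)
    moreover have "L2_norm \<Omega> (rate \<epsilon> f ?b (H q t) - rhs q t) \<le> 0"
    proof -
      have "H1_norm \<Omega> (\<phi> t - sol \<alpha> \<beta> (q t) (ell t)) \<le> 0"
        using solves_Lipschitz[OF \<alpha> \<beta> elim(4,4,7,7,2) solves_sol[OF \<alpha> \<beta> elim(4,7)]]
        by (simp add: H1.dual_norm_zero L2.N_zero)
      then have 0: "L2_norm \<Omega> (\<phi> t - sol \<alpha> \<beta> (q t) (ell t)) \<le> 0"
        using L2_norm_le_H1_norm[of "\<phi> t - sol \<alpha> \<beta> (q t) (ell t)"] by simp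
      have "?b - drive (q t) (ell t) = \<beta> *\<^sub>R (\<phi> t - sol \<alpha> \<beta> (q t) (ell t))"
        by (simp add: drive_def algebra_simps)
      then have "L2_norm \<Omega> (?b - drive (q t) (ell t)) = \<beta> * L2_norm \<Omega> (\<phi> t - sol \<alpha> \<beta> (q t) (ell t))"
        using L2.N_scaleR[OF L2.diff_in[OF \<phi>t s], of \<beta>] \<beta> by simp
      then have "L2_norm \<Omega> (?b - drive (q t) (ell t)) \<le> 0" using 0 \<beta> by (simp add: mult_le_0_iff)
      moreover have "L2_norm \<Omega> (rate \<epsilon> f ?b (H q t) - rhs q t)
          \<le> 1 / \<epsilon> * L2_norm \<Omega> (?b - drive (q t) (ell t)) + Lf / \<epsilon> * L2_norm \<Omega> (H q t - H q t)"
        unfolding rhs_def by (rule rate_Lipschitz[OF \<epsilon> f b d elim(6,6)])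
      ultimately show ?thesis using \<epsilon> L2.N_zero by (simp add: divide_le_0_iff order_trans)
    qed
    moreover note L2.N_triangle3[OF elim(5) rate_L2[OF \<epsilon> f b elim(6)], of "rhs q t"]
      rate_L2[OF \<epsilon> f d elim(6)] L2.N_nonneg[OF L2.diff_in[OF elim(5) rate_L2[OF \<epsilon> f d elim(6)]]]
    ultimately show ?case by (simp add: rhs_def)
  qed
qed

text \<open>\<open>q\<close> and the primitive of its derivative agree only at almost every time,
  whereas \<open>H\<close> acts on whole functions. Since \<open>rhs_Lipschitz\<close> bounds the
  memory term by an integral of the difference, exchanging the two changes \<open>rhs\<close> by
  seminorm zero only.\<close>

lemma system_fixed_point:
  assumes q: "q \<in> H10_L2 T \<Omega>" and \<phi>: "\<phi> \<in> L2_H1 T \<Omega>"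
    and sys: "fatigue_damage_system T \<Omega> \<alpha> \<beta> \<epsilon> H f ell q \<phi>"
  shows "AE t in time T. L2_norm \<Omega> (dot T \<Omega> q t - rhs (prim (dot T \<Omega> q)) t) = 0"
proof -
  have q1: "q \<in> H1_L2 T \<Omega>" using q by (simp add: bochner_H10_def)
  note q2 = L2.time_derivative[OF q1]
  note p = L2.primitive_bochner_L2[OF q2(2) T]
  note qp = L2.bochner_H10_eq_primitive[OF q T]
  show ?thesis
    using system_rhs(1)[OF assms] rhs_Lipschitz[OF q2(1) p] qp AE_space L2_L2_in[OF q2(2)]
      L2_L2_in[OF rhs_bochner_L2[OF q2(1)]] L2_L2_in[OF rhs_bochner_L2[OF p]]
  proof eventually_elim
    case (elim t)
    then have t: "t \<in> {0..T}" by simp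
    have "AE s in time t. L2_norm \<Omega> (q s - prim (dot T \<Omega> q) s) = 0"
      using qp t by (auto simp: AE_restrict_space_iff elim!: eventually_mono)
    then have "(LINT s|time t. L2_norm \<Omega> (q s - prim (dot T \<Omega> q) s)) = 0"
      by (rule integral_eq_zero_AE)
    then have "L2_norm \<Omega> (rhs q t - rhs (prim (dot T \<Omega> q)) t) \<le> 0"
      using elim(2,3) by simp
    then show ?case
      using L2.N_triangle3[OF elim(5,6,7)] elim(1) L2.N_nonneg[OF L2.diff_in[OF elim(5,7)]] by simp
  qed
qed

text \<open>The rates solve the same fixed point equation and agree; hence so do their primitives,
  then \<open>q1\<close> and \<open>q2\<close>, and finally the elliptic solutions by Lipschitz
  dependence on the data.\<close>

lemma system_unique:
  assumes q1: "q1 \<in> H10_L2 T \<Omega>" and \<phi>1: "\<phi>1 \<in> L2_H1 T \<Omega>" and s1: "fatigue_damage_system T \<Omega> \<alpha> \<beta> \<epsilon> H f ell q1 \<phi>1"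
    and q2: "q2 \<in> H10_L2 T \<Omega>" and \<phi>2: "\<phi>2 \<in> L2_H1 T \<Omega>" and s2: "fatigue_damage_system T \<Omega> \<alpha> \<beta> \<epsilon> H f ell q2 \<phi>2"
  shows "AE t in time T. L2_norm \<Omega> (q1 t - q2 t) = 0 \<and> H1_norm \<Omega> (\<phi>1 t - \<phi>2 t) = 0"
proof -
  have "q1 \<in> H1_L2 T \<Omega>" "q2 \<in> H1_L2 T \<Omega>" using q1 q2 by (auto simp: bochner_H10_def)
  note d1 = L2.time_derivative[OF this(1)] and d2 = L2.time_derivative[OF this(2)]
  have eq: "AE t in time T. L2_norm \<Omega> (dot T \<Omega> q1 t - dot T \<Omega> q2 t) = 0"
    by (rule fixed_point_unique[OF d1(2) system_fixed_point[OF q1 \<phi>1 s1] d2(2) system_fixed_point[OF q2 \<phi>2 s2]])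
  show ?thesis
    using L2.bochner_H10_eq_primitive[OF q1 T] L2.bochner_H10_eq_primitive[OF q2 T] AE_space
      L2_L2_in[OF d1(1)] L2_L2_in[OF d2(1)] system_rhs(2)[OF q1 \<phi>1 s1] system_rhs(2)[OF q2 \<phi>2 s2] ell_dual
  proof eventually_elim
    case (elim t)
    then have t: "t \<in> {0..T}" by simp
    note p1 = L2.primitive(1)[OF d1(2) t] and p2 = L2.primitive(1)[OF d2(2) t]
    have "AE s in time t. L2_norm \<Omega> (dot T \<Omega> q1 s - dot T \<Omega> q2 s) = 0"
      using eq t by (auto simp: AE_restrict_space_iff elim!: eventually_mono)
    then have "(LINT s|time t. L2_norm \<Omega> (dot T \<Omega> q1 s - dot T \<Omega> q2 s)) = 0"
      by (rule integral_eq_zero_AE)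
    then have "L2_norm \<Omega> (prim (dot T \<Omega> q1) t - prim (dot T \<Omega> q2) t) \<le> 0"
      using L2.N_primitive_diff[OF d1(2) d2(2) t] by simp
    then have q: "L2_norm \<Omega> (q1 t - q2 t) = 0"
      using L2.N_triangle3[OF elim(4) p1 elim(5)] L2.N_triangle3[OF p1 p2 elim(5)]
        L2.N_commute[OF elim(5) p2] elim(1,2) L2.N_nonneg[OF L2.diff_in[OF elim(4,5)]] by simp
    have H: "\<phi>1 t \<in> H1 \<Omega>" "\<phi>2 t \<in> H1 \<Omega>" using elim(6,7) by (auto simp: solves_iff)
    have "H1_norm \<Omega> (\<phi>1 t - \<phi>2 t) \<le> 0"
      using solves_Lipschitz[OF \<alpha> \<beta> elim(4,5) elim(8,8) elim(6,7)] q by (simp add: H1.dual_norm_zero)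
    then show ?case using q H1.N_nonneg[OF H1.diff_in[OF H]] by simp
  qed
qed

lemma system_exists: "\<exists>q\<in>H10_L2 T \<Omega>. \<exists>\<phi>\<in>L2_H1 T \<Omega>. fatigue_damage_system T \<Omega> \<alpha> \<beta> \<epsilon> H f ell q \<phi>"
proof -
  obtain w where w: "w \<in> L2_L2 T \<Omega>" "AE t in time T. L2_norm \<Omega> (w t - rhs (prim w) t) = 0"
    using fixed_point_exists by blast
  define q where "q = prim w"
  define \<phi> where "\<phi> t = sol \<alpha> \<beta> (q t) (ell t)" for t
  have q: "q \<in> H10_L2 T \<Omega>" unfolding q_def by (rule L2.primitive_bochner_H10[OF w(1) T])
  then have q1: "q \<in> H1_L2 T \<Omega>" "vanishes_initially T (L2 \<Omega>) (L2_norm \<Omega>) q" by (auto simp: bochner_H10_def)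
  note d = L2.time_derivative[OF q1(1)]
  have \<phi>: "\<phi> \<in> L2_H1 T \<Omega>" unfolding \<phi>_def[abs_def] by (rule sol_bochner_L2[OF d(1)])
  note reg = L2_L2_in[OF d(1)] L2_L2_in[OF d(2)] L2_L2_in[OF H_L2[OF d(1)]] ell_dual L2_L2_in[OF w(1)]
  have "AE t in time T. AE x in lebesgue_on \<Omega>.
       dot T \<Omega> q t x = 1 / \<epsilon> * max (- \<beta> * (q t x - \<phi> t x) - f (H q t x)) 0"
    using L2.time_derivative_primitive[OF w(1) T, folded q_def] w(2)[folded q_def] reg
      L2_L2_in[OF rhs_bochner_L2[OF d(1)]]
  proof eventually_elim
    case (elim t)
    \<comment> \<open>The time derivative of \<open>prim w\<close> is again a choice; it agrees with
      \<open>w\<close>, and \<open>w\<close> with \<open>rhs q\<close>, so the triangle inequality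
      joins them.\<close>
    have "L2_norm \<Omega> (dot T \<Omega> q t - rhs q t) = 0"
      using L2.N_triangle3[OF elim(4,7,8)] elim(1,2) L2.N_nonneg[OF L2.diff_in[OF elim(4,8)]] by simp
    then show ?case
      using rate_eq_AE[OF elim(4) drive_L2[OF elim(3,6)] elim(5)]
      by (simp add: rhs_def drive_def \<phi>_def scaleR_fun_def)
  qed
  moreover have "AE t in time T. \<forall>\<psi>\<in>H1 \<Omega>. - \<alpha> * laplacian \<Omega> (\<phi> t) \<psi> + \<beta> * L2_functional \<Omega> (\<phi> t) \<psi>
        = \<beta> * L2_functional \<Omega> (q t) \<psi> + ell t \<psi>"
    using reg
  proof eventually_elim
    case (elim t)
    show ?case using solves_sol[OF \<alpha> \<beta> elim(1,4)] unfolding solves_iff \<phi>_def by blast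
  qed
  ultimately have "fatigue_damage_system T \<Omega> \<alpha> \<beta> \<epsilon> H f ell q \<phi>"
    using q1(2) unfolding fatigue_damage_system_def by blast
  then show ?thesis using q \<phi> by blast
qed

end

theorem proposition2p3:
  fixes \<Omega> :: "(real ^ 'n) set"
    and T \<alpha> \<beta> \<epsilon> Lf :: real
    and H :: "(real \<Rightarrow> real ^ 'n \<Rightarrow> real) \<Rightarrow> real \<Rightarrow> real ^ 'n \<Rightarrow> real"
    and f :: "real \<Rightarrow> real"
    and ell :: "real \<Rightarrow> (real ^ 'n \<Rightarrow> real) \<Rightarrow> real"
  assumes "CARD('n) \<in> {2, 3}"
    and "bounded_lipschitz_domain \<Omega>"
    and "T > 0" and "\<alpha> > 0" and "\<beta> > 0" and "\<epsilon> > 0"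
    and "history_operator T \<Omega> H"
    and "Lf > 0" and "Lf-lipschitz_on UNIV f" and "directionally_differentiable f"
    and "ell \<in> L2_H1_dual T \<Omega>"
  shows "(\<exists>q\<in>H10_L2 T \<Omega>. \<exists>\<phi>\<in>L2_H1 T \<Omega>. fatigue_damage_problem T \<Omega> \<alpha> \<beta> \<epsilon> H f ell q \<phi>) \<and>
    (\<forall>q1\<in>H10_L2 T \<Omega>. \<forall>\<phi>1\<in>L2_H1 T \<Omega>. \<forall>q2\<in>H10_L2 T \<Omega>. \<forall>\<phi>2\<in>L2_H1 T \<Omega>.
       fatigue_damage_problem T \<Omega> \<alpha> \<beta> \<epsilon> H f ell q1 \<phi>1 \<and>
       fatigue_damage_problem T \<Omega> \<alpha> \<beta> \<epsilon> H f ell q2 \<phi>2 \<longrightarrow>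
       (AE t in time T. L2_norm \<Omega> (q1 t - q2 t) = 0 \<and> H1_norm \<Omega> (\<phi>1 t - \<phi>2 t) = 0)) \<and>
    (\<forall>q\<in>H10_L2 T \<Omega>. \<forall>\<phi>\<in>L2_H1 T \<Omega>.
       fatigue_damage_problem T \<Omega> \<alpha> \<beta> \<epsilon> H f ell q \<phi> \<longleftrightarrow>
       fatigue_damage_system T \<Omega> \<alpha> \<beta> \<epsilon> H f ell q \<phi>)"
proof -
  have dom: "open \<Omega>" "bounded \<Omega>"
    using assms(2) by (simp_all add: bounded_lipschitz_domain_def)
  note H = assms(7)[unfolded history_operator_def]
  from H[THEN conjunct2, THEN conjunct1] obtain LH where LH: "LH > 0"
    "\<forall>q1\<in>L2_L2 T \<Omega>. \<forall>q2\<in>L2_L2 T \<Omega>. AE t in time T.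
       L2_norm \<Omega> (H q1 t - H q2 t) \<le> LH * (LINT s|time t. L2_norm \<Omega> (q1 s - q2 s))"
    by (elim exE conjE)
  interpret fatigue \<Omega> T \<alpha> \<beta> \<epsilon> Lf LH H f ell
    by unfold_locales
       (use dom assms(3-6,9,11) LH(1) in simp_all, (rule bspec[OF conjunct1[OF H]], assumption),
         rule bspec[OF bspec[OF LH(2)]], assumption+)
  show ?thesis
  proof (intro conjI ballI impI)
    show "\<exists>q\<in>H10_L2 T \<Omega>. \<exists>\<phi>\<in>L2_H1 T \<Omega>. fatigue_damage_problem T \<Omega> \<alpha> \<beta> \<epsilon> H f ell q \<phi>"
      using system_exists problem_iff_system by blast
  next
    fix q1 \<phi>1 q2 \<phi>2
    assume 1: "q1 \<in> H10_L2 T \<Omega>" "\<phi>1 \<in> L2_H1 T \<Omega>" and 2: "q2 \<in> H10_L2 T \<Omega>" "\<phi>2 \<in> L2_H1 T \<Omega>"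
      and "fatigue_damage_problem T \<Omega> \<alpha> \<beta> \<epsilon> H f ell q1 \<phi>1 \<and>
        fatigue_damage_problem T \<Omega> \<alpha> \<beta> \<epsilon> H f ell q2 \<phi>2"
    then show "AE t in time T. L2_norm \<Omega> (q1 t - q2 t) = 0 \<and> H1_norm \<Omega> (\<phi>1 t - \<phi>2 t) = 0"
      using system_unique[OF 1 _ 2] problem_iff_system[OF 1] problem_iff_system[OF 2] by simp
  next
    fix q \<phi>
    assume "q \<in> H10_L2 T \<Omega>" "\<phi> \<in> L2_H1 T \<Omega>"
    then show "fatigue_damage_problem T \<Omega> \<alpha> \<beta> \<epsilon> H f ell q \<phi> \<longleftrightarrow> fatigue_damage_system T \<Omega> \<alpha> \<beta> \<epsilon> H f ell q \<phi>"
      by (rule problem_iff_system)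
  qed
qed

end
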